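(* Let $A$ be a maximal indecomposable cyclotomic matrix over $\mathbb{Z}[i]$ that has only zeros on the diagonal and whose nonzero entries are all units of $\mathbb{Z}[i]$. Then $A$ is equivalent to an adjacency matrix of one of the graphs $T_{2k}$ ($k\geqslant 3$), $T_{2k}^{(i)}$ ($k\geqslant 3$), $S_8^\dagger$, $S_{14}$, $S_{16}$.
   Context: **Matrices.** Let $R=\mathbb{Z}[i]$. A cyclotomic matrix over $R$ is a (finite, square) Hermitian matrix with entries in $R$ all of whose eigenvalues lie in $[-2,2]$. A Hermitian $R$-matrix is the adjacency matrix $(w(u,v))_{u,v}$ of a weighted directed graph ($R$-graph) with weight function $w$ satisfying $w(v,u)=\overline{w(u,v)}$; $w(v,v)$ is the charge of $v$. A matrix is indecomposable if its underlying graph (distinct $u,v$ adjacent iff $w(u,v)\neq 0$) is connected. An indecomposable cyclotomic $R$-matrix is maximal if it is not a (proper) principal submatrix of any other indecomposable cyclotomic $R$-matrix. Two $n\times n$ matrices $A,B$ over $R$ are equivalent if $A=\pm\sigma(QBQ^* )$ for some unitary matrix $Q$ with entries in $R$ ($QQ^*=Q^*Q=I$), some choice of sign, and $\sigma$ either the identity or complex conjugation applied entrywise. **Graphs.** Weights not determined by the listed ones via $w(v,u)=\overline{w(u,v)}$ are $0$. $T_{2k}$ ($k\ge 3$): vertices $t_j,b_j$, $j\in\mathbb{Z}/k$; for every $j$: $w(t_j,t_{j+1})=w(t_j,b_{j+1})=1$, $w(b_j,t_{j+1})=w(b_j,b_{j+1})=-1$. $T_{2k}^{(i)}$ ($k\ge3$):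 vertices $t_1,b_1,\dots,t_k,b_k$; for $1\le j\le k-1$ the same weights as in $T_{2k}$; and $w(t_k,t_1)=w(t_k,b_1)=i$, $w(b_k,t_1)=w(b_k,b_1)=-i$. $S_8^\dagger$: vertices $a,\dots,h$; weight $1$: $ab, cd, ef, gh, ac, ag, ce, fh$; weight $-1$: $bh, bd, eg, df$; $w(e,a)=w(g,c)=w(b,f)=w(d,h)=i$. $S_{14}$: vertices $o_j,n_j$, $j\in\mathbb{Z}/7$; $w(o_j,n_j)=w(o_j,n_{j+1})=w(o_j,n_{j+3})=1$, $w(o_j,n_{j-1})=-1$. $S_{16}$: vertices $o_j,n_j$, $j\in\mathbb{Z}/8$; $w(o_j,o_{j+1})=1$, $w(n_j,n_{j+3})=1$, $w(o_j,n_{j+1})=-1$, $w(o_j,n_{j-1})=1$. *)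

theory Defs
  imports
    "Jordan_Normal_Form.Char_Poly"
    "Jordan_Normal_Form.Schur_Decomposition"
    "Jordan_Normal_Form.DL_Submatrix"
    "Graph_Theory.Digraph_Component"
begin

section \<open>Matrices over the Gaussian integers\<close>

definition gauss_ints :: "complex set" where
  "gauss_ints = {z. Re z \<in> \<int> \<and> Im z \<in> \<int>}"

definition gauss_units :: "complex set" where
  "gauss_units = {z \<in> gauss_ints. \<exists>w \<in> gauss_ints. z * w = 1}"

definition cyclotomic_mat :: "complex mat \<Rightarrow> bool" where
  "cyclotomic_mat A \<longleftrightarrow>
     square_mat A \<and> elements_mat A \<subseteq> gauss_ints \<and> mat_adjoint A = A \<and>
     (\<forall>x. eigenvalue A x \<longrightarrow> x \<in> complex_of_real ` {-2..2})"

definition underlying_graph :: "complex mat \<Rightarrow> nat pair_pre_digraph" where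
  "underlying_graph A =
     \<lparr>pverts = {0..<dim_row A},
      parcs = {(u, v). u < dim_row A \<and> v < dim_row A \<and> u \<noteq> v \<and> A $$ (u, v) \<noteq> 0}\<rparr>"

(* The qualified name avoids the topological constant of the same name. Graph-theoretic
   connectedness in this library includes having at least one vertex. *)
definition indecomposable_mat :: "complex mat \<Rightarrow> bool" where
  "indecomposable_mat A \<longleftrightarrow> Digraph_Component.connected (with_proj (underlying_graph A))"

definition maximal_indecomposable_cyclotomic :: "complex mat \<Rightarrow> bool" where
  "maximal_indecomposable_cyclotomic A \<longleftrightarrow>
     cyclotomic_mat A \<and> indecomposable_mat A \<and>
     \<not> (\<exists>M I. cyclotomic_mat M \<and> indecomposable_mat M \<and>
          I \<subset> {0..<dim_row M} \<and> submatrix M I I = A)"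

definition gauss_unitary :: "nat \<Rightarrow> complex mat \<Rightarrow> bool" where
  "gauss_unitary n Q \<longleftrightarrow>
     Q \<in> carrier_mat n n \<and> elements_mat Q \<subseteq> gauss_ints \<and>
     Q * mat_adjoint Q = 1\<^sub>m n \<and> mat_adjoint Q * Q = 1\<^sub>m n"

definition equivalent_mat :: "complex mat \<Rightarrow> complex mat \<Rightarrow> bool" where
  "equivalent_mat A B \<longleftrightarrow>
     (\<exists>n Q s \<sigma>. A \<in> carrier_mat n n \<and> B \<in> carrier_mat n n \<and>
        elements_mat A \<subseteq> gauss_ints \<and> elements_mat B \<subseteq> gauss_ints \<and>
        gauss_unitary n Q \<and> s \<in> {1, -1} \<and> \<sigma> \<in> {id, cnj} \<and>
        A = s \<cdot>\<^sub>m map_mat \<sigma> (Q * B * mat_adjoint Q))"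


section \<open>Weighted graphs\<close>

(* A weighted graph is given by a vertex set V and a weight function w on it; its adjacency
   matrices are obtained by listing the vertices in an arbitrary order f. *)
definition is_adjacency_mat :: "'v set \<Rightarrow> ('v \<Rightarrow> 'v \<Rightarrow> complex) \<Rightarrow> complex mat \<Rightarrow> bool" where
  "is_adjacency_mat V w B \<longleftrightarrow>
     (\<exists>f. bij_betw f {0..<card V} V \<and>
          B = mat (card V) (card V) (\<lambda>(r, c). w (f r) (f c)))"

(* The graphs below are given by listing each edge in one direction only; this fills in the
   weights of the reversed edges. *)
definition hermitian_closure :: "('v \<Rightarrow> 'v \<Rightarrow> complex) \<Rightarrow> 'v \<Rightarrow> 'v \<Rightarrow> complex" where
  "hermitian_closure l u v = (if l u v \<noteq> 0 then l u v else cnj (l v u))"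

datatype T_vertex = Top nat | Bot nat

fun T_listed :: "nat \<Rightarrow> T_vertex \<Rightarrow> T_vertex \<Rightarrow> complex" where
  "T_listed k (Top i) (Top j) = (if j = (i + 1) mod k then 1 else 0)"
| "T_listed k (Top i) (Bot j) = (if j = (i + 1) mod k then 1 else 0)"
| "T_listed k (Bot i) (Top j) = (if j = (i + 1) mod k then -1 else 0)"
| "T_listed k (Bot i) (Bot j) = (if j = (i + 1) mod k then -1 else 0)"

definition T_verts :: "nat \<Rightarrow> T_vertex set" where
  "T_verts k = Top ` {0..<k} \<union> Bot ` {0..<k}"

(* The parameter k stands for the graph T_{2k} on 2k vertices. *)
definition T_weight :: "nat \<Rightarrow> T_vertex \<Rightarrow> T_vertex \<Rightarrow> complex" where
  "T_weight k = hermitian_closure (T_listed k)"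

(* Vertices of T_{2k}^{(i)} are numbered from 1 to k; the edges from column k back to column 1
   carry the additional factor i. *)
definition Ti_step :: "nat \<Rightarrow> nat \<Rightarrow> nat \<Rightarrow> complex" where
  "Ti_step k i j =
     (if 1 \<le> i \<and> i \<le> k - 1 \<and> j = i + 1 then 1
      else if i = k \<and> j = 1 then \<i> else 0)"

fun Ti_listed :: "nat \<Rightarrow> T_vertex \<Rightarrow> T_vertex \<Rightarrow> complex" where
  "Ti_listed k (Top i) (Top j) = Ti_step k i j"
| "Ti_listed k (Top i) (Bot j) = Ti_step k i j"
| "Ti_listed k (Bot i) (Top j) = - Ti_step k i j"
| "Ti_listed k (Bot i) (Bot j) = - Ti_step k i j"

definition Ti_verts :: "nat \<Rightarrow> T_vertex set" where
  "Ti_verts k = Top ` {1..k} \<union> Bot ` {1..k}"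

definition Ti_weight :: "nat \<Rightarrow> T_vertex \<Rightarrow> T_vertex \<Rightarrow> complex" where
  "Ti_weight k = hermitian_closure (Ti_listed k)"

datatype S8_vertex = Va | Vb | Vc | Vd | Ve | Vf | Vg | Vh

definition S8_listed :: "S8_vertex \<Rightarrow> S8_vertex \<Rightarrow> complex" where
  "S8_listed u v =
     (if (u, v) \<in> {(Va,Vb), (Vc,Vd), (Ve,Vf), (Vg,Vh), (Va,Vc), (Va,Vg), (Vc,Ve), (Vf,Vh)} then 1
      else if (u, v) \<in> {(Vb,Vh), (Vb,Vd), (Ve,Vg), (Vd,Vf)} then -1
      else if (u, v) \<in> {(Ve,Va), (Vg,Vc), (Vb,Vf), (Vd,Vh)} then \<i>
      else 0)"

definition S8_weight :: "S8_vertex \<Rightarrow> S8_vertex \<Rightarrow> complex" where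
  "S8_weight = hermitian_closure S8_listed"

datatype ON_vertex = Ov nat | Nv nat

definition ON_verts :: "nat \<Rightarrow> ON_vertex set" where
  "ON_verts m = Ov ` {0..<m} \<union> Nv ` {0..<m}"

(* Subtracting 1 modulo 7 is written as adding 6, and modulo 8 as adding 7. *)
fun S14_listed :: "ON_vertex \<Rightarrow> ON_vertex \<Rightarrow> complex" where
  "S14_listed (Ov i) (Nv j) =
     (if j = i \<or> j = (i + 1) mod 7 \<or> j = (i + 3) mod 7 then 1
      else if j = (i + 6) mod 7 then -1 else 0)"
| "S14_listed _ _ = 0"

definition S14_weight :: "ON_vertex \<Rightarrow> ON_vertex \<Rightarrow> complex" where
  "S14_weight = hermitian_closure S14_listed"

fun S16_listed :: "ON_vertex \<Rightarrow> ON_vertex \<Rightarrow> complex" where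
  "S16_listed (Ov i) (Ov j) = (if j = (i + 1) mod 8 then 1 else 0)"
| "S16_listed (Nv i) (Nv j) = (if j = (i + 3) mod 8 then 1 else 0)"
| "S16_listed (Ov i) (Nv j) =
     (if j = (i + 1) mod 8 then -1 else if j = (i + 7) mod 8 then 1 else 0)"
| "S16_listed (Nv i) (Ov j) = 0"

definition S16_weight :: "ON_vertex \<Rightarrow> ON_vertex \<Rightarrow> complex" where
  "S16_weight = hermitian_closure S16_listed"

end

theory Submission
  imports Defs "HOL-Analysis.Function_Topology" "HOL-Analysis.Topology_Euclidean_Space"
begin


text \<open>Call a vertex full if it has degree 4 and thin otherwise. The proof has two halves:
  maximality forces A^2 = 4I, and graphs with unit weights and A^2 = 4I are classified up to
  switching, that is, conjugation by a diagonal matrix of units.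

  Eigenvalues in [-2,2] mean that 2 + A and 2 - A are positive semidefinite
  (\<open>cyclotomic_two_bounded\<close>), hence so is 4 - A^2
  (\<open>two_bounded_imp_square\<close>). Its diagonal entries are 4 minus the degrees, so degrees
  are at most 4 and the row of a full vertex is orthogonal to all other rows
  (\<open>psd_kernel\<close>). To contradict maximality, A is bordered by a column c = (4 - A^2) z
  and a charge d; completing the square (\<open>bordered_nonneg\<close>) turns the spectral
  condition on the larger matrix into one scalar inequality, and \<open>not_maximal\<close> draws
  the conclusion. A unit vector z excludes degree 3; eigenvectors of A^2 supported on few vertices
  give forbidden configurations (\<open>no_kernel\<close>, \<open>no_double_eigenvector\<close>). If
  no vertex is full, the graph is a path or a cycle and extends explicitly
  (\<open>thin_extension\<close>). A thin vertex next to a full one always leads to a forbidden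
  configuration, so by connectivity every vertex is full (\<open>all_full\<close>).

  Now let A^2 = 4I. A vanishing sum of units has an even number of terms, so two distinct vertices
  share 0, 2 or 4 neighbours. Suppose that there are twins, that is, distinct vertices with the same
  four neighbours. Then some twin pair is joined to another one by a block of rank one
  (\<open>link_exists\<close>), each such block forces a next one (\<open>link_next\<close>), and
  the resulting ladder closes up by finiteness (\<open>ladder_closes\<close>). Switching removes all
  weights but one unit, the gain around the ladder (\<open>ladder_gauge\<close>); exchanging the
  members of one pair negates it, which leaves the gains 1 and i, that is, T_{2k} and T_{2k}^{(i)}.

  Without twins, two vertices with a common neighbour have exactly two, and the weights around each
  resulting quadrangle multiply to -1 (\<open>corner\<close>). Hence few weights determine the
  others, and switching normalises those on a spanning tree (\<open>tree_switch\<close>). A triangle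
  lies in a K_4 (\<open>triangle_extends\<close>), the graph is the product of K_4 with an edge, and
  triangle gains are i or -i: this is S_8^dagger. Without triangles, the vertices around a base
  vertex fit together in two ways only (\<open>S14_or_S16_of_triangle_free\<close>): the incidence
  graph of the complement of the Fano plane, which gives S_14, or the 4-cube, which gives S_16. In
  every case \<open>realize\<close> identifies the whole graph, and
  \<open>equivalent_of_represents\<close> returns to matrices.\<close>

section \<open>Units of Z[i] and the parity of sums of units\<close>

lemma Ints_norm_le_1: "(a::real) \<in> \<int> \<Longrightarrow> a * a \<le> 1 \<Longrightarrow> a = 0 \<or> a = 1 \<or> a = -1"
proof -
  assume a: "a \<in> \<int>" "a * a \<le> 1"
  then obtain k :: int where k: "a = of_int k" by (auto elim: Ints_cases)
  have "real_of_int (k * k) \<le> 1" using a(2) k by simp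
  hence "k * k \<le> 1" by linarith
  hence "\<bar>k\<bar> * \<bar>k\<bar> \<le> 1" by simp
  hence "\<bar>k\<bar> < 2" using mult_mono[of 2 "\<bar>k\<bar>" 2 "\<bar>k\<bar>"] by (cases "\<bar>k\<bar> < 2") auto
  hence "k = 0 \<or> k = 1 \<or> k = -1" by linarith
  thus ?thesis using k by auto
qed

lemma gauss_units_eq: "gauss_units = {1, -1, \<i>, -\<i>}"
proof
  show "{1, -1, \<i>, -\<i>} \<subseteq> gauss_units"
  proof -
    have "1 * 1 = (1::complex)" "-1 * -1 = (1::complex)" "\<i> * -\<i> = 1" "-\<i> * \<i> = 1" by simp_all
    moreover have "{1, -1, \<i>, -\<i>} \<subseteq> gauss_ints" by (auto simp: gauss_ints_def)
    ultimately show ?thesis unfolding gauss_units_def by blast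
  qed
  show "gauss_units \<subseteq> {1, -1, \<i>, -\<i>}"
  proof
    fix z assume "z \<in> gauss_units"
    then obtain u where z: "z \<in> gauss_ints" and u: "u \<in> gauss_ints" and zu: "z * u = 1"
      by (auto simp: gauss_units_def)
    obtain a b c d :: int where ab: "Re z = of_int a" "Im z = of_int b"
      and cd: "Re u = of_int c" "Im u = of_int d"
      using z u by (auto simp: gauss_ints_def elim!: Ints_cases)
    have "(cmod z)\<^sup>2 * (cmod u)\<^sup>2 = 1" using zu by (metis norm_mult norm_one power_mult_distrib power_one)
    hence e: "(Re z * Re z + Im z * Im z) * (Re u * Re u + Im u * Im u) = 1"
      unfolding cmod_power2 by (simp add: power2_eq_square)
    hence "real_of_int ((a*a + b*b) * (c*c + d*d)) = 1" using ab cd by simp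
    hence "(a*a + b*b) * (c*c + d*d) = 1" by linarith
    hence "a*a + b*b = 1" using zmult_eq_1_iff[of "a*a+b*b"] by (auto simp: add_nonneg_nonneg)
       (metis add_nonneg_nonneg not_one_le_zero zero_le_square le_minus_one_simps(1) order_trans zero_le_one neg_0_le_iff_le)
    hence n: "Re z * Re z + Im z * Im z = 1" using ab by (metis of_int_1 of_int_add of_int_mult)
    have "Re z * Re z \<le> 1" "Im z * Im z \<le> 1" using n
      by (smt (verit) zero_le_square)+
    hence "(Re z = 0 \<or> Re z = 1 \<or> Re z = -1) \<and> (Im z = 0 \<or> Im z = 1 \<or> Im z = -1)"
      using z Ints_norm_le_1 by (simp add: gauss_ints_def)
    thus "z \<in> {1, -1, \<i>, -\<i>}" using n by (auto simp: complex_eq_iff)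
  qed
qed

lemma gauss_units_cases [consumes 1, case_names one minus_one i minus_i]:
  assumes "z \<in> gauss_units"
  obtains "z = 1" | "z = -1" | "z = \<i>" | "z = -\<i>"
  using assms unfolding gauss_units_eq by auto

lemma gauss_units_closed [simp]:
  shows "1 \<in> gauss_units" "\<i> \<in> gauss_units"
    and "z \<in> gauss_units \<Longrightarrow> - z \<in> gauss_units"
    and "z \<in> gauss_units \<Longrightarrow> cnj z \<in> gauss_units"
    and "z \<in> gauss_units \<Longrightarrow> u \<in> gauss_units \<Longrightarrow> z * u \<in> gauss_units"
  by (auto simp: gauss_units_eq)

lemma gauss_units_mult_cnj [simp]:
  assumes "z \<in> gauss_units"
  shows "z * cnj z = 1" "cnj z * z = 1" "z * (cnj z * x) = x" "cnj z * (z * x) = x"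
  using assms by (auto simp: gauss_units_eq)

lemma gauss_units_norm [simp]: "z \<in> gauss_units \<Longrightarrow> cmod z = 1"
  by (auto simp: gauss_units_eq)

lemma gauss_units_nonzero [simp]: "0 \<notin> gauss_units"
  by (auto simp: gauss_units_eq)

lemma gauss_units_finite [simp]: "finite gauss_units" and card_gauss_units: "card gauss_units = 4"
  by (auto simp: gauss_units_eq complex_eq_iff)

lemma gauss_units_subset_ints: "z \<in> gauss_units \<Longrightarrow> z \<in> gauss_ints"
  by (simp add: gauss_units_def)

text \<open>Re + Im modulo 2 is reduction modulo 1 + i, which sends every unit to 1. A sum of units
  therefore remembers the parity of its number of terms.\<close>

lemma Re_Im_sum_units:
  assumes "finite S" "\<And>x. x \<in> S \<Longrightarrow> f x \<in> gauss_units"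
  shows "\<exists>k::int. Re (sum f S) + Im (sum f S) = real (card S) + 2 * of_int k"
  using assms
proof (induction S rule: finite_induct)
  case (insert x S)
  then obtain k :: int where "Re (sum f S) + Im (sum f S) = real (card S) + 2 * of_int k" by auto
  moreover have "\<exists>j::int. Re (f x) + Im (f x) = 1 + 2 * of_int j"
  proof -
    have "f x \<in> gauss_units" using insert by auto
    thus ?thesis
    proof (cases rule: gauss_units_cases)
      case minus_one thus ?thesis by (intro exI[of _ "-1"]) auto
    next
      case minus_i thus ?thesis by (intro exI[of _ "-1"]) auto
    qed (auto intro!: exI[of _ 0])
  qed
  then obtain j :: int where "Re (f x) + Im (f x) = 1 + 2 * of_int j" by auto
  ultimately show ?case using insert by (intro exI[of _ "k + j"]) auto
qed auto

lemma sum_units_zero_imp_even: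
  assumes "finite S" "\<And>x. x \<in> S \<Longrightarrow> f x \<in> gauss_units" "sum f S = 0"
  shows "even (card S)"
proof -
  have "\<exists>k::int. Re (sum f S) + Im (sum f S) = real (card S) + 2 * of_int k"
    by (rule Re_Im_sum_units) (use assms in auto)
  then obtain k :: int where "real (card S) + 2 * of_int k = 0"
    unfolding assms(3) by auto
  hence "real_of_int (int (card S) + 2 * k) = 0" by simp
  hence "int (card S) + 2 * k = 0" by linarith
  hence "even (int (card S))" by presburger
  thus ?thesis by simp
qed

lemma card_4_iff: "card A = 4 \<longleftrightarrow> (\<exists>a b c d. A = {a, b, c, d} \<and> distinct [a, b, c, d])"
proof
  assume "card A = 4"
  hence "card A = Suc 3" by simp
  then obtain a B where "A = insert a B" "a \<notin> B" "card B = 3" unfolding card_Suc_eq by blast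
  thus "\<exists>a b c d. A = {a, b, c, d} \<and> distinct [a, b, c, d]" unfolding card_3_iff by auto
qed auto

section \<open>Connected graphs with unit weights\<close>

text \<open>Connectivity is put as a closure principle (\<open>conn\<close>): later a property is
  shown for all vertices by checking that the vertices having it are closed under taking
  neighbours.\<close>

locale gauss_graph =
  fixes V :: "'a set" and w :: "'a \<Rightarrow> 'a \<Rightarrow> complex"
  assumes finite_verts: "finite V"
    and nonempty: "V \<noteq> {}"
    and supp: "w u v \<noteq> 0 \<Longrightarrow> u \<in> V"
    and herm: "w v u = cnj (w u v)"
    and loopless: "w v v = 0"
    and unit: "w u v \<noteq> 0 \<Longrightarrow> w u v \<in> gauss_units"
    and conn: "\<lbrakk>S \<subseteq> V; S \<noteq> {}; \<And>u v. u \<in> S \<Longrightarrow> w u v \<noteq> 0 \<Longrightarrow> v \<in> S\<rbrakk> \<Longrightarrow> S = V"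
begin

definition N :: "'a \<Rightarrow> 'a set" where "N u = {v. w u v \<noteq> 0}"

text \<open>The entry of A^2 at \<open>u\<close>, \<open>v\<close>; by \<open>herm\<close> also the
  Hermitian inner product of rows \<open>u\<close> and \<open>v\<close>.\<close>

definition ip :: "'a \<Rightarrow> 'a \<Rightarrow> complex" where "ip u v = (\<Sum>x\<in>V. w u x * w x v)"

lemma w_sym: "w u v \<noteq> 0 \<longleftrightarrow> w v u \<noteq> 0"
  using herm[of u v] by (metis complex_cnj_zero_iff)

lemma N_sym: "v \<in> N u \<longleftrightarrow> u \<in> N v"
  unfolding N_def using w_sym by auto

lemma N_symD: "v \<in> N u \<Longrightarrow> u \<in> N v"
  using N_sym by blast

lemma N_subset: "N u \<subseteq> V"
  unfolding N_def using w_sym supp by auto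

lemma N_verts: "v \<in> N u \<Longrightarrow> u \<in> V" "v \<in> N u \<Longrightarrow> v \<in> V"
  using N_subset N_sym by auto

lemma finite_N [simp]: "finite (N u)"
  using N_subset finite_verts finite_subset by blast

lemma N_irrefl [simp]: "u \<notin> N u"
  by (simp add: N_def loopless)

lemma w_inverse [simp]:
  assumes "v \<in> N u"
  shows "w u v * w v u = 1" "w u v * (w v u * x) = x" "x * w u v * w v u = x"
    and "w v u * w u v = 1" "w v u * (w u v * x) = x" "x * w v u * w u v = x"
proof -
  have "w u v \<in> gauss_units" using assms unit by (simp add: N_def)
  hence *: "w u v * w v u = 1" using herm[of v u] by simp
  show "w u v * w v u = 1" "w u v * (w v u * x) = x" "x * w u v * w v u = x"
    "w v u * w u v = 1" "w v u * (w u v * x) = x" "x * w v u * w u v = x"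
    using * by (simp_all add: mult.assoc [symmetric] mult.commute[of "w v u"])
qed

lemma w_unit: "v \<in> N u \<Longrightarrow> w u v \<in> gauss_units" "v \<in> N u \<Longrightarrow> w v u \<in> gauss_units"
  using unit w_sym by (auto simp: N_def)

lemma w_nonzero: "v \<in> N u \<Longrightarrow> w u v \<noteq> 0" and w_zero: "v \<notin> N u \<Longrightarrow> w u v = 0"
  by (auto simp: N_def)

lemma sum_N:
  assumes "\<And>x. x \<in> V \<Longrightarrow> f x \<noteq> 0 \<Longrightarrow> x \<in> N u"
  shows "(\<Sum>x\<in>V. f x) = (\<Sum>x\<in>N u. f x)"
  by (rule sum.mono_neutral_right[OF finite_verts N_subset]) (use assms in auto)

lemma ip_common: "ip u v = (\<Sum>x\<in>N u \<inter> N v. w u x * w x v)"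
  unfolding ip_def
  by (rule sum.mono_neutral_right[OF finite_verts])
     (use N_subset w_sym in \<open>auto simp: N_def\<close>)

lemma ip_zero_even:
  assumes "ip u v = 0" shows "even (card (N u \<inter> N v))"
proof (rule sum_units_zero_imp_even)
  show "sum (\<lambda>x. w u x * w x v) (N u \<inter> N v) = 0" using assms ip_common by simp
  show "w u x * w x v \<in> gauss_units" if "x \<in> N u \<inter> N v" for x
    using that w_unit by (intro gauss_units_closed(5)) auto
qed simp

lemma closed_eq: "\<lbrakk>S \<subseteq> V; S \<noteq> {}; \<And>u. u \<in> S \<Longrightarrow> N u \<subseteq> S\<rbrakk> \<Longrightarrow> S = V"
  by (rule conn) (auto simp: N_def)

end

section \<open>Switching equivalence, and graphs with A^2 = 4I\<close>

text \<open>Switching equivalence up to relabelling: \<open>g\<close> names the vertices and the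
  \<open>\<mu> p\<close> are the diagonal entries of a unitary matrix conjugating one weight
  function into the other.\<close>

definition represents :: "'a set \<Rightarrow> ('a \<Rightarrow> 'a \<Rightarrow> complex) \<Rightarrow> 'b set \<Rightarrow> ('b \<Rightarrow> 'b \<Rightarrow> complex) \<Rightarrow> bool" where
  "represents V w T l \<longleftrightarrow> (\<exists>g \<mu>. bij_betw g T V \<and> (\<forall>p\<in>T. \<mu> p \<in> gauss_units) \<and>
     (\<forall>p\<in>T. \<forall>q\<in>T. w (g p) (g q) = \<mu> p * l p q * cnj (\<mu> q)))"

lemma represents_switch:
  assumes "represents V (\<lambda>u v. \<nu> u * w u v * cnj (\<nu> v)) T l" "\<And>v. \<nu> v \<in> gauss_units"
  shows "represents V w T l"
proof -
  obtain g \<mu> where g: "bij_betw g T V" "\<forall>p\<in>T. \<mu> p \<in> gauss_units"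
    "\<forall>p\<in>T. \<forall>q\<in>T. \<nu> (g p) * w (g p) (g q) * cnj (\<nu> (g q)) = \<mu> p * l p q * cnj (\<mu> q)"
    using assms(1) unfolding represents_def by auto
  show ?thesis unfolding represents_def
  proof (intro exI conjI ballI)
    fix p q assume pq: "p \<in> T" "q \<in> T"
    have "w (g p) (g q) = cnj (\<nu> (g p)) * (\<nu> (g p) * w (g p) (g q) * cnj (\<nu> (g q))) * \<nu> (g q)"
      using assms(2)[of "g p"] assms(2)[of "g q"] by (simp add: mult.assoc)
    also have "\<dots> = (cnj (\<nu> (g p)) * \<mu> p) * l p q * cnj (cnj (\<nu> (g q)) * \<mu> q)"
      using g(3) pq by (simp add: mult_ac)
    finally show "w (g p) (g q) = (cnj (\<nu> (g p)) * \<mu> p) * l p q * cnj (cnj (\<nu> (g q)) * \<mu> q)" .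
  qed (use g assms(2) in auto)
qed

text \<open>The condition A^2 = 4I, split into its diagonal (\<open>deg\<close>) and off-diagonal
  (\<open>orth\<close>) entries.\<close>

locale weighing_graph = gauss_graph +
  assumes deg: "v \<in> V \<Longrightarrow> card (N v) = 4"
    and orth: "u \<noteq> v \<Longrightarrow> ip u v = 0"
begin

lemma even_common: "u \<noteq> v \<Longrightarrow> even (card (N u \<inter> N v))"
  using ip_zero_even orth by auto

lemma card_N_le: "card (N v) \<le> 4"
proof (cases "v \<in> V")
  case False
  hence "N v = {}" using N_verts(1) by blast
  thus ?thesis by simp
qed (simp add: deg)

text \<open>The number is even, positive and less than 4.\<close>

lemma card_common:
  assumes "u \<noteq> v" "x \<in> N u" "x \<in> N v" "N u \<noteq> N v"
  shows "card (N u \<inter> N v) = 2"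
proof -
  have c: "card (N u) = 4" "card (N v) = 4" using assms N_verts deg by auto
  have "card (N u \<inter> N v) \<noteq> 0" using assms by (auto simp: card_eq_0_iff)
  moreover have "card (N u \<inter> N v) < 4"
  proof (rule ccontr)
    assume "\<not> ?thesis"
    hence "card (N u \<inter> N v) \<ge> 4" by simp
    hence "N u \<inter> N v = N u" "N u \<inter> N v = N v"
      using c by (intro card_seteq; simp)+
    thus False using assms(4) by simp
  qed
  moreover obtain k where "card (N u \<inter> N v) = 2 * k" using even_common[OF assms(1)] by blast
  ultimately show ?thesis by auto
qed

text \<open>Checking the listed edges is enough. They already give every vertex four neighbours, so
  degree 4 in \<open>w\<close> leaves no room for further edges, and the image of \<open>T\<close>,
  being closed under neighbours, is all of \<open>V\<close> by connectivity.\<close>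

lemma realize:
  fixes g :: "'b \<Rightarrow> 'a"
  assumes T: "finite T" "T \<noteq> {}" "inj_on g T" "g ` T \<subseteq> V"
    and \<mu>: "\<And>p. p \<in> T \<Longrightarrow> \<mu> p \<in> gauss_units"
    and edges: "\<And>p q. p \<in> T \<Longrightarrow> q \<in> T \<Longrightarrow> l p q \<noteq> 0 \<Longrightarrow> w (g p) (g q) = \<mu> p * l p q * cnj (\<mu> q)"
    and reg: "\<And>p. p \<in> T \<Longrightarrow> \<exists>S\<subseteq>T. card S = 4 \<and> (\<forall>q\<in>S. l p q \<noteq> 0 \<or> l q p \<noteq> 0)"
  shows "represents V w T (hermitian_closure l)"
proof -
  define L where "L = hermitian_closure l"
  have eq: "w (g p) (g q) = \<mu> p * L p q * cnj (\<mu> q)" if "p \<in> T" "q \<in> T" "l p q \<noteq> 0 \<or> l q p \<noteq> 0" for p q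
  proof (cases "l p q = 0")
    case True
    hence "w (g q) (g p) = \<mu> q * l q p * cnj (\<mu> p)" using edges that by auto
    hence "w (g p) (g q) = \<mu> p * cnj (l q p) * cnj (\<mu> q)" using herm[of "g p" "g q"] by simp
    thus ?thesis using True by (simp add: L_def hermitian_closure_def)
  qed (use edges that in \<open>simp add: L_def hermitian_closure_def\<close>)
  have Lnz: "L p q \<noteq> 0 \<longleftrightarrow> l p q \<noteq> 0 \<or> l q p \<noteq> 0" for p q
    by (auto simp: L_def hermitian_closure_def)
  have nb: "\<exists>S\<subseteq>T. N (g p) = g ` S \<and> (\<forall>q\<in>S. L p q \<noteq> 0)" if p: "p \<in> T" for p
  proof -
    obtain S where S: "S \<subseteq> T" "card S = 4" "\<forall>q\<in>S. l p q \<noteq> 0 \<or> l q p \<noteq> 0" using reg p by blast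
    have "g ` S \<subseteq> N (g p)"
    proof
      fix y assume "y \<in> g ` S"
      then obtain q where q: "q \<in> S" "y = g q" by auto
      hence "w (g p) (g q) = \<mu> p * L p q * cnj (\<mu> q)" using eq p S by auto
      moreover have "L p q \<noteq> 0" using q S Lnz by auto
      moreover have "\<mu> p \<noteq> 0" "\<mu> q \<noteq> 0" using \<mu>[of p] \<mu>[of q] p q S by auto
      ultimately show "y \<in> N (g p)" using q by (simp add: N_def)
    qed
    moreover have "card (g ` S) = 4" using S T(3) by (metis card_image inj_on_subset)
    moreover have "card (N (g p)) = 4" using deg T p by auto
    ultimately have "g ` S = N (g p)" by (intro card_subset_eq) auto
    thus ?thesis using S Lnz by blast
  qed
  have im: "g ` T = V"
  proof (rule closed_eq)
    fix u assume "u \<in> g ` T"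
    thus "N u \<subseteq> g ` T" using nb by blast
  qed (use T(2,4) in simp_all)
  have "w (g p) (g q) = \<mu> p * L p q * cnj (\<mu> q)" if "p \<in> T" "q \<in> T" for p q
  proof (cases "L p q = 0")
    case True
    obtain S where S: "S \<subseteq> T" "N (g p) = g ` S" "\<forall>q\<in>S. L p q \<noteq> 0" using nb[OF \<open>p \<in> T\<close>] by blast
    have "g q \<notin> N (g p)"
    proof
      assume "g q \<in> N (g p)"
      then obtain q' where "q' \<in> S" "g q' = g q" using S by auto
      hence "q' = q" using T(3) S(1) that by (auto dest: inj_onD)
      thus False using \<open>q' \<in> S\<close> S True by auto
    qed
    thus ?thesis using True by (simp add: N_def)
  next
    case False
    thus ?thesis using eq[OF that] Lnz[of p q] by blast
  qed
  thus ?thesis unfolding represents_def L_def[symmetric]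
    using im T \<mu> by (intro exI[of _ g] exI[of _ \<mu>]) (auto simp: bij_betw_def)
qed

lemma switch:
  assumes "\<And>v. \<nu> v \<in> gauss_units"
  shows "weighing_graph V (\<lambda>u v. \<nu> u * w u v * cnj (\<nu> v))"
proof -
  have nz: "\<nu> v \<noteq> 0" for v using assms[of v] by auto
  have 1: "gauss_graph V (\<lambda>u v. \<nu> u * w u v * cnj (\<nu> v))"
  proof (unfold_locales; (rule finite_verts nonempty)?)
    fix u v assume "\<nu> u * w u v * cnj (\<nu> v) \<noteq> 0"
    hence "w u v \<noteq> 0" by auto
    thus "u \<in> V" "\<nu> u * w u v * cnj (\<nu> v) \<in> gauss_units" using supp unit assms by auto
  next
    fix S assume "S \<subseteq> V" "S \<noteq> {}" "\<And>u v. u \<in> S \<Longrightarrow> \<nu> u * w u v * cnj (\<nu> v) \<noteq> 0 \<Longrightarrow> v \<in> S"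
    thus "S = V" using conn[of S] nz by auto
  next
    fix u v show "\<nu> v * w v u * cnj (\<nu> u) = cnj (\<nu> u * w u v * cnj (\<nu> v))"
      using herm[of v u] by simp
  qed (simp add: loopless)
  interpret G: gauss_graph V "\<lambda>u v. \<nu> u * w u v * cnj (\<nu> v)" by (rule 1)
  show ?thesis
  proof
    show "v \<in> V \<Longrightarrow> card (G.N v) = 4" for v
      using deg nz by (simp add: G.N_def N_def)
    fix u v :: 'a assume "u \<noteq> v"
    have "G.ip u v = \<nu> u * ip u v * cnj (\<nu> v)"
      unfolding G.ip_def ip_def sum_distrib_left sum_distrib_right
    proof (rule sum.cong)
      fix x
      have "\<nu> u * w u x * cnj (\<nu> x) * (\<nu> x * w x v * cnj (\<nu> v))
        = \<nu> u * (w u x * w x v) * cnj (\<nu> v) * (cnj (\<nu> x) * \<nu> x)" by (simp only: mult_ac)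
      thus "\<nu> u * w u x * cnj (\<nu> x) * (\<nu> x * w x v * cnj (\<nu> v))
        = \<nu> u * (w u x * w x v) * cnj (\<nu> v)" by (simp only: gauss_units_mult_cnj[OF assms] mult_1_right)
    qed simp
    thus "G.ip u v = 0" using orth[OF \<open>u \<noteq> v\<close>] by simp
  qed
qed

end

section \<open>Normalising weights along a tree\<close>

fun tree_order :: "('a \<Rightarrow> 'a \<Rightarrow> complex) \<Rightarrow> ('a \<times> 'a \<times> complex) list \<Rightarrow> bool" where
  "tree_order w [] \<longleftrightarrow> True"
| "tree_order w ((c, p, t) # es) \<longleftrightarrow> c \<noteq> p \<and> c \<notin> fst ` set es \<and> c \<notin> (fst \<circ> snd) ` set es \<and>
     w c p \<in> gauss_units \<and> t \<in> gauss_units \<and> tree_order w es"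

text \<open>The list runs from the leaves to the root: every entry is an edge from a child to its parent
  together with the value that the edge is to have after switching.\<close>
lemma tree_switch:
  assumes "tree_order w es"
  shows "\<exists>\<nu>. (\<forall>v. \<nu> v \<in> gauss_units) \<and> (\<forall>(c, p, t) \<in> set es. \<nu> c * w c p * cnj (\<nu> p) = t)"
  using assms
proof (induction w es rule: tree_order.induct)
  case (1 w)
  show ?case by (auto intro!: exI[of _ "\<lambda>_. 1"])
next
  case (2 w c p t es)
  then obtain \<nu> where \<nu>: "\<forall>v. \<nu> v \<in> gauss_units" "\<forall>(c, p, t) \<in> set es. \<nu> c * w c p * cnj (\<nu> p) = t"
    by auto
  \<comment> \<open>\<open>c\<close> does not occur in \<open>es\<close>, so its factor can be reset
    without disturbing the other edges; this value solves the equation for the edge to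
    \<open>p\<close>.\<close>
  define \<nu>' where "\<nu>' = \<nu>(c := t * \<nu> p * cnj (w c p))"
  have "\<nu>' v \<in> gauss_units" for v using \<nu>(1) 2 by (auto simp: \<nu>'_def)
  moreover have "\<nu>' a * w a b * cnj (\<nu>' b) = s" if "(a, b, s) \<in> set ((c, p, t) # es)" for a b s
  proof (cases "(a, b, s) = (c, p, t)")
    case True
    hence "\<nu>' a * w a b * cnj (\<nu>' b) = t * (\<nu> p * cnj (\<nu> p)) * (w c p * cnj (w c p))"
      using 2(2) by (auto simp: \<nu>'_def mult_ac)
    thus ?thesis using 2(2) \<nu>(1) True by simp
  next
    case False
    hence "a \<noteq> c" "b \<noteq> c" "(a, b, s) \<in> set es" using that 2(2) by force+
    thus ?thesis using \<nu>(2) by (auto simp: \<nu>'_def)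
  qed
  ultimately show ?case by blast
qed

lemma (in weighing_graph) N_eqI:
  assumes "distinct [a, b, c, d]" "a \<in> N v" "b \<in> N v" "c \<in> N v" "d \<in> N v"
  shows "N v = {a, b, c, d}"
proof -
  have "card (N v) = 4" using assms(2) N_verts deg by blast
  moreover have "card {a, b, c, d} = 4" using assms(1) by simp
  ultimately have "{a, b, c, d} = N v" using assms by (intro card_subset_eq) auto
  thus ?thesis by simp
qed

lemma (in weighing_graph) N_cases:
  assumes "v \<in> V"
  obtains a b c d where "N v = {a, b, c, d}" "distinct [a, b, c, d]"
  using deg[OF assms] unfolding card_4_iff by blast

section \<open>Hermitian forms on a finite index set\<close>

definition app :: "'a set \<Rightarrow> ('a \<Rightarrow> 'a \<Rightarrow> complex) \<Rightarrow> ('a \<Rightarrow> complex) \<Rightarrow> 'a \<Rightarrow> complex" where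
  "app V a x i = (\<Sum>j\<in>V. a i j * x j)"

definition dot :: "'a set \<Rightarrow> ('a \<Rightarrow> complex) \<Rightarrow> ('a \<Rightarrow> complex) \<Rightarrow> complex" where
  "dot V x y = (\<Sum>i\<in>V. cnj (x i) * y i)"

lemma app_linear: "app V a (\<lambda>i. s * x i + t * y i) = (\<lambda>i. s * app V a x i + t * app V a y i)"
  by (auto simp: app_def sum_distrib_left sum.distrib distrib_left mult_ac)

lemma app_scale: "app V a (\<lambda>i. s * x i) = (\<lambda>i. s * app V a x i)"
  by (auto simp: app_def sum_distrib_left mult_ac)

lemma app_cong: "(\<And>i. i \<in> V \<Longrightarrow> x i = y i) \<Longrightarrow> app V a x = app V a y"
  by (auto simp: app_def intro!: sum.cong)

lemma dot_cong: "(\<And>i. i \<in> V \<Longrightarrow> x i = x' i) \<Longrightarrow> (\<And>i. i \<in> V \<Longrightarrow> y i = y' i) \<Longrightarrow> dot V x y = dot V x' y'"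
  by (auto simp: dot_def intro!: sum.cong)

lemma dot_add_right: "dot V x (\<lambda>i. s * y i + t * z i) = s * dot V x y + t * dot V x z"
  by (simp add: dot_def sum_distrib_left sum.distrib distrib_left mult_ac)

lemma dot_scale_right: "dot V x (\<lambda>i. s * y i) = s * dot V x y"
  by (simp add: dot_def sum_distrib_left mult_ac)

lemma cnj_dot: "cnj (dot V x y) = dot V y x"
  by (simp add: dot_def mult_ac)

lemma dot_add_left: "dot V (\<lambda>i. s * y i + t * z i) x = cnj s * dot V y x + cnj t * dot V z x"
proof -
  have "cnj (dot V x (\<lambda>i. s * y i + t * z i)) = cnj s * dot V y x + cnj t * dot V z x"
    unfolding dot_add_right by (simp add: cnj_dot)
  thus ?thesis by (simp add: cnj_dot)
qed

lemma dot_self: "dot V x x = of_real (\<Sum>i\<in>V. (cmod (x i))\<^sup>2)"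
  unfolding dot_def of_real_sum complex_norm_square by (simp add: mult.commute)

lemma dot_self_ge_0: "0 \<le> Re (dot V x x)"
  unfolding dot_self by (simp add: sum_nonneg)

lemma dot_app:
  assumes "\<And>i j. i \<in> V \<Longrightarrow> j \<in> V \<Longrightarrow> a j i = cnj (a i j)"
  shows "dot V x (app V a y) = dot V (app V a x) y"
proof -
  have "dot V x (app V a y) = (\<Sum>i\<in>V. \<Sum>j\<in>V. cnj (x i) * a i j * y j)"
    by (simp add: dot_def app_def sum_distrib_left mult.assoc)
  also have "\<dots> = (\<Sum>j\<in>V. \<Sum>i\<in>V. cnj (x i) * a i j * y j)" by (rule sum.swap)
  also have "\<dots> = (\<Sum>j\<in>V. \<Sum>i\<in>V. cnj (a j i * x i) * y j)"
    by (intro sum.cong refl) (metis assms complex_cnj_mult mult.commute)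
  also have "\<dots> = dot V (app V a x) y" by (simp add: dot_def app_def sum_distrib_right)
  finally show ?thesis .
qed

lemma Re_dot_swap: "Re (s * dot V x y) = Re (cnj s * dot V y x)"
  by (metis cnj.simps(1) cnj_dot complex_cnj_mult)

text \<open>If \<open>S\<close> were positive, the linear term would dominate for a small negative
  \<open>t\<close>.\<close>

lemma real_linear_plus_quadratic_nonneg:
  fixes S Q :: real
  assumes "\<And>t. 0 \<le> 2 * t * S + t\<^sup>2 * Q" "0 \<le> S"
  shows "S = 0"
proof (rule ccontr)
  assume "S \<noteq> 0"
  hence S: "S > 0" using assms by simp
  define t where "t = - S / (\<bar>Q\<bar> + 1)"
  have t: "t < 0" using S by (simp add: t_def divide_neg_pos)
  have "\<bar>t * Q\<bar> = S * (\<bar>Q\<bar> / (\<bar>Q\<bar> + 1))" using S by (simp add: t_def abs_mult abs_divide)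
  also have "\<dots> \<le> S * 1" using S by (intro mult_left_mono) auto
  finally have "0 < 2 * S + t * Q" using S by linarith
  hence "t * (2 * S + t * Q) < 0" using t by (simp add: mult_neg_pos)
  moreover have "0 \<le> t * (2 * S + t * Q)" using assms(1)[of t] by (simp add: power2_eq_square algebra_simps)
  ultimately show False by simp
qed

text \<open>A zero of a positive semidefinite form is a minimum, so the first variation vanishes
  there. In the direction y = A x this variation is 2 |A x|^2.\<close>

lemma psd_kernel:
  assumes fin: "finite V" and h: "\<And>i j. i \<in> V \<Longrightarrow> j \<in> V \<Longrightarrow> a j i = cnj (a i j)"
    and psd: "\<And>x. 0 \<le> Re (dot V x (app V a x))"
    and zero: "Re (dot V x (app V a x)) = 0"
    and "i \<in> V"
  shows "app V a x i = 0"
proof -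
  define y where "y = app V a x"
  have "Re (dot V y y) = 0"
  proof (rule real_linear_plus_quadratic_nonneg)
    fix t :: real
    have "dot V (\<lambda>i. 1 * x i + of_real t * y i) (app V a (\<lambda>i. 1 * x i + of_real t * y i))
      = dot V x y + of_real t * dot V x (app V a y) + of_real t * (dot V y y + of_real t * dot V y (app V a y))"
      unfolding app_linear dot_add_right dot_add_left by (simp add: y_def algebra_simps)
    also have "dot V x (app V a y) = dot V y y" unfolding y_def by (rule dot_app[OF h])
    finally have "Re (dot V (\<lambda>i. 1 * x i + of_real t * y i) (app V a (\<lambda>i. 1 * x i + of_real t * y i)))
      = 2 * t * Re (dot V y y) + t\<^sup>2 * Re (dot V y (app V a y))"
      using zero by (simp add: y_def power2_eq_square algebra_simps)
    thus "0 \<le> 2 * t * Re (dot V y y) + t\<^sup>2 * Re (dot V y (app V a y))" using psd by metis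
  qed (rule dot_self_ge_0)
  hence "(\<Sum>i\<in>V. (cmod (y i))\<^sup>2) = 0" by (simp add: dot_self)
  hence "(cmod (y i))\<^sup>2 = 0" using sum_nonneg_eq_0_iff[OF fin, of "\<lambda>i. (cmod (y i))\<^sup>2"] \<open>i \<in> V\<close> by auto
  thus ?thesis by (simp add: y_def)
qed

text \<open>Vectors are functions on the whole type, so they are fixed to be 0 off \<open>V\<close>.
  The sphere is then closed in a product of closed discs and points, which is compact by
  Tychonoff.\<close>

lemma compact_unit_sphere:
  assumes "finite V"
  shows "compact {x :: 'a \<Rightarrow> complex. (\<forall>i. i \<notin> V \<longrightarrow> x i = 0) \<and> (\<Sum>i\<in>V. (cmod (x i))\<^sup>2) = 1}" (is "compact ?K")
proof -
  define S where "S i = (if i \<in> V then cball 0 1 else {0 :: complex})" for i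
  have "compactin (product_topology (\<lambda>_. euclidean) UNIV) (PiE UNIV S)"
    unfolding compactin_PiE by (auto simp: S_def compact_cball)
  hence "compact (PiE UNIV S)" by (simp add: euclidean_product_topology)
  moreover have "closed ?K"
  proof -
    have "?K = (\<Inter>i\<in>-V. {x. x i = 0}) \<inter> {x. (\<Sum>i\<in>V. (cmod (x i))\<^sup>2) = 1}" by auto
    moreover have "closed {x :: 'a \<Rightarrow> complex. x i = 0}" for i
      by (intro closed_Collect_eq continuous_on_product_coordinates continuous_on_const)
    moreover have "closed {x :: 'a \<Rightarrow> complex. (\<Sum>i\<in>V. (cmod (x i))\<^sup>2) = 1}"
      by (intro closed_Collect_eq continuous_intros continuous_on_product_coordinates)
    ultimately show ?thesis by (auto intro!: closed_Int closed_INT)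
  qed
  moreover have "?K \<subseteq> PiE UNIV S"
  proof
    fix x assume x: "x \<in> ?K"
    have "cmod (x i) \<le> 1" if "i \<in> V" for i
    proof -
      have "(cmod (x i))\<^sup>2 \<le> (\<Sum>i\<in>V. (cmod (x i))\<^sup>2)" using assms that by (intro member_le_sum) auto
      thus ?thesis using x by (simp add: abs_square_le_1)
    qed
    thus "x \<in> PiE UNIV S" using x by (auto simp: S_def)
  qed
  ultimately have "compact (PiE UNIV S \<inter> ?K)" by (intro compact_Int_closed)
  moreover have "PiE UNIV S \<inter> ?K = ?K" using \<open>?K \<subseteq> PiE UNIV S\<close> by blast
  ultimately show ?thesis by simp
qed

text \<open>A minimiser of the Rayleigh quotient is an eigenvector.\<close>
lemma smallest_eigenvalue:
  assumes fin: "finite V" and ne: "V \<noteq> {}" and h: "\<And>i j. i \<in> V \<Longrightarrow> j \<in> V \<Longrightarrow> a j i = cnj (a i j)"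
  shows "\<exists>m x. (\<exists>i\<in>V. x i \<noteq> 0) \<and> (\<forall>i\<in>V. app V a x i = of_real m * x i) \<and>
    (\<forall>y. m * Re (dot V y y) \<le> Re (dot V y (app V a y)))"
proof -
  define K :: "('a \<Rightarrow> complex) set" where
    "K = {x. (\<forall>i. i \<notin> V \<longrightarrow> x i = 0) \<and> (\<Sum>i\<in>V. (cmod (x i))\<^sup>2) = 1}"
  obtain v where "v \<in> V" using ne by blast
  have "(\<lambda>i. if i = v then 1 else 0) \<in> K"
    using fin \<open>v \<in> V\<close> by (auto simp: K_def if_distrib[of cmod] if_distrib[of "\<lambda>x. x\<^sup>2"] cong: if_cong)
  hence ne: "K \<noteq> {}" by blast
  have cpt: "compact K" unfolding K_def by (rule compact_unit_sphere[OF fin])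
  have "continuous_on UNIV (\<lambda>x. Re (dot V x (app V a x)))"
    unfolding dot_def app_def
    by (intro continuous_on_Re continuous_on_sum continuous_on_mult continuous_on_cnj
        continuous_on_const continuous_on_product_coordinates)
  hence "continuous_on K (\<lambda>x. Re (dot V x (app V a x)))" by (rule continuous_on_subset) simp
  from continuous_attains_inf[OF cpt ne this]
  obtain x where x: "x \<in> K" "\<And>y. y \<in> K \<Longrightarrow> Re (dot V x (app V a x)) \<le> Re (dot V y (app V a y))"
    by blast
  define m where "m = Re (dot V x (app V a x))"
  have min: "m * Re (dot V y y) \<le> Re (dot V y (app V a y))" for y
  proof (cases "Re (dot V y y) = 0")
    case True
    hence "(\<Sum>i\<in>V. (cmod (y i))\<^sup>2) = 0" by (simp add: dot_self)
    hence "\<forall>i\<in>V. y i = 0" using sum_nonneg_eq_0_iff[OF fin, of "\<lambda>i. (cmod (y i))\<^sup>2"] by auto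
    thus ?thesis using True by (simp add: dot_def)
  next
    case False
    define r where "r = sqrt (Re (dot V y y))"
    have r: "r > 0" "r\<^sup>2 = Re (dot V y y)" using False dot_self_ge_0[of V y] by (auto simp: r_def)
    define z where "z i = (if i \<in> V then of_real (1 / r) * y i else 0)" for i
    have "(\<Sum>i\<in>V. (cmod (z i))\<^sup>2) = (\<Sum>i\<in>V. (cmod (y i))\<^sup>2) / r\<^sup>2"
      unfolding sum_divide_distrib using r
      by (intro sum.cong) (simp_all add: z_def norm_mult norm_divide power_mult_distrib power_divide)
    also have "\<dots> = 1" using r False by (simp add: dot_self)
    finally have "z \<in> K" by (simp add: K_def z_def)
    have "app V a z = app V a (\<lambda>i. of_real (1 / r) * y i)" by (rule app_cong) (simp add: z_def)
    also have "\<dots> = (\<lambda>i. of_real (1 / r) * app V a y i)" by (rule app_scale)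
    finally have "dot V z (app V a z) = dot V (\<lambda>i. of_real (1 / r) * y i) (\<lambda>i. of_real (1 / r) * app V a y i)"
      by (intro dot_cong) (simp_all add: z_def)
    also have "\<dots> = of_real (1 / r) * (of_real (1 / r) * dot V y (app V a y))"
      unfolding dot_scale_right using dot_add_left[of V "of_real (1 / r)" y 0 y] by simp
    finally have "Re (dot V z (app V a z)) = Re (dot V y (app V a y)) / r\<^sup>2"
      by (simp add: power2_eq_square)
    hence "m \<le> Re (dot V y (app V a y)) / r\<^sup>2" using x(2)[OF \<open>z \<in> K\<close>] by (simp add: m_def)
    moreover have "0 < r\<^sup>2" using r(1) by simp
    ultimately show ?thesis by (simp add: pos_le_divide_eq r(2))
  qed
  \<comment> \<open>Subtracting m times the identity leaves a positive semidefinite form that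
    vanishes at the minimiser \<open>x\<close>, so \<open>psd_kernel\<close> gives the eigenvector
    equation.\<close>
  define b where "b i j = a i j - (if i = j then of_real m else 0)" for i j
  have appb: "app V b y i = app V a y i + (- of_real m) * y i" if "i \<in> V" for y i
  proof -
    have "(\<Sum>j\<in>V. (if i = j then of_real m else 0) * y j) = of_real m * y i"
      using fin that by (simp add: if_distrib[of "\<lambda>c. c * _"] cong: if_cong)
    thus ?thesis by (simp add: app_def b_def left_diff_distrib sum_subtractf)
  qed
  have dotb: "Re (dot V y (app V b y)) = Re (dot V y (app V a y)) - m * Re (dot V y y)" for y
  proof -
    have "dot V y (app V b y) = dot V y (\<lambda>i. 1 * app V a y i + (- of_real m) * y i)"
      by (intro dot_cong) (simp_all add: appb)
    thus ?thesis unfolding dot_add_right by simp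
  qed
  have xx: "dot V x x = 1" using x(1) by (simp add: K_def dot_self)
  have "app V b x i = 0" if "i \<in> V" for i
  proof (rule psd_kernel[OF fin _ _ _ that])
    show "b j i = cnj (b i j)" if "i \<in> V" "j \<in> V" for i j using h[OF that] by (auto simp: b_def)
    show "0 \<le> Re (dot V y (app V b y))" for y using min[of y] by (simp add: dotb)
    show "Re (dot V x (app V b x)) = 0" using xx by (simp add: dotb m_def)
  qed
  hence "app V a x i = of_real m * x i" if "i \<in> V" for i
    using appb[OF that, of x] that by (simp add: add_eq_0_iff)
  moreover have "\<exists>i\<in>V. x i \<noteq> 0"
  proof (rule ccontr)
    assume "\<not> ?thesis"
    hence "dot V x x = 0" by (simp add: dot_def)
    thus False using xx by simp
  qed
  ultimately show ?thesis using min by blast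
qed

section \<open>Forms bounded by 2 and their extension by one coordinate\<close>

text \<open>For a Hermitian matrix: the spectrum lies in [-2,2], expressed by the quadratic
  form.\<close>

definition two_bounded :: "'a set \<Rightarrow> ('a \<Rightarrow> 'a \<Rightarrow> complex) \<Rightarrow> bool" where
  "two_bounded V a \<longleftrightarrow> (\<forall>x. \<bar>Re (dot V x (app V a x))\<bar> \<le> 2 * Re (dot V x x))"

lemma two_bounded_sign:
  assumes "two_bounded V a" "\<epsilon> = 1 \<or> \<epsilon> = -1"
  shows "0 \<le> 2 * Re (dot V x x) + \<epsilon> * Re (dot V x (app V a x))"
  using assms(1)[unfolded two_bounded_def, rule_format, of x] assms(2) by auto

text \<open>No diagonalisation is involved: the form of 2 + \<epsilon>A at (2 - \<epsilon>A) x is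
  that of (4 - A^2)(2 - \<epsilon>A) at x, and the sum over both signs is that of 4(4 -
  A^2).\<close>

lemma two_bounded_imp_square:
  assumes h: "\<And>i j. i \<in> V \<Longrightarrow> j \<in> V \<Longrightarrow> a j i = cnj (a i j)" and b: "two_bounded V a"
  shows "Re (dot V (app V a x) (app V a x)) \<le> 4 * Re (dot V x x)"
proof -
  let ?A = "app V a"
  have *: "Re (dot V x (?A (?A (?A x)))) = Re (dot V (?A x) (?A (?A x)))" by (simp add: dot_app[OF h])
  have x2: "dot V x (?A (?A x)) = dot V (?A x) (?A x)" "dot V (?A x) x = dot V x (?A x)"
    by (simp_all add: dot_app[OF h])
  have "0 \<le> 2 * Re (dot V (\<lambda>i. 2 * x i + (- \<epsilon>) * ?A x i) (\<lambda>i. 2 * x i + (- \<epsilon>) * ?A x i))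
     + \<epsilon> * Re (dot V (\<lambda>i. 2 * x i + (- \<epsilon>) * ?A x i) (?A (\<lambda>i. 2 * x i + (- \<epsilon>) * ?A x i)))"
    if "\<epsilon> = 1 \<or> \<epsilon> = -1" for \<epsilon> :: real
    using two_bounded_sign[OF b that] by blast
  from this[of 1] this[of "-1"] show ?thesis
    unfolding app_linear dot_add_right dot_add_left by (simp add: * x2 algebra_simps)
qed

text \<open>The extension by the column \<open>c = (4 - A\<^sup>2) z\<close>: the quadratic form of
  \<open>2 \<plusminus> A\<close> bordered by \<open>c\<close> and \<open>d\<close> is that of \<open>2 \<plusminus> A\<close> at a shifted point
  plus a nonnegative multiple of the square of the new coordinate.\<close>
lemma bordered_nonneg:
  assumes h: "\<And>i j. i \<in> V \<Longrightarrow> j \<in> V \<Longrightarrow> a j i = cnj (a i j)" and b: "two_bounded V a"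
    and c: "\<And>i. i \<in> V \<Longrightarrow> c i = 4 * z i - app V a (app V a z) i"
    and d: "\<bar>Re (dot V z (app V a c)) + d\<bar> \<le> 2 - 2 * Re (dot V z c)"
    and \<epsilon>: "\<epsilon> = 1 \<or> \<epsilon> = (-1 :: real)"
  shows "0 \<le> 2 * Re (dot V x x) + 2 * (cmod t)\<^sup>2
     + \<epsilon> * (Re (dot V x (app V a x)) + 2 * Re (t * dot V x c) + d * (cmod t)\<^sup>2)"
proof -
  let ?A = "app V a"
  \<comment> \<open>z' = (2 - \<epsilon>A) z is a preimage of c under P = 2 + \<epsilon>A.\<close>
  define z' where "z' = (\<lambda>i. 2 * z i + (- of_real \<epsilon>) * ?A z i)"
  define P where "P y = (\<lambda>i. 2 * y i + of_real \<epsilon> * ?A y i)" for y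
  \<comment> \<open>The point at which completing the square evaluates P.\<close>
  define y where "y = (\<lambda>i. 1 * x i + (of_real \<epsilon> * t) * z' i)"
  have \<epsilon>2: "complex_of_real \<epsilon> * of_real \<epsilon> = 1" "\<epsilon> * \<epsilon> = 1" using \<epsilon> by auto
  have "P z' i = c i" if "i \<in> V" for i
    unfolding P_def c[OF that] unfolding z'_def app_linear using \<epsilon> by auto
  hence Pz: "dot V v (P z') = dot V v c" "dot V (P z') v = dot V c v" for v
    by (intro dot_cong; simp)+
  have Psym: "dot V u (P v) = dot V (P u) v" for u v
    unfolding P_def dot_add_right dot_add_left by (simp add: dot_app[OF h])
  have Pad: "P y = (\<lambda>i. 1 * P x i + (of_real \<epsilon> * t) * P z' i)"
    unfolding P_def y_def app_linear by (auto simp: algebra_simps)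
  have "0 \<le> Re (dot V y (P y))"
    using two_bounded_sign[OF b \<epsilon>, of y] unfolding P_def dot_add_right by simp
  also have "dot V y (P y) = dot V x (P x) + of_real \<epsilon> * (t * dot V x c) + of_real \<epsilon> * (cnj t * dot V c x)
      + (t * cnj t) * dot V z' c"
    unfolding Pad dot_add_right unfolding y_def dot_add_left Pz using Psym[of z' x] \<epsilon>
    by (auto simp: Pz algebra_simps)
  also have "Re (cnj t * dot V c x) = Re (t * dot V x c)" by (rule Re_dot_swap[symmetric])
  hence "Re (dot V x (P x) + of_real \<epsilon> * (t * dot V x c) + of_real \<epsilon> * (cnj t * dot V c x) + (t * cnj t) * dot V z' c)
      = 2 * Re (dot V x x) + \<epsilon> * Re (dot V x (?A x)) + 2 * \<epsilon> * Re (t * dot V x c) + (cmod t)\<^sup>2 * Re (dot V z' c)"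
    unfolding P_def dot_add_right complex_norm_square[symmetric] by (simp flip: of_real_power)
  finally have main: "0 \<le> 2 * Re (dot V x x) + \<epsilon> * Re (dot V x (?A x)) + 2 * \<epsilon> * Re (t * dot V x c)
      + (cmod t)\<^sup>2 * Re (dot V z' c)" .
  \<comment> \<open>What remains is the coefficient of |t|^2: the Schur complement is nonnegative
    exactly when this product is at most 2 + \<epsilon>d, and \<open>d\<close> grants this for both
    signs.\<close>
  have "dot V z' c = 2 * dot V z c - of_real \<epsilon> * dot V z (?A c)"
    unfolding z'_def dot_add_left by (simp add: dot_app[OF h])
  hence "Re (dot V z' c) \<le> 2 + \<epsilon> * d" using d \<epsilon> by auto
  hence "(cmod t)\<^sup>2 * Re (dot V z' c) \<le> (cmod t)\<^sup>2 * (2 + \<epsilon> * d)" by (rule mult_left_mono) simp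
  thus ?thesis using main by (simp add: algebra_simps)
qed

lemma cmod_add_square: "(cmod (a + b))\<^sup>2 = (cmod a)\<^sup>2 + (cmod b)\<^sup>2 + 2 * Re (cnj a * b)"
  unfolding cmod_power2 by (simp add: power2_eq_square algebra_simps)

lemma Re_of_real_mult: "Re (of_real r * z) = r * Re z"
  by simp

section \<open>Extending a graph with all degrees at most 2\<close>

context gauss_graph
begin

definition edge_square :: "real \<Rightarrow> ('a \<Rightarrow> complex) \<Rightarrow> 'a \<Rightarrow> 'a \<Rightarrow> real" where
  "edge_square \<epsilon> x i j = (if j \<in> N i then (cmod (x i + of_real \<epsilon> * w i j * x j))\<^sup>2 else 0)"

lemma sum_if_N: "(\<Sum>j\<in>V. if j \<in> N i then f j else (0::real)) = (\<Sum>j\<in>N i. f j)"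
  using sum.inter_restrict[OF finite_verts, of f "N i"] N_subset[of i] by (simp add: Int_absorb1)

text \<open>As for a graph Laplacian, D + \<epsilon>A is a sum of squares over the edges, where D is
  the diagonal matrix of degrees. The sum runs over ordered pairs, whence the factor 2.\<close>

lemma sum_edge_squares:
  assumes \<epsilon>: "\<epsilon> = 1 \<or> \<epsilon> = -1"
  shows "(\<Sum>i\<in>V. \<Sum>j\<in>V. edge_square \<epsilon> x i j)
    = 2 * (\<Sum>i\<in>V. real (card (N i)) * (cmod (x i))\<^sup>2) + 2 * \<epsilon> * Re (dot V x (app V w x))"
proof -
  have "edge_square \<epsilon> x i j = (if j \<in> N i then (cmod (x i))\<^sup>2 else 0) + (if j \<in> N i then (cmod (x j))\<^sup>2 else 0)
      + 2 * \<epsilon> * Re (cnj (x i) * (w i j * x j))" for i j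
  proof (cases "j \<in> N i")
    case True
    have "cmod (of_real \<epsilon> * w i j * x j) = cmod (x j)"
      using \<epsilon> w_unit(1)[OF True] by (auto simp: norm_mult)
    moreover have "cnj (x i) * (of_real \<epsilon> * w i j * x j) = of_real \<epsilon> * (cnj (x i) * (w i j * x j))"
      by (simp only: mult_ac)
    hence "Re (cnj (x i) * (of_real \<epsilon> * w i j * x j)) = \<epsilon> * Re (cnj (x i) * (w i j * x j))"
      by (simp only: Re_of_real_mult)
    ultimately show ?thesis using True by (simp add: edge_square_def cmod_add_square)
  qed (simp add: edge_square_def w_zero)
  hence "(\<Sum>i\<in>V. \<Sum>j\<in>V. edge_square \<epsilon> x i j) = (\<Sum>i\<in>V. \<Sum>j\<in>V. if j \<in> N i then (cmod (x i))\<^sup>2 else 0)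
    + (\<Sum>i\<in>V. \<Sum>j\<in>V. if j \<in> N i then (cmod (x j))\<^sup>2 else 0) + (\<Sum>i\<in>V. \<Sum>j\<in>V. 2 * \<epsilon> * Re (cnj (x i) * (w i j * x j)))"
    by (simp add: sum.distrib)
  also have "(\<Sum>i\<in>V. \<Sum>j\<in>V. if j \<in> N i then (cmod (x j))\<^sup>2 else 0) = (\<Sum>i\<in>V. \<Sum>j\<in>V. if j \<in> N i then (cmod (x i))\<^sup>2 else 0)"
    by (subst sum.swap) (simp only: N_sym)
  also have "(\<Sum>i\<in>V. \<Sum>j\<in>V. if j \<in> N i then (cmod (x i))\<^sup>2 else 0) = (\<Sum>i\<in>V. real (card (N i)) * (cmod (x i))\<^sup>2)"
    by (simp only: sum_if_N sum_constant)
  also have "(\<Sum>i\<in>V. \<Sum>j\<in>V. 2 * \<epsilon> * Re (cnj (x i) * (w i j * x j))) = 2 * \<epsilon> * Re (dot V x (app V w x))"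
    unfolding dot_def app_def sum_distrib_left Re_sum ..
  finally show ?thesis by simp
qed

lemma edge_square_sym:
  assumes \<epsilon>: "\<epsilon> = 1 \<or> \<epsilon> = -1"
  shows "edge_square \<epsilon> x i j = edge_square \<epsilon> x j i"
proof (cases "j \<in> N i")
  case True
  have "of_real \<epsilon> * w i j * (x j + of_real \<epsilon> * w j i * x i) = x i + of_real \<epsilon> * w i j * x j"
  proof -
    have "of_real \<epsilon> * w i j * (x j + of_real \<epsilon> * w j i * x i)
      = of_real \<epsilon> * w i j * x j + (of_real \<epsilon> * of_real \<epsilon>) * (w i j * w j i) * x i"
      by (simp add: algebra_simps)
    thus ?thesis using \<epsilon> True by auto
  qed
  moreover have "cmod (of_real \<epsilon> * w i j * (x j + of_real \<epsilon> * w j i * x i)) = cmod (x j + of_real \<epsilon> * w j i * x i)"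
    using \<epsilon> w_unit(1)[OF True] by (auto simp: norm_mult)
  ultimately show ?thesis using True N_symD[OF True] by (simp add: edge_square_def)
qed (use N_symD in \<open>auto simp: edge_square_def\<close>)

text \<open>Every edge at \<open>v\<close> occurs in both orders in the double sum, and there are no
  loops.\<close>

lemma edge_squares_at:
  assumes \<epsilon>: "\<epsilon> = 1 \<or> \<epsilon> = -1" and v: "v \<in> V"
  shows "2 * (\<Sum>j\<in>V. edge_square \<epsilon> x v j) \<le> (\<Sum>i\<in>V. \<Sum>j\<in>V. edge_square \<epsilon> x i j)"
proof -
  let ?E = "edge_square \<epsilon> x"
  have nn: "0 \<le> ?E i j" for i j by (simp add: edge_square_def)
  have "(\<Sum>j\<in>V. ?E v j) = (\<Sum>i\<in>V. ?E i v)" by (simp only: edge_square_sym[OF \<epsilon>, of x v])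
  also have "\<dots> = (\<Sum>i\<in>V - {v}. ?E i v)"
    using sum.remove[OF finite_verts v, of "\<lambda>i. ?E i v"] by (simp add: edge_square_def)
  also have "\<dots> \<le> (\<Sum>i\<in>V - {v}. \<Sum>j\<in>V. ?E i j)"
    by (intro sum_mono member_le_sum) (use finite_verts v nn in auto)
  finally show ?thesis using sum.remove[OF finite_verts v, of "\<lambda>i. \<Sum>j\<in>V. ?E i j"] by linarith
qed

text \<open>2 + \<epsilon>A = (2 - D) + (D + \<epsilon>A), a sum of two nonnegative forms when
  degrees are at most 2. Of each form only the contribution of \<open>v\<close> is kept, which is
  all that an extension near \<open>v\<close> consumes.\<close>

lemma thin_form_lower:
  assumes thin: "\<And>i. i \<in> V \<Longrightarrow> card (N i) \<le> 2" and v: "v \<in> V" and \<epsilon>: "\<epsilon> = 1 \<or> \<epsilon> = -1"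
  shows "(\<Sum>j\<in>N v. (cmod (x v + of_real \<epsilon> * w v j * x j))\<^sup>2) + (2 - real (card (N v))) * (cmod (x v))\<^sup>2
    \<le> 2 * Re (dot V x x) + \<epsilon> * Re (dot V x (app V w x))"
proof -
  have "(2 - real (card (N v))) * (cmod (x v))\<^sup>2 \<le> (\<Sum>i\<in>V. (2 - real (card (N i))) * (cmod (x i))\<^sup>2)"
    using finite_verts v thin by (intro member_le_sum) auto
  also have "\<dots> = 2 * Re (dot V x x) - (\<Sum>i\<in>V. real (card (N i)) * (cmod (x i))\<^sup>2)"
    by (simp add: dot_self sum_distrib_left sum_subtractf left_diff_distrib)
  finally have "(2 - real (card (N v))) * (cmod (x v))\<^sup>2 \<le> 2 * Re (dot V x x) - (\<Sum>i\<in>V. real (card (N i)) * (cmod (x i))\<^sup>2)" .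
  moreover have "(\<Sum>j\<in>V. edge_square \<epsilon> x v j) = (\<Sum>j\<in>N v. (cmod (x v + of_real \<epsilon> * w v j * x j))\<^sup>2)"
    unfolding edge_square_def by (rule sum_if_N)
  ultimately show ?thesis using edge_squares_at[OF \<epsilon> v, of x] unfolding sum_edge_squares[OF \<epsilon>, of x] by linarith
qed

text \<open>The graph is a path or a cycle. An end vertex admits a new pendant vertex. On a cycle, a
  new vertex is joined to both neighbours of some \<open>v\<close> like a twin of \<open>v\<close>,
  with the sign of one edge reversed so that its row is orthogonal to that of \<open>v\<close>. In
  both cases the new vertex has charge 0.\<close>

lemma thin_extension:
  assumes thin: "\<And>i. i \<in> V \<Longrightarrow> card (N i) \<le> 2"
  obtains c where "\<And>i. c i \<in> gauss_ints" "\<exists>i\<in>V. c i \<noteq> 0"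
    "\<And>x t \<epsilon>. \<epsilon> = 1 \<or> \<epsilon> = -1 \<Longrightarrow> 0 \<le> 2 * Re (dot V x x) + 2 * (cmod t)\<^sup>2
       + \<epsilon> * (Re (dot V x (app V w x)) + 2 * Re (t * dot V x c) + 0 * (cmod t)\<^sup>2)"
proof (cases "\<exists>v\<in>V. card (N v) \<le> 1")
  case True
  then obtain v where v: "v \<in> V" "card (N v) \<le> 1" by blast
  \<comment> \<open>A pendant vertex at \<open>v\<close>; the slack 2 - deg v \<ge> 1 pays for the
    new edge.\<close>
  define c where "c i = (if i = v then 1 else 0 :: complex)" for i
  have dot: "dot V x c = cnj (x v)" for x
    using finite_verts v by (simp add: dot_def c_def if_distrib[of "\<lambda>y. _ * y"] cong: if_cong)
  show ?thesis
  proof (rule that[of c])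
    show "c i \<in> gauss_ints" for i by (auto simp: c_def gauss_ints_def)
    show "\<exists>i\<in>V. c i \<noteq> 0" using v by (auto simp: c_def)
    fix x t and \<epsilon> :: real assume \<epsilon>: "\<epsilon> = 1 \<or> \<epsilon> = -1"
    have "(cmod (x v))\<^sup>2 \<le> (2 - real (card (N v))) * (cmod (x v))\<^sup>2"
      using v(2) mult_right_mono[of 1 "2 - real (card (N v))" "(cmod (x v))\<^sup>2"] by simp
    moreover have "0 \<le> (\<Sum>j\<in>N v. (cmod (x v + of_real \<epsilon> * w v j * x j))\<^sup>2)" by (simp add: sum_nonneg)
    ultimately have "(cmod (x v))\<^sup>2 \<le> 2 * Re (dot V x x) + \<epsilon> * Re (dot V x (app V w x))"
      using thin_form_lower[OF thin v(1) \<epsilon>, of x] by linarith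
    moreover have "(cmod (x v + of_real \<epsilon> * t))\<^sup>2 = (cmod (x v))\<^sup>2 + (cmod t)\<^sup>2 + \<epsilon> * (2 * Re (t * cnj (x v)))"
      using \<epsilon> by (auto simp: cmod_add_square norm_mult)
    moreover have "0 \<le> (cmod (x v + of_real \<epsilon> * t))\<^sup>2" "0 \<le> (cmod t)\<^sup>2" by simp_all
    ultimately show "0 \<le> 2 * Re (dot V x x) + 2 * (cmod t)\<^sup>2
       + \<epsilon> * (Re (dot V x (app V w x)) + 2 * Re (t * dot V x c) + 0 * (cmod t)\<^sup>2)"
      unfolding dot distrib_left by linarith
  qed
next
  case False
  obtain v where v: "v \<in> V" using nonempty by blast
  hence "card (N v) = 2" using thin[OF v] False by force
  then obtain a b where ab: "N v = {a, b}" "a \<noteq> b" unfolding card_2_iff by blast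
  have abN: "a \<in> N v" "b \<in> N v" using ab by auto
  have abV: "a \<in> V" "b \<in> V" using abN N_subset by blast+
  \<comment> \<open>The twin of \<open>v\<close> with the edge to \<open>b\<close> negated.\<close>
  define c where "c i = (if i = a then w a v else if i = b then - w b v else 0)" for i
  have dot: "dot V x c = cnj (x a) * w a v - cnj (x b) * w b v" for x
  proof -
    have "dot V x c = (\<Sum>i\<in>{a, b}. cnj (x i) * c i)" unfolding dot_def
      by (rule sum.mono_neutral_right[OF finite_verts]) (use abV in \<open>auto simp: c_def\<close>)
    thus ?thesis using ab by (simp add: c_def)
  qed
  show ?thesis
  proof (rule that[of c])
    have "0 \<in> gauss_ints" by (simp add: gauss_ints_def)
    thus "c i \<in> gauss_ints" for i
      using w_unit[OF abN(1)] w_unit[OF abN(2)] gauss_units_subset_ints by (auto simp: c_def)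
    show "\<exists>i\<in>V. c i \<noteq> 0" using abV(1) w_nonzero[OF N_symD[OF abN(1)]] by (auto simp: c_def)
    fix x t and \<epsilon> :: real assume \<epsilon>: "\<epsilon> = 1 \<or> \<epsilon> = -1"
    define p where "p = x v + of_real \<epsilon> * w v a * x a"
    define q where "q = x v + of_real \<epsilon> * w v b * x b"
    have "(cmod p)\<^sup>2 + (cmod q)\<^sup>2 \<le> 2 * Re (dot V x x) + \<epsilon> * Re (dot V x (app V w x))"
      using thin_form_lower[OF thin v \<epsilon>, of x] ab \<open>card (N v) = 2\<close> by (simp add: p_def q_def)
    \<comment> \<open>Because of the opposite signs at \<open>a\<close> and \<open>b\<close>, moving
      the two edge terms p and q by t and -t produces exactly the cross term with \<open>c\<close>
      and the new diagonal term 2|t|^2.\<close>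
    moreover have "(cmod (p + t))\<^sup>2 + (cmod (q + - t))\<^sup>2 = (cmod p)\<^sup>2 + (cmod q)\<^sup>2 + 2 * (cmod t)\<^sup>2 + \<epsilon> * (2 * Re (t * dot V x c))"
    proof -
      have "cnj p - cnj q = of_real \<epsilon> * dot V x c"
        unfolding dot p_def q_def using herm[of a v] herm[of b v] by (simp add: algebra_simps)
      hence "Re ((cnj p - cnj q) * t) = \<epsilon> * Re (t * dot V x c)" using \<epsilon> by (auto simp: mult.commute)
      moreover have "Re ((cnj p - cnj q) * t) = Re (cnj p * t) - Re (cnj q * t)"
        by (simp only: left_diff_distrib minus_complex.sel)
      moreover have "Re (cnj q * - t) = - Re (cnj q * t)" "(cmod (- t))\<^sup>2 = (cmod t)\<^sup>2"
        "\<epsilon> * (2 * Re (t * dot V x c)) = 2 * (\<epsilon> * Re (t * dot V x c))" by simp_all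
      ultimately show ?thesis using cmod_add_square[of p t] cmod_add_square[of q "- t"] by linarith
    qed
    moreover have "0 \<le> (cmod (p + t))\<^sup>2 + (cmod (q + - t))\<^sup>2" by simp
    ultimately show "0 \<le> 2 * Re (dot V x x) + 2 * (cmod t)\<^sup>2
       + \<epsilon> * (Re (dot V x (app V w x)) + 2 * Re (t * dot V x c) + 0 * (cmod t)\<^sup>2)"
      unfolding distrib_left by linarith
  qed
qed

end

section \<open>From forms to matrices: bordering contradicts maximality\<close>

lemma mat_adjoint_index:
  assumes "i < dim_col A" "j < dim_row A"
  shows "mat_adjoint A $$ (i, j) = conjugate (A $$ (j, i))"
  using assms by (simp add: mat_adjoint_def mat_of_rows_index)

lemma dim_mat_adjoint: "dim_row (mat_adjoint A) = dim_col A" "dim_col (mat_adjoint A) = dim_row A"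
  by (simp_all add: mat_adjoint_def)

lemma cyclotomic_mat_D:
  assumes "cyclotomic_mat A"
  shows "dim_col A = dim_row A" "A \<in> carrier_mat (dim_row A) (dim_row A)"
    and "i < dim_row A \<Longrightarrow> j < dim_row A \<Longrightarrow> A $$ (i, j) \<in> gauss_ints"
    and "i < dim_row A \<Longrightarrow> j < dim_row A \<Longrightarrow> A $$ (j, i) = cnj (A $$ (i, j))"
proof -
  have A: "square_mat A" "elements_mat A \<subseteq> gauss_ints" "mat_adjoint A = A"
    using assms unfolding cyclotomic_mat_def by - (elim conjE; assumption)+
  show d: "dim_col A = dim_row A" using A(1) by simp
  thus c: "A \<in> carrier_mat (dim_row A) (dim_row A)" by (rule carrier_matI[OF refl])
  show "A $$ (i, j) \<in> gauss_ints" if "i < dim_row A" "j < dim_row A"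
    by (rule subsetD[OF A(2) elements_matI[OF c that refl]])
  show "A $$ (j, i) = cnj (A $$ (i, j))" if "i < dim_row A" "j < dim_row A"
  proof -
    have "A $$ (j, i) = mat_adjoint A $$ (j, i)" by (simp only: A(3))
    also have "\<dots> = conjugate (A $$ (i, j))" by (rule mat_adjoint_index) (use that d in simp_all)
    finally show ?thesis unfolding conjugate_complex_def .
  qed
qed

lemma eigenvalue_of_app:
  assumes A: "A \<in> carrier_mat n n" and x: "\<exists>i<n. x i \<noteq> 0"
    and ev: "\<And>i. i < n \<Longrightarrow> app {0..<n} (\<lambda>i j. A $$ (i, j)) x i = k * x i"
  shows "eigenvalue A k"
proof -
  have "A *\<^sub>v Matrix.vec n x = k \<cdot>\<^sub>v Matrix.vec n x"
    using A ev by (intro eq_vecI) (auto simp: scalar_prod_def app_def)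
  moreover have "Matrix.vec n x \<noteq> 0\<^sub>v n"
  proof
    assume eq: "Matrix.vec n x = 0\<^sub>v n"
    have "x i = 0" if "i < n" for i using arg_cong[OF eq, of "\<lambda>v. v $ i"] that by simp
    thus False using x by auto
  qed
  ultimately show ?thesis using A unfolding eigenvalue_def eigenvector_def by (intro exI[of _ "Matrix.vec n x"]) auto
qed

lemma eigenvalue_imp_app:
  assumes A: "A \<in> carrier_mat n n" and ev: "eigenvalue A k"
  shows "\<exists>x. (\<exists>i<n. x i \<noteq> 0) \<and> (\<forall>i<n. app {0..<n} (\<lambda>i j. A $$ (i, j)) x i = k * x i)"
proof -
  obtain v where "eigenvector A v k" using ev unfolding eigenvalue_def by blast
  hence v: "v \<in> carrier_vec n" "v \<noteq> 0\<^sub>v n" "A *\<^sub>v v = k \<cdot>\<^sub>v v"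
    unfolding eigenvector_def carrier_matD(1)[OF A] by simp_all
  show ?thesis
  proof (intro exI[of _ "\<lambda>i. v $ i"] conjI allI impI)
    show "\<exists>i<n. v $ i \<noteq> 0"
    proof (rule ccontr)
      assume "\<not> ?thesis"
      hence "v = 0\<^sub>v n" using v(1) by (intro eq_vecI) auto
      thus False using v(2) by blast
    qed
    fix i assume "i < n"
    have "(A *\<^sub>v v) $ i = k * v $ i" unfolding v(3) using v(1) \<open>i < n\<close> by simp
    thus "app {0..<n} (\<lambda>i j. A $$ (i, j)) (\<lambda>i. v $ i) i = k * v $ i"
      using A v(1) \<open>i < n\<close> by (simp add: scalar_prod_def app_def)
  qed
qed

text \<open>The smallest eigenvalues of A and of -A, found by minimising the form, bound it from
  both sides; the sign \<open>s\<close> treats both at once.\<close>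

lemma cyclotomic_two_bounded:
  assumes "cyclotomic_mat A"
  defines "a \<equiv> \<lambda>i j. A $$ (i, j)"
  shows "two_bounded {0..<dim_row A} a"
proof (cases "dim_row A = 0")
  case False
  define n where "n = dim_row A"
  have D: "A \<in> carrier_mat n n" "\<And>i j. i < n \<Longrightarrow> j < n \<Longrightarrow> a j i = cnj (a i j)"
    unfolding a_def n_def by (rule cyclotomic_mat_D[OF assms(1)]; assumption?)+
  have range: "-2 \<le> m \<and> m \<le> 2" if "eigenvalue A (complex_of_real m)" for m
    using that assms by (auto simp: cyclotomic_mat_def)
  have lower: "-2 * Re (dot {0..<n} y y) \<le> s * Re (dot {0..<n} y (app {0..<n} a y))" if s: "s = 1 \<or> s = (-1 :: real)" for s y
  proof -
    have app_s: "app {0..<n} (\<lambda>i j. of_real s * a i j) x = (\<lambda>i. of_real s * app {0..<n} a x i)" for x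
      by (rule ext) (simp add: app_def sum_distrib_left mult.assoc)
    have herm_s: "of_real s * a j i = cnj (of_real s * a i j)" if "i \<in> {0..<n}" "j \<in> {0..<n}" for i j
    proof -
      have "a j i = cnj (a i j)" by (rule D(2)) (use that in auto)
      thus ?thesis by simp
    qed
    have "finite {0..<n}" "{0..<n} \<noteq> {}" using False by (simp_all add: n_def)
    from smallest_eigenvalue[OF this, of "\<lambda>i j. of_real s * a i j", OF herm_s] obtain m x where
      x: "\<exists>i\<in>{0..<n}. x i \<noteq> 0"
      "\<forall>i\<in>{0..<n}. app {0..<n} (\<lambda>i j. of_real s * a i j) x i = of_real m * x i"
      "\<forall>y. m * Re (dot {0..<n} y y) \<le> Re (dot {0..<n} y (app {0..<n} (\<lambda>i j. of_real s * a i j) y))"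
      by blast
    have "app {0..<n} a x i = complex_of_real (s * m) * x i" if "i < n" for i
      using x(2)[rule_format, of i] that s by (auto simp: app_s) (metis minus_minus)
    hence "eigenvalue A (complex_of_real (s * m))"
      by (intro eigenvalue_of_app[OF D(1), of x]) (use x(1) in \<open>auto simp: a_def\<close>)
    hence "-2 \<le> m" using range[of "s * m"] s by auto
    hence "-2 * Re (dot {0..<n} y y) \<le> m * Re (dot {0..<n} y y)" by (intro mult_right_mono dot_self_ge_0)
    also have "\<dots> \<le> s * Re (dot {0..<n} y (app {0..<n} a y))"
      using x(3)[rule_format, of y] unfolding app_s dot_scale_right by simp
    finally show ?thesis .
  qed
  show ?thesis unfolding two_bounded_def n_def[symmetric]
  proof
    fix x
    show "\<bar>Re (dot {0..<n} x (app {0..<n} a x))\<bar> \<le> 2 * Re (dot {0..<n} x x)"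
      using lower[OF disjI1[OF refl], of x] lower[OF disjI2[OF refl], of x]
      unfolding mult_1_left mult_minus1 abs_le_iff by (intro conjI) linarith+
  qed
qed (simp add: two_bounded_def dot_def)

definition bordered :: "nat \<Rightarrow> (nat \<Rightarrow> nat \<Rightarrow> complex) \<Rightarrow> (nat \<Rightarrow> complex) \<Rightarrow> real \<Rightarrow> nat \<Rightarrow> nat \<Rightarrow> complex" where
  "bordered n a c d i j = (if i < n then if j < n then a i j else c i else if j < n then cnj (c j) else of_real d)"

lemma bordered_form:
  "Re (dot {0..<Suc n} x (app {0..<Suc n} (bordered n a c d) x))
    = Re (dot {0..<n} x (app {0..<n} a x)) + 2 * Re (x n * dot {0..<n} x c) + d * (cmod (x n))\<^sup>2"
proof -
  have 1: "app {0..<Suc n} (bordered n a c d) x i = 1 * app {0..<n} a x i + x n * c i" if "i < n" for i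
    using that by (simp add: app_def bordered_def)
  have 2: "app {0..<Suc n} (bordered n a c d) x n = dot {0..<n} c x + of_real d * x n"
    by (simp add: app_def bordered_def dot_def)
  have "dot {0..<Suc n} x (app {0..<Suc n} (bordered n a c d) x)
      = dot {0..<n} x (\<lambda>i. 1 * app {0..<n} a x i + x n * c i) + cnj (x n) * (dot {0..<n} c x + of_real d * x n)"
    unfolding dot_def[of "{0..<Suc n}"] using 2 by (simp add: dot_def 1)
  also have "\<dots> = dot {0..<n} x (app {0..<n} a x) + x n * dot {0..<n} x c + cnj (x n) * dot {0..<n} c x
      + of_real d * (x n * cnj (x n))"
    unfolding dot_add_right by (simp add: algebra_simps)
  finally show ?thesis using Re_dot_swap[of "x n" "{0..<n}" x c]
    unfolding complex_norm_square[symmetric] by (simp flip: of_real_power)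
qed

lemma mk_symmetric_underlying:
  "pverts (mk_symmetric (with_proj (underlying_graph A))) = {0..<dim_row A}"
  "parcs (mk_symmetric (with_proj (underlying_graph A)))
    = {(u, v). u < dim_row A \<and> v < dim_row A \<and> u \<noteq> v \<and> (A $$ (u, v) \<noteq> 0 \<or> A $$ (v, u) \<noteq> 0)}"
  by (auto simp: mk_symmetric_def underlying_graph_def)

text \<open>Connectivity in the closure form of \<open>conn\<close> in \<open>gauss_graph\<close>,
  which passes easily to bordered matrices.\<close>

definition closed_connected :: "nat \<Rightarrow> (nat \<Rightarrow> nat \<Rightarrow> complex) \<Rightarrow> bool" where
  "closed_connected n a \<longleftrightarrow> 0 < n \<and> (\<forall>S \<subseteq> {0..<n}. S \<noteq> {} \<longrightarrow>
     (\<forall>u \<in> S. \<forall>v < n. a u v \<noteq> 0 \<longrightarrow> v \<in> S) \<longrightarrow> S = {0..<n})"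

lemma closed_connectedD:
  assumes "closed_connected n a" "S \<subseteq> {0..<n}" "S \<noteq> {}" "\<And>u v. u \<in> S \<Longrightarrow> v < n \<Longrightarrow> a u v \<noteq> 0 \<Longrightarrow> v \<in> S"
  shows "S = {0..<n}"
proof -
  have imp: "S \<noteq> {} \<longrightarrow> (\<forall>u \<in> S. \<forall>v < n. a u v \<noteq> 0 \<longrightarrow> v \<in> S) \<longrightarrow> S = {0..<n}"
    using assms(1,2) unfolding closed_connected_def by (elim conjE allE[of _ S]) (erule mp)
  have "\<forall>u \<in> S. \<forall>v < n. a u v \<noteq> 0 \<longrightarrow> v \<in> S" using assms(4) by blast
  thus ?thesis by (rule mp[OF mp[OF imp assms(3)]])
qed

lemma closed_connected_cong:
  assumes "closed_connected n a" "\<And>i j. i < n \<Longrightarrow> j < n \<Longrightarrow> b i j = a i j"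
  shows "closed_connected n b"
  unfolding closed_connected_def
proof (intro conjI allI impI)
  show "0 < n" using assms(1) by (simp add: closed_connected_def)
  fix S assume S: "S \<subseteq> {0..<n}" "S \<noteq> {}" "\<forall>u\<in>S. \<forall>v<n. b u v \<noteq> 0 \<longrightarrow> v \<in> S"
  show "S = {0..<n}"
  proof (rule closed_connectedD[OF assms(1) S(1,2)])
    fix u v assume "u \<in> S" "v < n" "a u v \<noteq> 0"
    moreover have "u < n" using S(1) \<open>u \<in> S\<close> by auto
    ultimately show "v \<in> S" using S(3) assms(2)[of u v] by simp
  qed
qed

text \<open>The set of vertices reachable from a vertex is closed, and a closed set contains all
  that is reachable from its members; \<open>sym\<close> makes the symmetrised arc set equal to the
  arc set.\<close>

lemma indecomposable_mat_iff:
  assumes sym: "\<And>i j. i < dim_row A \<Longrightarrow> j < dim_row A \<Longrightarrow> A $$ (i, j) \<noteq> 0 \<Longrightarrow> A $$ (j, i) \<noteq> 0"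
  shows "indecomposable_mat A \<longleftrightarrow> closed_connected (dim_row A) (\<lambda>i j. A $$ (i, j))"
proof -
  define n where "n = dim_row A"
  define R where "R = {(u, v). u < n \<and> v < n \<and> u \<noteq> v \<and> A $$ (u, v) \<noteq> 0}"
  have R: "parcs (mk_symmetric (with_proj (underlying_graph A))) = R"
    unfolding mk_symmetric_underlying R_def n_def using sym by blast
  have ind: "indecomposable_mat A \<longleftrightarrow> 0 < n \<and> (\<forall>u<n. \<forall>v<n. (u, v) \<in> rtrancl_on {0..<n} R)"
    unfolding indecomposable_mat_def Digraph_Component.connected_def strongly_connected_def reachable_def
      with_proj_simps R mk_symmetric_underlying(1) by (auto simp: n_def)
  show ?thesis unfolding n_def[symmetric]
  proof
    assume I: "indecomposable_mat A"
    show "closed_connected n (\<lambda>i j. A $$ (i, j))" unfolding closed_connected_def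
    proof (intro conjI allI impI)
      show "0 < n" using I ind by blast
      fix S assume S: "S \<subseteq> {0..<n}" "S \<noteq> {}" "\<forall>u\<in>S. \<forall>v<n. A $$ (u, v) \<noteq> 0 \<longrightarrow> v \<in> S"
      then obtain u where u: "u \<in> S" by blast
      have in_S: "v \<in> S" if "(u, v) \<in> rtrancl_on {0..<n} R" for v
        using that
      proof (induction rule: rtrancl_on_induct)
        case base thus ?case using u by simp
      next
        case (step y z) thus ?case using S by (auto simp: R_def)
      qed
      have "u < n" using u S(1) by auto
      hence "(u, v) \<in> rtrancl_on {0..<n} R" if "v < n" for v using I[unfolded ind] that by simp
      thus "S = {0..<n}" using S(1) in_S by auto
    qed
  next
    assume C: "closed_connected n (\<lambda>i j. A $$ (i, j))"
    have reach: "(u, v) \<in> rtrancl_on {0..<n} R" if "u < n" "v < n" for u v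
    proof -
      define S where "S = {v \<in> {0..<n}. (u, v) \<in> rtrancl_on {0..<n} R}"
      have "u \<in> S" using that by (auto simp: S_def intro: rtrancl_on_refl)
      moreover have "z \<in> S" if "y \<in> S" "z < n" "A $$ (y, z) \<noteq> 0" for y z
      proof (cases "y = z")
        case False
        hence "(y, z) \<in> R" using that by (auto simp: R_def S_def)
        thus ?thesis using that by (auto simp: S_def intro: rtrancl_on_into_rtrancl_on)
      qed (use that in simp)
      moreover have "S \<subseteq> {0..<n}" by (auto simp: S_def)
      ultimately have "S = {0..<n}" by (intro closed_connectedD[OF C]) blast+
      hence "v \<in> S" using that by simp
      thus ?thesis by (simp add: S_def)
    qed
    have "0 < n" using C unfolding closed_connected_def by (elim conjE)
    thus "indecomposable_mat A" unfolding ind using reach by blast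
  qed
qed

text \<open>The edge between the new vertex and some \<open>i\<close> with \<open>c i\<close>
  nonzero carries a closed set across in either direction.\<close>

lemma closed_connected_bordered:
  assumes "closed_connected n a" "\<exists>i<n. c i \<noteq> 0"
  shows "closed_connected (Suc n) (bordered n a c d)"
  unfolding closed_connected_def
proof (intro conjI allI impI)
  fix S assume S: "S \<subseteq> {0..<Suc n}" "S \<noteq> {}" "\<forall>u\<in>S. \<forall>v<Suc n. bordered n a c d u v \<noteq> 0 \<longrightarrow> v \<in> S"
  obtain i where i: "i < n" "c i \<noteq> 0" using assms(2) by blast
  have "S \<inter> {0..<n} \<noteq> {}"
  proof (cases "n \<in> S")
    case True
    hence "i \<in> S" using S(3) i by (auto simp: bordered_def)
    thus ?thesis using i by auto
  next
    case False
    obtain u where "u \<in> S" using S(2) by blast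
    moreover have "u \<noteq> n" using False \<open>u \<in> S\<close> by blast
    ultimately show ?thesis using S(1) by force
  qed
  moreover have "\<forall>u\<in>S \<inter> {0..<n}. \<forall>v<n. a u v \<noteq> 0 \<longrightarrow> v \<in> S \<inter> {0..<n}"
    using S(3) by (auto simp: bordered_def)
  ultimately have eq: "S \<inter> {0..<n} = {0..<n}"
    by (intro closed_connectedD[OF assms(1)]) auto
  hence sub: "{0..<n} \<subseteq> S" by blast
  hence "i \<in> S" using i by (auto simp: subset_iff)
  hence "n \<in> S" using S(3) i by (auto simp: bordered_def)
  thus "S = {0..<Suc n}" using sub S(1) by (auto simp: less_Suc_eq subset_iff)
qed simp

text \<open>The bordered matrix is the witness: \<open>form\<close> bounds its quadratic form by 2,
  a nonzero \<open>c\<close> keeps it connected, and \<open>A\<close> is its leading principal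
  submatrix.\<close>

lemma not_maximal:
  assumes cyc: "cyclotomic_mat A" and ind: "indecomposable_mat A"
  defines "n \<equiv> dim_row A" and "a \<equiv> \<lambda>i j. A $$ (i, j)"
  assumes c: "\<And>i. i < n \<Longrightarrow> c i \<in> gauss_ints" "\<exists>i<n. c i \<noteq> 0" and d: "d \<in> \<int>"
    and form: "\<And>x t \<epsilon>. \<epsilon> = 1 \<or> \<epsilon> = -1 \<Longrightarrow> 0 \<le> 2 * Re (dot {0..<n} x x) + 2 * (cmod t)\<^sup>2
       + \<epsilon> * (Re (dot {0..<n} x (app {0..<n} a x)) + 2 * Re (t * dot {0..<n} x c) + d * (cmod t)\<^sup>2)"
  shows "\<not> maximal_indecomposable_cyclotomic A"
proof -
  define b where "b = bordered n a c d"
  define M where "M = Matrix.mat (Suc n) (Suc n) (\<lambda>(i, j). b i j)"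
  have M: "M \<in> carrier_mat (Suc n) (Suc n)" "dim_row M = Suc n" "dim_col M = Suc n" by (auto simp: M_def)
  have Mij: "M $$ (i, j) = b i j" if "i < Suc n" "j < Suc n" for i j using that by (simp add: M_def)
  have herm_a: "a j i = cnj (a i j)" if "i < n" "j < n" for i j
    using that unfolding a_def n_def by (rule cyclotomic_mat_D(4)[OF cyc])
  have herm: "b j i = cnj (b i j)" if "i < Suc n" "j < Suc n" for i j
    using herm_a[of i j] that by (cases "i < n"; cases "j < n") (simp_all add: b_def bordered_def)
  have bZ: "b i j \<in> gauss_ints" if "i < Suc n" "j < Suc n" for i j
  proof -
    have "cnj z \<in> gauss_ints" if "z \<in> gauss_ints" for z using that by (auto simp: gauss_ints_def)
    thus ?thesis using cyclotomic_mat_D(3)[OF cyc] c(1) d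
      by (auto simp: b_def bordered_def a_def n_def gauss_ints_def)
  qed
  have bnd: "\<bar>Re (dot {0..<Suc n} x (app {0..<Suc n} b x))\<bar> \<le> 2 * Re (dot {0..<Suc n} x x)" for x
  proof -
    have "Re (dot {0..<Suc n} x x) = Re (dot {0..<n} x x) + (cmod (x n))\<^sup>2" by (simp add: dot_self)
    thus ?thesis using form[of 1 x "x n", OF disjI1[OF refl]] form[of "-1" x "x n", OF disjI2[OF refl]]
      unfolding b_def bordered_form mult_1_left mult_minus1 abs_le_iff by (intro conjI) linarith+
  qed
  \<comment> \<open>At an eigenvector the form equals x times the squared norm; Hermitian symmetry
    makes x real, and the bound on the form gives |x| \<le> 2.\<close>
  have "x \<in> complex_of_real ` {-2..2}" if ev: "eigenvalue M x" for x
  proof -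
    obtain v where v: "\<exists>i<Suc n. v i \<noteq> 0"
      "\<forall>i<Suc n. app {0..<Suc n} (\<lambda>i j. M $$ (i, j)) v i = x * v i"
      using eigenvalue_imp_app[OF M(1) ev] by blast
    have app: "app {0..<Suc n} b v i = x * v i" if "i < Suc n" for i
      using v(2)[rule_format, OF that] that by (simp add: app_def Mij)
    have dotx: "dot {0..<Suc n} v (app {0..<Suc n} b v) = x * dot {0..<Suc n} v v"
      unfolding dot_scale_right[symmetric] by (intro dot_cong) (simp_all add: app)
    have "Re (dot {0..<Suc n} v v) \<noteq> 0"
    proof
      assume "Re (dot {0..<Suc n} v v) = 0"
      hence "(\<Sum>i\<in>{0..<Suc n}. (cmod (v i))\<^sup>2) = 0" by (simp only: dot_self Re_complex_of_real)
      hence "\<forall>i\<in>{0..<Suc n}. (cmod (v i))\<^sup>2 = 0"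
        using sum_nonneg_eq_0_iff[of "{0..<Suc n}" "\<lambda>i. (cmod (v i))\<^sup>2"] by auto
      thus False using v(1) by auto
    qed
    hence pos: "0 < Re (dot {0..<Suc n} v v)" using dot_self_ge_0[of "{0..<Suc n}" v] by linarith
    define s where "s = Re (dot {0..<Suc n} v v)"
    have ds: "dot {0..<Suc n} v v = of_real s" by (simp only: s_def dot_self Re_complex_of_real)
    have "dot {0..<Suc n} v (app {0..<Suc n} b v) = dot {0..<Suc n} (app {0..<Suc n} b v) v"
      by (rule dot_app, rule herm) simp_all
    also have "\<dots> = cnj (dot {0..<Suc n} v (app {0..<Suc n} b v))" by (simp only: cnj_dot)
    finally have "x * of_real s = cnj (x * of_real s)" unfolding dotx ds .
    hence "x * of_real s = cnj x * of_real s" by simp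
    moreover have "s \<noteq> 0" using pos by (simp add: s_def)
    ultimately have "x = cnj x" by simp
    hence "Im x = - Im x" by (metis cnj.simps(2))
    hence x: "x = of_real (Re x)" by (simp add: complex_eq_iff)
    have "\<bar>Re x * s\<bar> \<le> 2 * s" using bnd[of v] unfolding dotx ds by simp
    hence "\<bar>Re x\<bar> * s \<le> 2 * s" using pos by (simp add: abs_mult s_def)
    hence "\<bar>Re x\<bar> \<le> 2" using pos by (simp add: s_def)
    thus ?thesis using x by (intro image_eqI[of _ _ "Re x"]) (auto simp: abs_le_iff)
  qed
  moreover have "mat_adjoint M = M"
  proof (rule eq_matI)
    fix i j assume "i < dim_row M" "j < dim_col M"
    thus "mat_adjoint M $$ (i, j) = M $$ (i, j)"
      using herm[of j i] M(2,3) by (simp add: mat_adjoint_index Mij)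
  qed (simp_all add: dim_mat_adjoint M(2,3))
  moreover have "elements_mat M \<subseteq> gauss_ints"
  proof
    fix x assume "x \<in> elements_mat M"
    then obtain i j where "i < Suc n" "j < Suc n" "x = M $$ (i, j)" 
      using elements_matD[of x M] unfolding M(2,3) by blast
    thus "x \<in> gauss_ints" using bZ by (simp add: Mij)
  qed
  ultimately have "cyclotomic_mat M" using M by (auto simp: cyclotomic_mat_def)
  moreover have "indecomposable_mat M"
  proof -
    have cl: "closed_connected n a"
      unfolding n_def a_def
      by (rule indecomposable_mat_iff[THEN iffD1, OF _ ind]) (metis complex_cnj_zero_iff cyclotomic_mat_D(4)[OF cyc])
    have "closed_connected (Suc n) b" unfolding b_def by (rule closed_connected_bordered[OF cl c(2)])
    hence "closed_connected (dim_row M) (\<lambda>i j. M $$ (i, j))"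
      unfolding M(2) by (rule closed_connected_cong) (simp add: Mij)
    moreover have "M $$ (j, i) \<noteq> 0" if "i < dim_row M" "j < dim_row M" "M $$ (i, j) \<noteq> 0" for i j
      using that herm[of i j] by (simp add: M(2) Mij)
    ultimately show ?thesis using indecomposable_mat_iff[of M] by blast
  qed
  moreover have "submatrix M {0..<n} {0..<n} = A"
  proof -
    have set: "{i. i < Suc n \<and> i \<in> {0..<n}} = {0..<n}" by auto
    have pick: "pick {0..<n} i = i" if "i < n" for i
    proof -
      have "{a \<in> {0..<n}. a < i} = {0..<i}" using that by auto
      thus ?thesis using pick_card_in_set[of i "{0..<n}"] that by simp
    qed
    show ?thesis unfolding submatrix_def M(2,3) set
    proof (rule eq_matI)
      fix i j assume "i < dim_row A" "j < dim_col A"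
      hence ij: "i < n" "j < n" using cyclotomic_mat_D(1)[OF cyc] by (simp_all add: n_def)
      have "b i j = A $$ (i, j)" unfolding b_def bordered_def a_def using ij by simp
      thus "Matrix.mat (card {0..<n}) (card {0..<n}) (\<lambda>(i, j). M $$ (pick {0..<n} i, pick {0..<n} j)) $$ (i, j) = A $$ (i, j)"
        using ij by (simp add: pick[OF ij(1)] pick[OF ij(2)] Mij)
    qed (simp_all add: n_def cyclotomic_mat_D(1)[OF cyc])
  qed
  moreover have "{0..<n} \<subset> {0..<dim_row M}" using M by auto
  ultimately have "\<exists>M I. cyclotomic_mat M \<and> indecomposable_mat M \<and> I \<subset> {0..<dim_row M} \<and> submatrix M I I = A"
    by (intro exI[of _ M] exI[of _ "{0..<n}"] conjI)
  thus ?thesis unfolding maximal_indecomposable_cyclotomic_def by (intro notI) (elim conjE notE)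
qed

section \<open>In a maximal graph every vertex has degree 4\<close>

lemma sum_gauss_units_square: "(\<Sum>z\<in>gauss_units. z * z) = 0"
  by (simp add: gauss_units_eq complex_eq_iff)

text \<open>What the combinatorial argument uses of maximality. \<open>no_extension\<close> is
  bordering with charge 0 by an eigenvector \<open>c\<close> of A^2 with eigenvalue
  \<open>l\<close>, for z = c / (4 - l); the bound on the norm of \<open>c\<close> is the scalar
  inequality of \<open>bordered_nonneg\<close>.\<close>

locale maximal_graph = gauss_graph +
  assumes deg_le: "card (N v) \<le> 4"
    and deg_neq_3: "card (N v) \<noteq> 3"
    and full_orth: "card (N v) = 4 \<Longrightarrow> u \<noteq> v \<Longrightarrow> ip u v = 0"
    and full_exists: "\<exists>v\<in>V. card (N v) = 4"
    and no_extension: "\<lbrakk>\<And>x. c x \<in> gauss_ints; \<exists>x\<in>V. c x \<noteq> 0;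
      \<And>x. x \<in> V \<Longrightarrow> (\<Sum>y\<in>V. w x y * (\<Sum>z\<in>V. w y z * c z)) = complex_of_real l * c x;
      (\<Sum>x\<in>V. cnj (c x) * (\<Sum>y\<in>V. w x y * c y)) = 0;
      l < 4; (\<Sum>x\<in>V. (cmod (c x))\<^sup>2) + l \<le> 4\<rbrakk> \<Longrightarrow> False"
begin

lemma deg_le_2: "card (N v) \<noteq> 4 \<Longrightarrow> card (N v) \<le> 2"
  using deg_le[of v] deg_neq_3[of v] by linarith

lemma sum_supported:
  assumes "S \<subseteq> V"
  shows "(\<Sum>y\<in>V. g y * (if y \<in> S then c y else 0)) = (\<Sum>y\<in>S. g y * c y :: complex)"
proof -
  have "(\<Sum>y\<in>S. g y * c y) = (\<Sum>y\<in>S. g y * (if y \<in> S then c y else 0))" by simp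
  also have "\<dots> = (\<Sum>y\<in>V. g y * (if y \<in> S then c y else 0))"
    by (rule sum.mono_neutral_left[OF finite_verts assms]) auto
  finally show ?thesis ..
qed

lemma sum_norm_supported:
  assumes "S \<subseteq> V" "\<And>x. x \<in> S \<Longrightarrow> c x \<in> gauss_units"
  shows "(\<Sum>x\<in>V. (cmod (if x \<in> S then c x else 0))\<^sup>2) = card S"
proof -
  have "(\<Sum>x\<in>V. (cmod (if x \<in> S then c x else 0))\<^sup>2) = (\<Sum>x\<in>S. (cmod (if x \<in> S then c x else 0))\<^sup>2)"
    by (rule sum.mono_neutral_right[OF finite_verts assms(1)]) auto
  also have "\<dots> = (\<Sum>x\<in>S. 1)" using assms(2) by (intro sum.cong) auto
  finally show ?thesis by simp
qed

text \<open>Eigenvalue 0: the norm bound allows four unit entries.\<close>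

lemma no_kernel:
  assumes "S \<subseteq> V" "S \<noteq> {}" "card S \<le> 4" "\<And>x. x \<in> S \<Longrightarrow> c x \<in> gauss_units"
    and "\<And>u. u \<in> V \<Longrightarrow> (\<Sum>y\<in>S. w u y * c y) = 0"
  shows False
proof (rule no_extension[of "\<lambda>x. if x \<in> S then c x else 0" 0])
  show "(if x \<in> S then c x else 0) \<in> gauss_ints" for x
    using assms(4)[of x] gauss_units_subset_ints by (auto simp: gauss_ints_def)
  show "\<exists>x\<in>V. (if x \<in> S then c x else 0) \<noteq> 0" using assms by fastforce
  show "(\<Sum>x\<in>V. (cmod (if x \<in> S then c x else 0))\<^sup>2) + 0 \<le> 4"
    using sum_norm_supported[OF assms(1,4)] assms(3) by simp
qed (use assms in \<open>simp_all add: sum_supported\<close>)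

lemma no_kernel_pair:
  assumes "a \<in> V" "b \<in> V" "a \<noteq> b" "\<alpha> \<in> gauss_units" "\<beta> \<in> gauss_units"
    and "\<And>u. u \<in> V \<Longrightarrow> w u a * \<alpha> + w u b * \<beta> = 0"
  shows False
  by (rule no_kernel[of "{a, b}" "\<lambda>x. if x = a then \<alpha> else \<beta>"]) (use assms in auto)

text \<open>A sends c to d and d back to c, so c is an eigenvector of A^2 for the eigenvalue 1; it
  is orthogonal to A c since the supports are disjoint. The norm bound allows 4 - 1 = 3 unit
  entries.\<close>

lemma no_double_eigenvector:
  assumes "S \<subseteq> V" "S \<noteq> {}" "card S \<le> 3" "\<And>x. x \<in> S \<Longrightarrow> c x \<in> gauss_units" "T \<subseteq> V" "S \<inter> T = {}"
    and c: "\<And>u. u \<in> V \<Longrightarrow> (\<Sum>y\<in>S. w u y * c y) = (if u \<in> T then d u else 0)"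
    and d: "\<And>u. u \<in> V \<Longrightarrow> (\<Sum>y\<in>T. w u y * d y) = (if u \<in> S then c u else 0)"
  shows False
proof (rule no_extension[of "\<lambda>x. if x \<in> S then c x else 0" 1])
  show "(if x \<in> S then c x else 0) \<in> gauss_ints" for x
    using assms(4)[of x] gauss_units_subset_ints by (auto simp: gauss_ints_def)
  show "\<exists>x\<in>V. (if x \<in> S then c x else 0) \<noteq> 0" using assms(1,2,4) by fastforce
  show "(\<Sum>x\<in>V. (cmod (if x \<in> S then c x else 0))\<^sup>2) + 1 \<le> 4"
    using sum_norm_supported[OF assms(1,4)] assms(3) by simp
  show "(\<Sum>x\<in>V. cnj (if x \<in> S then c x else 0) * (\<Sum>y\<in>V. w x y * (if y \<in> S then c y else 0))) = 0"
    using assms(6) by (intro sum.neutral) (auto simp: sum_supported[OF assms(1)] c)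
  show "(\<Sum>y\<in>V. w x y * (\<Sum>z\<in>V. w y z * (if z \<in> S then c z else 0))) = complex_of_real 1 * (if x \<in> S then c x else 0)"
    if "x \<in> V" for x
  proof -
    have "(\<Sum>y\<in>V. w x y * (\<Sum>z\<in>V. w y z * (if z \<in> S then c z else 0))) = (\<Sum>y\<in>V. w x y * (if y \<in> T then d y else 0))"
      by (intro sum.cong) (simp_all add: sum_supported[OF assms(1)] c)
    thus ?thesis using that by (simp add: sum_supported[OF assms(5)] d)
  qed
qed simp

lemma even_common: "card (N v) = 4 \<Longrightarrow> u \<noteq> v \<Longrightarrow> even (card (N u \<inter> N v))"
  using full_orth ip_zero_even by blast

text \<open>On the common neighbours \<open>c\<close> is a multiple of column \<open>v\<close>, so
  the sum is that multiple of \<open>ip u v\<close>, which is 0 because \<open>v\<close> is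
  full.\<close>

lemma sum_row:
  assumes "u \<noteq> v" "card (N v) = 4" "\<And>y. y \<in> N u \<inter> N v \<Longrightarrow> c y = \<epsilon> * w y v"
  shows "(\<Sum>y\<in>N v. w u y * c y) = 0"
proof -
  have "(\<Sum>y\<in>N v. w u y * c y) = (\<Sum>y\<in>N u \<inter> N v. w u y * c y)"
    by (rule sum.mono_neutral_right) (use w_zero in auto)
  also have "\<dots> = (\<Sum>y\<in>N u \<inter> N v. \<epsilon> * (w u y * w y v))"
    by (rule sum.cong) (use assms(3) in \<open>simp_all add: mult_ac\<close>)
  also have "\<dots> = \<epsilon> * ip u v" by (simp add: ip_common sum_distrib_left)
  finally show ?thesis using full_orth[OF assms(2,1)] by simp
qed

text \<open>Otherwise the neighbourhood of \<open>v\<close> carries a kernel vector: up to signs it is the row of a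
  twin of \<open>v\<close>.\<close>
lemma full_neighbour:
  assumes "card (N v) = 4"
  shows "\<exists>s\<in>N v. card (N s) = 4"
proof (rule ccontr)
  assume "\<not> ?thesis"
  hence small: "card (N x) \<le> 2" if "x \<in> N v" for x using that deg_le_2 by blast
  have vN: "v \<in> N x" if "x \<in> N v" for x using that N_symD by blast
  have two: "N x = {v, u}" if "x \<in> N v" "u \<in> N x" "u \<noteq> v" for x u
    using card_seteq[of "N x" "{v, u}"] small[OF that(1)] vN[OF that(1)] that by auto
  \<comment> \<open>Two vertices share an even number of neighbours. The cases are: some
    \<open>u\<close> shares exactly two with \<open>v\<close>; otherwise every other vertex shares
    none, or all four and is then a twin of \<open>v\<close>.\<close>
  show False
  proof (cases "\<exists>u. u \<noteq> v \<and> card (N u \<inter> N v) = 2")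
    case True
    then obtain u a b where u: "u \<noteq> v" and ab: "N u \<inter> N v = {a, b}" "a \<noteq> b"
      unfolding card_2_iff by blast
    have abv: "a \<in> N v" "b \<in> N v" "a \<in> N u" "b \<in> N u" using ab by auto
    have "card (N v - {a, b}) = 2" using assms ab abv by (simp add: card_Diff_subset)
    then obtain c d where cd: "N v - {a, b} = {c, d}" "c \<noteq> d" unfolding card_2_iff by blast
    have Nv: "N v = {a, b, c, d}" "distinct [a, b, c, d]" using cd abv ab by auto
    \<comment> \<open>Column \<open>v\<close> with its signs reversed on \<open>c\<close> and
      \<open>d\<close>. Row \<open>v\<close> gives 1 + 1 - 1 - 1, row \<open>u\<close> sees only
      \<open>a\<close> and \<open>b\<close>, and the other rows miss \<open>a\<close> and
      \<open>b\<close>, whose neighbours are just \<open>v\<close> and \<open>u\<close>.\<close>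
    define k where "k y = (if y = a \<or> y = b then w y v else - w y v)" for y
    show False
    proof (rule no_kernel[of "N v" k])
      show "k x \<in> gauss_units" if "x \<in> N v" for x using that w_unit by (auto simp: k_def)
      fix u'
      have ab_u: "u' = v \<or> u' = u" if "a \<in> N u' \<or> b \<in> N u'"
        using two[of a u] two[of b u] that abv u N_symD by blast
      consider "u' = v" | "u' = u" "u' \<noteq> v" | "u' \<noteq> u" "u' \<noteq> v" by blast
      thus "(\<Sum>y\<in>N v. w u' y * k y) = 0"
      proof cases
        case 1
        have "c \<in> N v" "d \<in> N v" using Nv by auto
        thus ?thesis unfolding 1 using Nv(2) abv by (auto simp: Nv(1) k_def)
      next
        case 2
        show ?thesis by (rule sum_row[OF 2(2) assms, of k 1]) (use 2 ab in \<open>auto simp: k_def\<close>)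
      next
        case 3
        show ?thesis by (rule sum_row[OF 3(2) assms, of k "-1"]) (use 3 ab_u in \<open>auto simp: k_def\<close>)
      qed
    qed (use assms N_subset in auto)
  next
    case False
    have all_or_none: "N u \<inter> N v = {} \<or> N u = N v" if "u \<noteq> v" for u
    proof -
      obtain k where k: "card (N u \<inter> N v) = 2 * k" using even_common[OF assms \<open>u \<noteq> v\<close>] by blast
      have "card (N u \<inter> N v) \<le> 4" using assms card_mono[of "N v" "N u \<inter> N v"] by auto
      hence "card (N u \<inter> N v) = 0 \<or> card (N u \<inter> N v) = 4" using False that k by auto
      thus ?thesis
      proof
        assume "card (N u \<inter> N v) = 4"
        hence "N u \<inter> N v = N v" "N u \<inter> N v = N u"
          using assms deg_le[of u] by (intro card_seteq; simp)+
        thus ?thesis by simp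
      qed (simp add: card_eq_0_iff)
    qed
    show False
    proof (cases "\<exists>u. u \<noteq> v \<and> N u = N v \<and> inj_on (\<lambda>x. w u x * w x v) (N v)")
      case True
      then obtain u where u: "u \<noteq> v" "N u = N v" "inj_on (\<lambda>x. w u x * w x v) (N v)" by blast
      \<comment> \<open>The ratios between the twin rows \<open>u\<close> and \<open>v\<close>.
        Being injective, they run through all four units, so both their sum (row \<open>v\<close>)
        and the sum of their squares (row \<open>u\<close>) vanish.\<close>
      define f where "f x = w u x * w x v" for x
      have fu: "f x \<in> gauss_units" if "x \<in> N v" for x
        using that u w_unit by (auto simp: f_def intro!: gauss_units_closed(5))
      show False
      proof (rule no_kernel[of "N v" "\<lambda>x. f x * w x v"])
        show "f x * w x v \<in> gauss_units" if "x \<in> N v" for x using fu that w_unit by auto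
        fix u'
        have fv: "sum f (N v) = 0" using full_orth[OF assms u(1)] u(2) by (simp add: ip_common f_def)
        have inj: "inj_on f (N v)" using u(3) by (simp add: f_def[abs_def])
        hence "f ` N v = gauss_units"
          using fu assms card_gauss_units by (intro card_subset_eq) (auto simp: card_image)
        hence "(\<Sum>x\<in>N v. f x * f x) = 0"
          using sum.reindex[OF inj, of "\<lambda>z. z * z"] sum_gauss_units_square by simp
        moreover have "(\<Sum>y\<in>N v. w u y * (f y * w y v)) = (\<Sum>y\<in>N v. f y * f y)"
          by (rule sum.cong) (simp_all add: f_def mult_ac)
        moreover have "(\<Sum>y\<in>N v. w v y * (f y * w y v)) = sum f (N v)"
          by (rule sum.cong) (simp_all add: mult.left_commute[of "w v _"])
        ultimately have "(\<Sum>y\<in>N v. w u' y * (f y * w y v)) = 0" if "u' = u \<or> u' = v"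
          using that fv by auto
        moreover have "(\<Sum>y\<in>N v. w u' y * (f y * w y v)) = 0" if "u' \<noteq> u" "u' \<noteq> v"
        proof (rule sum.neutral, safe)
          fix y assume y: "y \<in> N v"
          hence "N y = {v, u}" using two[of y u] u N_symD by blast
          hence "u' \<notin> N y" using that by auto
          hence "y \<notin> N u'" using N_symD by blast
          thus "w u' y * (f y * w y v) = 0" by (simp add: w_zero)
        qed
        ultimately show "(\<Sum>y\<in>N v. w u' y * (f y * w y v)) = 0" by blast
      qed (use assms N_subset in auto)
    next
      case noninj: False
      \<comment> \<open>If a twin has a repeated ratio, then at the two places where it repeats the
        columns are proportional; if there is no twin, all neighbours of \<open>v\<close> have
        degree 1 and any two will do. The difference of the normalised columns gives a kernel
        vector.\<close>
      have "\<exists>a b. a \<in> N v \<and> b \<in> N v \<and> a \<noteq> b \<and> (\<forall>u. w u a * w a v = w u b * w b v)"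
      proof (cases "\<exists>u. u \<noteq> v \<and> N u = N v")
        case True
        then obtain u where u: "u \<noteq> v" "N u = N v" by blast
        then obtain a b where ab: "a \<in> N v" "b \<in> N v" "a \<noteq> b" "w u a * w a v = w u b * w b v"
          using noninj unfolding inj_on_def by blast
        have "a \<in> N u" "b \<in> N u" using ab u by auto
        hence "N a = {v, u}" "N b = {v, u}" using two u ab N_symD by blast+
        hence "a \<notin> N u'" "b \<notin> N u'" if "u' \<noteq> v" "u' \<noteq> u" for u' using that N_symD by blast+
        hence "w u' a * w a v = w u' b * w b v" for u'
          using ab by (cases "u' = v"; cases "u' = u") (auto simp: w_zero)
        thus ?thesis using ab by blast
      next
        case False
        have "2 \<le> card (N v)" using assms by simp
        then obtain a b where ab: "a \<in> N v" "b \<in> N v" "a \<noteq> b" by (meson card_2_iff' obtain_subset_with_card_n subsetD)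
        have "a \<notin> N u" "b \<notin> N u" if "u \<noteq> v" for u using all_or_none[OF that] False that ab by blast+
        hence "w u a * w a v = w u b * w b v" for u using ab by (cases "u = v") (auto simp: w_zero)
        thus ?thesis using ab by blast
      qed
      then obtain a b where ab: "a \<in> N v" "b \<in> N v" "a \<noteq> b" "\<And>u. w u a * w a v = w u b * w b v" by blast
      show False
        by (rule no_kernel_pair[of a b "w a v" "- w b v"]) (use ab w_unit N_verts in auto)
    qed
  qed
qed

text \<open>\<open>q\<close> and the full vertex \<open>s\<close> share \<open>v\<close>, hence
  evenly many and so at least two neighbours, while \<open>q\<close> has degree at most 2. So both
  neighbours of \<open>q\<close> are neighbours of \<open>s\<close>.\<close>

lemma thin_neighbour:
  assumes "q \<in> N v" "card (N q) \<noteq> 4" "s \<in> N v" "card (N s) = 4"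
  obtains r where "r \<noteq> v" "N q = {v, r}" "r \<in> N s" "w q v * w v s + w q r * w r s = 0"
proof -
  have "q \<noteq> s" using assms by auto
  have vq: "v \<in> N q" "v \<in> N s" using assms N_symD by blast+
  obtain k where k: "card (N q \<inter> N s) = 2 * k" using even_common[OF assms(4) \<open>q \<noteq> s\<close>] by blast
  have "card (N q \<inter> N s) \<noteq> 0" using vq by (auto simp: card_eq_0_iff)
  hence "2 \<le> card (N q \<inter> N s)" using k by auto
  moreover have "card (N q) \<le> 2" using deg_le_2 assms by blast
  ultimately have eq: "N q \<inter> N s = N q" by (intro card_seteq) auto
  hence "card (N q) = 2" using \<open>2 \<le> card (N q \<inter> N s)\<close> \<open>card (N q) \<le> 2\<close> by simp
  then obtain a b where ab: "N q = {a, b}" "a \<noteq> b" unfolding card_2_iff by blast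
  define r where "r = (if v = a then b else a)"
  have "v = a \<or> v = b" using ab vq by auto
  hence r: "r \<noteq> v" "N q = {v, r}" unfolding r_def using ab by auto
  have "w q v * w v s + w q r * w r s = 0"
    using full_orth[OF assms(4) \<open>q \<noteq> s\<close>] r unfolding ip_common eq by simp
  thus ?thesis using that r eq by blast
qed

lemma thin_neighbour_relation:
  assumes "N q = {v, r}" "v \<noteq> r" "card (N q) \<noteq> 4" "s \<in> N v" "card (N s) = 4"
  shows "r \<in> N s" "w q v * w v s + w q r * w r s = 0"
proof -
  have "q \<in> N v" using assms(1) N_symD by blast
  from thin_neighbour[OF this assms(3-5)] obtain r' where r': "r' \<noteq> v" "N q = {v, r'}" "r' \<in> N s"
    "w q v * w v s + w q r' * w r' s = 0" .
  have "r' = r" using r' assms(1,2) by auto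
  thus "r \<in> N s" "w q v * w v s + w q r * w r s = 0" using r' by auto
qed

text \<open>If \<open>r\<close> were thin, \<open>v\<close> and its full neighbour \<open>s\<close>
  would be joined by two paths v-q-r-s and v-x-t-s with thin inner vertices. Transporting weights
  from \<open>v\<close> along the two paths with opposite signs gives vectors c on {q, x} and d on
  {r, t} with A c = d and A d = c.\<close>

lemma thin_path_end_full:
  assumes v: "card (N v) = 4" and q: "card (N q) \<noteq> 4" and Nq: "N q = {v, r}" and "r \<noteq> v"
  shows "card (N r) = 4"
proof (rule ccontr)
  assume rthin: "card (N r) \<noteq> 4"
  have qv: "q \<in> N v" and qr: "q \<in> N r" using Nq N_symD by blast+
  obtain s where s: "s \<in> N v" "card (N s) = 4" using full_neighbour[OF v] by blast
  note rel = thin_neighbour_relation[OF Nq _ q]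
  have rs: "r \<in> N s" "w q v * w v s + w q r * w r s = 0" using rel[OF _ s] \<open>r \<noteq> v\<close> by auto
  have sr: "s \<in> N r" using rs N_symD by blast
  have "s \<noteq> q" using s q by auto
  have Nr: "N r = {q, s}"
    using card_seteq[of "N r" "{q, s}"] deg_le_2[OF rthin] qr sr \<open>s \<noteq> q\<close> by auto
  \<comment> \<open>The start of the second path. A full \<open>x\<close> would be adjacent to
    \<open>r\<close>, whose only neighbours are \<open>q\<close> and \<open>s\<close>.\<close>
  have "\<not> N v \<subseteq> {q, s}" using v card_mono[of "{q, s}" "N v"] \<open>s \<noteq> q\<close> by auto
  then obtain x where x: "x \<in> N v" "x \<noteq> q" "x \<noteq> s" by blast
  have xthin: "card (N x) \<noteq> 4"
  proof
    assume "card (N x) = 4"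
    hence "r \<in> N x" using rel(1)[OF _ x(1)] \<open>r \<noteq> v\<close> by auto
    hence "x \<in> N r" using N_symD by blast
    thus False using Nr x by auto
  qed
  obtain t where t: "t \<noteq> v" "N x = {v, t}" "t \<in> N s" "w x v * w v s + w x t * w t s = 0"
    using thin_neighbour[OF x(1) xthin s] .
  have tx: "x \<in> N t" using t N_symD by blast
  have "x \<noteq> r" using x Nr Nq N_symD \<open>s \<noteq> q\<close> s(1) t by (metis N_irrefl insertE insertI1 singletonD qv)
  have "t \<noteq> r" using tx Nr x by auto
  have tthin: "card (N t) \<noteq> 4"
  proof
    assume "card (N t) = 4"
    moreover have "N r = {s, q}" using Nr by auto
    ultimately have "q \<in> N t" using thin_neighbour_relation(1)[of r s q t] rthin t(3) \<open>s \<noteq> q\<close> by auto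
    hence "t \<in> N q" using N_symD by blast
    thus False using Nq t(1) \<open>t \<noteq> r\<close> by auto
  qed
  have Nt: "N t = {x, s}"
    using card_seteq[of "N t" "{x, s}"] deg_le_2[OF tthin] tx t(3)[THEN N_symD] x by auto
  have "s \<notin> N q" using Nq s(1) rs(1) by auto
  hence "q \<noteq> t" using Nt by auto
  hence ne: "q \<noteq> r" "q \<noteq> t" "x \<noteq> t" "v \<noteq> s" "s \<noteq> r" "s \<noteq> t"
    using Nq Nt t(1) \<open>t \<noteq> r\<close> s(1) rs(1) t(3) tx qr x by auto
  \<comment> \<open>Transport from \<open>v\<close> to \<open>s\<close> along either path is minus
    the direct weight, so with opposite signs the two contributions cancel at
    \<open>s\<close>.\<close>
  have sums: "w s r * (w r q * w q v) = - w s v" "w s t * (w t x * w x v) = - w s v"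
  proof -
    have "cnj (w q v * w v s + w q r * w r s) = 0" using rs(2) by simp
    hence "w s v * w v q + w s r * w r q = 0"
      using herm[of v q] herm[of s v] herm[of r q] herm[of s r] by (simp add: mult_ac)
    hence "(w s v * w v q + w s r * w r q) * w q v = 0" by simp
    hence "w s v + w s r * w r q * w q v = 0" using qv by (simp only: distrib_right w_inverse)
    thus "w s r * (w r q * w q v) = - w s v" by (simp add: add_eq_0_iff mult.assoc)
    have "cnj (w x v * w v s + w x t * w t s) = 0" using t(4) by simp
    hence "w s v * w v x + w s t * w t x = 0"
      using herm[of v x] herm[of s v] herm[of t x] herm[of s t] by (simp add: mult_ac)
    hence "(w s v * w v x + w s t * w t x) * w x v = 0" by simp
    hence "w s v + w s t * w t x * w x v = 0" using x(1) by (simp only: distrib_right w_inverse)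
    thus "w s t * (w t x * w x v) = - w s v" by (simp add: add_eq_0_iff mult.assoc)
  qed
  have z: "w u y = 0" if "u \<notin> N y" for u y
    using that N_symD w_zero by blast
  define c where "c y = (if y = q then w q v else - w x v)" for y
  define d where "d y = (if y = r then w r q * w q v else - (w t x * w x v))" for y
  show False
  proof (rule no_double_eigenvector[of "{q, x}" c "{r, t}" d])
    show "c y \<in> gauss_units" if "y \<in> {q, x}" for y using that w_unit qv x(1) by (auto simp: c_def)
    show "{q, x} \<subseteq> V" "{r, t} \<subseteq> V" using N_verts qv x(1) qr tx by auto
    show "{q, x} \<inter> {r, t} = {}" using ne \<open>x \<noteq> r\<close> by auto
    fix u
    consider "u = v" | "u = r" | "u = t" | "u \<notin> N q" "u \<notin> N x" "u \<notin> {r, t}" using Nq t(2) by auto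
    thus "(\<Sum>y\<in>{q, x}. w u y * c y) = (if u \<in> {r, t} then d u else 0)"
    proof cases
      case 1
      thus ?thesis using x(2) qv x(1) \<open>r \<noteq> v\<close> t(1) by (auto simp: c_def)
    next
      case 2
      hence "u \<notin> N x" using t(2) \<open>r \<noteq> v\<close> \<open>t \<noteq> r\<close> by auto
      thus ?thesis using 2 x(2) by (simp add: c_def d_def z)
    next
      case 3
      hence "u \<notin> N q" using Nq t(1) \<open>t \<noteq> r\<close> by auto
      thus ?thesis using 3 x(2) \<open>t \<noteq> r\<close> by (simp add: c_def d_def z)
    qed (use x(2) z in simp_all)
    consider "u = q" | "u = x" | "u = s" | "u \<notin> N r" "u \<notin> N t" "u \<notin> {q, x}" using Nr Nt by auto
    thus "(\<Sum>y\<in>{r, t}. w u y * d y) = (if u \<in> {q, x} then c u else 0)"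
    proof cases
      case 1
      hence "u \<notin> N t" using Nt x(2) \<open>s \<noteq> q\<close> by auto
      thus ?thesis using 1 \<open>t \<noteq> r\<close> qr by (simp add: c_def d_def z)
    next
      case 2
      hence "u \<notin> N r" using Nr x by auto
      thus ?thesis using 2 \<open>t \<noteq> r\<close> tx x(2) by (simp add: c_def d_def z)
    next
      case 3
      thus ?thesis using sums \<open>t \<noteq> r\<close> \<open>s \<noteq> q\<close> x(3) by (auto simp: c_def d_def)
    qed (use \<open>t \<noteq> r\<close> z in simp_all)
  qed (use x(2) in auto)
qed

text \<open>Full neighbours of \<open>v\<close> or of \<open>r\<close> are common to both by
  \<open>thin_neighbour_relation\<close>. On the common neighbours, the ratio between rows
  \<open>r\<close> and \<open>v\<close> has one value on the thin ones (\<open>Q\<close>) and the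
  opposite value on the full ones (\<open>M\<close>), so orthogonality gives equally many of
  each.\<close>

lemma thin_path_unique:
  assumes v: "card (N v) = 4" and q: "card (N q) \<noteq> 4" and Nq: "N q = {v, r}" and rv: "r \<noteq> v"
  obtains s where "N v \<inter> N r = {q, s}" "card (N s) = 4"
    "\<And>x. x \<in> N v \<Longrightarrow> card (N x) = 4 \<Longrightarrow> x = s" "\<And>x. x \<in> N r \<Longrightarrow> card (N x) = 4 \<Longrightarrow> x = s"
proof -
  have r: "card (N r) = 4" by (rule thin_path_end_full[OF assms])
  have qv: "q \<in> N v" "q \<in> N r" using Nq N_symD by blast+
  define M where "M = {x \<in> N v. card (N x) = 4}"
  define Q where "Q = {x \<in> N v \<inter> N r. card (N x) \<noteq> 4}"
  have Nq': "N q = {r, v}" using Nq by auto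
  have "x \<in> N r" if "x \<in> M" for x
    using thin_neighbour_relation(1)[OF Nq rv[symmetric] q, of x] that N_symD unfolding M_def by blast
  hence MQ: "N v \<inter> N r = M \<union> Q" "M \<inter> Q = {}" by (auto simp: M_def Q_def)
  have Mr: "x \<in> M" if "x \<in> N r" "card (N x) = 4" for x
    using thin_neighbour_relation(1)[OF Nq' rv q that] that N_symD unfolding M_def by blast
  have fin: "finite M" "finite Q" by (simp_all add: M_def Q_def)
  define f where "f x = w r x * w x v" for x
  have rel: "f s = - f x" if s: "s \<in> M" and x: "x \<in> Q" for s x
  proof -
    have "card (N x) \<noteq> 4" "v \<in> N x" "r \<in> N x" using x N_symD by (auto simp: Q_def)
    hence Nx: "N x = {v, r}"
      using card_seteq[of "N x" "{v, r}"] deg_le_2[of x] rv by auto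
    have "s \<in> N v" "s \<in> N r" "card (N s) = 4" using s MQ by (auto simp: M_def)
    hence "w x v * w v s + w x r * w r s = 0"
      using thin_neighbour_relation(2)[OF Nx] rv \<open>card (N x) \<noteq> 4\<close> by blast
    hence "w r x * (w x v * w v s + w x r * w r s) * w s v = 0" by simp
    moreover have "w r x * (w x v * w v s + w x r * w r s) * w s v
      = w r x * w x v * (w v s * w s v) + (w r x * w x r) * w r s * w s v"
      by (simp add: algebra_simps)
    ultimately have "f x + f s = 0"
      using \<open>s \<in> N v\<close> \<open>r \<in> N x\<close> by (simp add: f_def)
    thus ?thesis by (simp add: add_eq_0_iff)
  qed
  have "q \<in> Q" using qv q by (auto simp: Q_def)
  obtain s where s: "s \<in> M" using full_neighbour[OF v] by (auto simp: M_def)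
  have fQ: "f x = f q" if "x \<in> Q" for x using rel[OF s that] rel[OF s \<open>q \<in> Q\<close>] by simp
  have fqu: "f q \<in> gauss_units" using qv w_unit by (auto simp: f_def)
  have "sum f (N r \<inter> N v) = 0"
    using full_orth[OF v rv] unfolding ip_common f_def .
  hence "sum f M + sum f Q = 0"
    using MQ fin by (metis Int_commute sum.union_disjoint)
  moreover have "sum f M = - of_nat (card M) * f q" using rel[OF _ \<open>q \<in> Q\<close>] by simp
  moreover have "sum f Q = of_nat (card Q) * f q" using fQ by simp
  ultimately have "of_nat (card Q) * f q = of_nat (card M) * f q" by (simp add: add_eq_0_iff)
  hence card_eq: "card Q = card M" using fqu by auto
  have "card M + card Q = card (N v \<inter> N r)" using MQ fin by (simp add: card_Un_disjoint)
  also have "\<dots> \<le> 4" using v card_mono[of "N v" "N v \<inter> N r"] by auto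
  finally have "card Q \<le> 2" using card_eq by simp
  \<comment> \<open>A second thin common neighbour would have the same two neighbours and the same
    ratio as \<open>q\<close>, so the two columns would be proportional.\<close>
  have Q: "Q = {q}"
  proof (rule ccontr)
    assume "Q \<noteq> {q}"
    then obtain x where x: "x \<in> Q" "x \<noteq> q" using \<open>q \<in> Q\<close> by blast
    have xthin: "card (N x) \<noteq> 4" "v \<in> N x" "r \<in> N x" using x N_symD by (auto simp: Q_def)
    hence Nx: "N x = {v, r}"
      using card_seteq[of "N x" "{v, r}"] deg_le_2[of x] rv by auto
    have xv: "x \<in> N v" "x \<in> N r" using x by (auto simp: Q_def)
    show False
    proof (rule no_kernel_pair[of q x "w q v" "- w x v"])
      fix u
      consider "u = v" | "u = r" | "u \<notin> N q" "u \<notin> N x" using Nq Nx by auto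
      thus "w u q * w q v + w u x * - w x v = 0"
      proof cases
        case 1
        thus ?thesis using qv xv by simp
      next
        case 2
        thus ?thesis using fQ[OF x(1)] by (simp add: f_def)
      next
        case 3
        hence "w u q = 0" "w u x = 0" using N_symD w_zero by blast+
        thus ?thesis by simp
      qed
    qed (use qv xv x w_unit N_verts in auto)
  qed
  hence "card M = 1" using card_eq by simp
  hence M: "M = {s}" using s by (metis card_1_singletonE singletonD)
  show ?thesis
  proof
    show "N v \<inter> N r = {q, s}" using MQ M Q by auto
    show "card (N s) = 4" using s by (simp add: M_def)
    show "x = s" if "x \<in> N v" "card (N x) = 4" for x using that M by (auto simp: M_def)
    show "x = s" if "x \<in> N r" "card (N x) = 4" for x using Mr[OF that] M by simp
  qed
qed

text \<open>Each of \<open>a\<close>, \<open>b\<close>, \<open>c\<close> has two transports to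
  \<open>s\<close>, through its two neighbours, and they are opposite. Taking these values as
  entries, the two contributions at each of \<open>x\<close>, \<open>y\<close>, \<open>z\<close>
  cancel and a kernel vector results.\<close>

lemma no_thin_triangle:
  assumes "N a = {x, y}" "N b = {y, z}" "N c = {z, x}" "distinct [x, y, z]" "s \<in> N x" "s \<in> N y" "s \<in> N z"
    "card (N a) \<noteq> 4" "card (N b) \<noteq> 4" "card (N c) \<noteq> 4" "card (N s) = 4"
  shows False
proof -
  have ra: "w a x * w x s = - (w a y * w y s)" and rb: "w b y * w y s = - (w b z * w z s)"
    and rc: "w c z * w z s = - (w c x * w x s)"
    using thin_neighbour_relation(2)[OF assms(1) _ assms(8) assms(5,11)]
      thin_neighbour_relation(2)[OF assms(2) _ assms(9) assms(6,11)]
      thin_neighbour_relation(2)[OF assms(3) _ assms(10) assms(7,11)] assms(4)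
    by (auto simp: add_eq_0_iff2 add_eq_0_iff)
  have mem: "a \<in> N x" "a \<in> N y" "b \<in> N y" "b \<in> N z" "c \<in> N z" "c \<in> N x"
    using assms(1-3) N_symD by blast+
  have ne: "a \<noteq> b" "b \<noteq> c" "a \<noteq> c" using assms(1-4) by (auto simp: doubleton_eq_iff)
  define k where "k u = (if u = a then w a x * w x s else if u = b then w b y * w y s else w c z * w z s)" for u
  show False
  proof (rule no_kernel[of "{a, b, c}" k])
    show "card {a, b, c} \<le> 4" by (simp add: card_insert_if)
    show "k u \<in> gauss_units" if "u \<in> {a, b, c}" for u
      using that w_unit assms(5-7) mem by (auto simp: k_def)
    fix u
    have sum: "(\<Sum>v\<in>{a, b, c}. w u v * k v) = w u a * (w a x * w x s) + w u b * (w b y * w y s) + w u c * (w c z * w z s)"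
      using ne by (simp add: k_def)
    have z: "w u v = 0" if "u \<notin> N v" for v using that N_symD w_zero by blast
    consider "u = x" | "u = y" | "u = z" | "u \<notin> N a" "u \<notin> N b" "u \<notin> N c" using assms(1-3) by auto
    thus "(\<Sum>v\<in>{a, b, c}. w u v * k v) = 0"
    proof cases
      case 1
      hence "w u b = 0" using assms(2,4) z by auto
      thus ?thesis unfolding sum unfolding 1 rc using mem by simp
    next
      case 2
      hence "w u c = 0" using assms(3,4) z by auto
      thus ?thesis unfolding sum unfolding 2 ra using mem by simp
    next
      case 3
      hence "w u a = 0" using assms(1,4) z by auto
      thus ?thesis unfolding sum unfolding 3 rb using mem by simp
    qed (simp add: sum z)
  qed (use mem N_verts in auto)
qed

text \<open>A thin neighbour \<open>q\<close> of a full vertex \<open>v\<close> gives a thin path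
  from \<open>v\<close> to a full vertex \<open>r\<close> with a common full neighbour
  \<open>s\<close>. Counting the thin paths starting at \<open>v\<close> and at \<open>r\<close>
  produces the configuration excluded by \<open>no_thin_triangle\<close>.\<close>

lemma all_full:
  assumes "v \<in> V"
  shows "card (N v) = 4"
proof -
  define F where "F = {v \<in> V. card (N v) = 4}"
  have "F = V"
  proof (rule closed_eq)
    show "F \<noteq> {}" using full_exists by (auto simp: F_def)
    fix v assume "v \<in> F"
    hence v: "card (N v) = 4" by (simp add: F_def)
    show "N v \<subseteq> F"
    proof
      fix q assume qv: "q \<in> N v"
      have "card (N q) = 4"
      proof (rule ccontr)
        assume q: "card (N q) \<noteq> 4"
        obtain s where s: "s \<in> N v" "card (N s) = 4" using full_neighbour[OF v] by blast
        obtain r where r: "r \<noteq> v" "N q = {v, r}" "r \<in> N s" using thin_neighbour[OF qv q s] by blast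
        have rfull: "card (N r) = 4" by (rule thin_path_end_full[OF v q r(2,1)])
        have other_full: "x = s" if "x \<in> N v \<or> x \<in> N r" "card (N x) = 4" for x
        proof -
          obtain s' where "\<And>x. x \<in> N v \<Longrightarrow> card (N x) = 4 \<Longrightarrow> x = s'" "\<And>x. x \<in> N r \<Longrightarrow> card (N x) = 4 \<Longrightarrow> x = s'"
            using thin_path_unique[OF v q r(2,1)] by metis
          thus ?thesis using s \<open>x \<in> N v \<or> x \<in> N r\<close> \<open>card (N x) = 4\<close> by metis
        qed
        have sr: "s \<in> N r" using r N_symD by blast
        have sq: "s \<noteq> q" using s q by auto
        have path: "\<exists>y. y \<noteq> a \<and> N x = {a, y} \<and> y \<in> N s \<and> N a \<inter> N y = {x, s} \<and> card (N x) \<noteq> 4"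
          if a: "card (N a) = 4" "s \<in> N a" and x: "x \<in> N a" "x \<noteq> s"
            and only: "\<And>y. y \<in> N a \<Longrightarrow> card (N y) = 4 \<Longrightarrow> y = s" for a x
        proof -
          have xt: "card (N x) \<noteq> 4" using only x by blast
          obtain y where y: "y \<noteq> a" "N x = {a, y}" "y \<in> N s" using thin_neighbour[OF x(1) xt a(2) s(2)] by blast
          obtain s' where s': "N a \<inter> N y = {x, s'}" "card (N s') = 4"
            using thin_path_unique[OF a(1) xt y(2,1)] by metis
          have "s' \<in> N a" using s' by blast
          hence "s' = s" using only s' by blast
          thus ?thesis using y s' xt by blast
        qed
        have pv: "\<exists>y. y \<noteq> v \<and> N x = {v, y} \<and> y \<in> N s \<and> N v \<inter> N y = {x, s} \<and> card (N x) \<noteq> 4"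
          if "x \<in> N v - {s}" for x
          by (rule path[OF v s(1)]) (use that other_full in auto)
        \<comment> \<open>\<open>e x\<close> is the far end of the thin path from \<open>v\<close>
          through \<open>x\<close>. As \<open>x\<close> and \<open>s\<close> are the only common
          neighbours of \<open>v\<close> and \<open>e x\<close>, the map is injective.\<close>
        then obtain e where e: "\<And>x. x \<in> N v - {s} \<Longrightarrow> e x \<noteq> v \<and> N x = {v, e x} \<and> e x \<in> N s \<and>
            N v \<inter> N (e x) = {x, s} \<and> card (N x) \<noteq> 4" by metis
        have "inj_on e (N v - {s})"
        proof (rule inj_onI)
          fix x y assume xy: "x \<in> N v - {s}" "y \<in> N v - {s}" "e x = e y"
          hence "{x, s} = {y, s}" using e[OF xy(1)] e[OF xy(2)] by simp
          thus "x = y" using xy by auto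
        qed
        hence "card (e ` (N v - {s})) = card (N v - {s})" by (rule card_image)
        also have "\<dots> = card (N s - {v})"
          using v s N_symD[OF s(1)] by (simp add: card_Diff_singleton)
        finally have card_e: "card (e ` (N v - {s})) = card (N s - {v})" .
        have "e ` (N v - {s}) \<subseteq> N s - {v}" using e by blast
        \<comment> \<open>Both sides have three elements: every neighbour of \<open>s\<close> other
          than \<open>v\<close> is reached from \<open>v\<close> by a thin path.\<close>
        from card_subset_eq[OF _ this card_e] have surj: "e ` (N v - {s}) = N s - {v}" by simp
        have "card {s, q} < card (N r)" using rfull by (simp add: card_insert_if)
        hence "\<not> N r \<subseteq> {s, q}" using card_mono[of "{s, q}" "N r"] by auto
        then obtain p where p: "p \<in> N r" "p \<noteq> s" "p \<noteq> q" by blast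
        obtain r' where r': "r' \<noteq> r" "N p = {r, r'}" "r' \<in> N s" "N r \<inter> N r' = {p, s}" "card (N p) \<noteq> 4"
          using path[OF rfull sr p(1,2)] other_full by blast
        have "e q = r" using e[of q] qv sq r(1,2) by (simp add: doubleton_eq_iff)
        hence "N v \<inter> N r = {q, s}" using e[of q] qv sq by blast
        hence "p \<notin> N v" using p by auto
        have "r' \<noteq> v"
        proof
          assume "r' = v"
          hence "p \<in> N v" using r'(2) N_symD by blast
          thus False using \<open>p \<notin> N v\<close> by blast
        qed
        hence "r' \<in> e ` (N v - {s})" using surj r' by simp
        then obtain q' where q': "q' \<in> N v - {s}" "e q' = r'" by blast
        have Nq': "N q' = {r', v}" "card (N q') \<noteq> 4" using e[OF q'(1)] q'(2) by auto
        \<comment> \<open>The thin paths through \<open>q\<close>, \<open>p\<close> and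
          \<open>q'\<close> join \<open>v\<close>, \<open>r\<close> and \<open>r'\<close> in a
          triangle over \<open>s\<close>.\<close>
        show False
          by (rule no_thin_triangle[OF r(2) r'(2) Nq'(1) _ s(1) sr _ q r'(5) Nq'(2) s(2)])
             (use r r' \<open>r' \<noteq> v\<close> N_symD[OF r'(3)] in auto)
      qed
      thus "q \<in> F" using N_verts qv by (auto simp: F_def)
    qed
  qed (auto simp: F_def)
  thus ?thesis using assms by (auto simp: F_def)
qed

end

section \<open>Graphs with twins: ladders, T_{2k} and T_{2k}^{(i)}\<close>

lemma units_sum_cancel:
  assumes "a \<in> gauss_units" "p \<in> gauss_units" "q \<in> gauss_units" "a + a + (p + q) = 0"
  shows "p = - a \<and> q = - a"
  using assms by (auto simp: gauss_units_eq complex_eq_iff)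

lemma prod_gauss_units_inj:
  assumes "inj_on f S" "card S = 4" "f ` S \<subseteq> gauss_units"
  shows "prod f S = -1"
proof -
  have "f ` S = gauss_units"
    by (rule card_subset_eq) (use assms card_gauss_units in \<open>auto simp: card_image\<close>)
  hence "prod f S = prod id gauss_units" using prod.reindex[OF assms(1), of id] by simp
  also have "\<dots> = -1" by (simp add: gauss_units_eq complex_eq_iff)
  finally show ?thesis .
qed

context weighing_graph
begin

text \<open>A rung of the ladder: two twin pairs joined by a 2 x 2 block of rank one. The last
  equation compares the ratio of rows \<open>b\<close> and \<open>t\<close> in the two
  columns.\<close>

definition link :: "'a \<Rightarrow> 'a \<Rightarrow> 'a \<Rightarrow> 'a \<Rightarrow> bool" where
  "link t b t' b' \<longleftrightarrow> t \<noteq> b \<and> N t = N b \<and> t' \<noteq> b' \<and> N t' = N b' \<and> t' \<in> N t \<and>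
     w b t' * w t' t = w b b' * w b' t"

lemma link_D:
  assumes "link t b t' b'"
  shows "t \<noteq> b" "t' \<noteq> b'" "N b = N t" "N b' = N t'"
    "t' \<in> N t" "b' \<in> N t" "t' \<in> N b" "b' \<in> N b" "t \<in> N t'" "b \<in> N t'" "t \<in> N b'" "b \<in> N b'"
    "w b t' * w t' t = w b b' * w b' t"
proof -
  have *: "t \<noteq> b" "t' \<noteq> b'" "N b = N t" "N b' = N t'" "t' \<in> N t" "w b t' * w t' t = w b b' * w b' t"
    using assms by (auto simp: link_def)
  show "t \<noteq> b" "t' \<noteq> b'" "N b = N t" "N b' = N t'" "t' \<in> N t" "w b t' * w t' t = w b b' * w b' t"
    by fact+
  show 1: "t' \<in> N b" using * by simp
  show 2: "t \<in> N t'" "b \<in> N t'" using *(5) 1 N_symD by blast+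
  show 3: "t \<in> N b'" "b \<in> N b'" using 2 * by simp_all
  show "b' \<in> N t" "b' \<in> N b" using 3 N_symD by blast+
qed

text \<open>Otherwise \<open>t\<close> and \<open>b\<close> are the only common neighbours of
  \<open>x\<close> and \<open>y\<close>, and orthogonality makes a sum of two equal units
  vanish.\<close>

lemma twins_of_equal_ratio:
  assumes "t \<noteq> b" "x \<noteq> y" "x \<in> N t" "y \<in> N t" "x \<in> N b" "y \<in> N b"
    and eq: "w b x * w x t = w b y * w y t"
  shows "N x = N y"
proof (rule ccontr)
  assume "N x \<noteq> N y"
  note sym = assms(3-6)[THEN N_symD]
  have "card (N x \<inter> N y) = 2" by (rule card_common[OF assms(2) sym(1,2) \<open>N x \<noteq> N y\<close>])
  hence "N x \<inter> N y = {t, b}"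
    using assms(1) sym by (intro card_subset_eq[symmetric]) auto
  hence "w x t * w t y + w x b * w b y = 0"
    using orth[OF assms(2)] assms(1) unfolding ip_common by simp
  moreover have "w x b * w b y = w x t * w t y"
  proof -
    have "w x b * (w b x * w x t) * w t y = w x b * (w b y * w y t) * w t y" by (simp only: eq)
    moreover have "w x b * (w b x * w x t) * w t y = w x t * w t y" using assms(3-6) by simp
    moreover have "w x b * (w b y * w y t) * w t y = w x b * w b y" using assms(3-6) by (simp add: mult.assoc)
    ultimately show ?thesis by simp
  qed
  ultimately have "w x t * w t y = 0" by auto
  thus False using assms sym w_nonzero by auto
qed

lemma link_sym:
  assumes "link t b t' b'"
  shows "link t' b' t b"
proof -
  note D = link_D[OF assms]
  have "w b' b * (w b t' * w t' t) * w t t' = w b' b * (w b b' * w b' t) * w t t'" by (simp only: D(13))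
  moreover have "w b' b * (w b t' * w t' t) * w t t' = w b' b * w b t'" using D(5-12) by (simp add: mult.assoc)
  moreover have "w b' b * (w b b' * w b' t) * w t t' = w b' t * w t t'" using D(5-12) by simp
  ultimately show ?thesis using D by (auto simp: link_def)
qed

text \<open>The ratios between rows \<open>b'\<close> and \<open>t'\<close> sum to zero over the
  four neighbours and agree on \<open>t\<close> and \<open>b\<close>, so both others are the
  opposite unit; being equal, they make \<open>x\<close> and \<open>y\<close> twins.\<close>

lemma link_next:
  assumes "link t b t' b'"
  obtains x y where "link t' b' x y" "N t' = {t, b, x, y}" "distinct [t, b, x, y]"
    and "w b' x * w x t' = - (w b' t * w t t')"
proof -
  note D = link_D[OF assms]
  have "card (N t' - {t, b}) = 2" using deg[OF N_verts(1)[OF D(9)]] D by (simp add: card_Diff_subset)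
  then obtain x y where xy: "N t' - {t, b} = {x, y}" "x \<noteq> y" unfolding card_2_iff by blast
  have N: "N t' = {t, b, x, y}" and dist: "distinct [t, b, x, y]" using xy D by auto
  define f where "f z = w b' z * w z t'" for z
  have fu: "f z \<in> gauss_units" if "z \<in> N t'" for z
    unfolding f_def using that D w_unit by (intro gauss_units_closed(5)) auto
  have ft: "f t = f b" unfolding f_def using link_D(13)[OF link_sym[OF assms]] .
  have "ip b' t' = 0" using orth D by metis
  hence "sum f (N t') = 0" unfolding ip_common f_def using D(4) by simp
  hence "f t + f t + (f x + f y) = 0" using dist ft unfolding N by (simp add: add.assoc)
  hence fx: "f x = - f t" "f y = - f t" using units_sum_cancel[OF fu fu fu, of t x y] N by auto
  have "N x = N y"
    by (rule twins_of_equal_ratio[of t' b']) (use D xy N fx in \<open>auto simp: f_def\<close>)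
  hence "link t' b' x y" unfolding link_def using D xy N fx by (auto simp: f_def)
  thus ?thesis using that N dist fx(1) by (simp add: f_def)
qed

lemma link_of_equal_ratio:
  assumes "v \<noteq> r" "N v = N r" "a \<in> N v" "b \<in> N v" "a \<noteq> b" "w r a * w a v = w r b * w b v"
  shows "link v r a b"
  using assms twins_of_equal_ratio[of v r a b] by (auto simp: link_def)

text \<open>Without a rung, the four ratios between twin rows are always distinct, so they are all
  the units and have product -1. This is impossible for three mutual twins, and a third twin is
  forced.\<close>

lemma link_exists:
  assumes "v \<in> V" "v \<noteq> r" "N v = N r"
  shows "\<exists>t b t' b'. link t b t' b'"
proof (rule ccontr)
  assume nolink: "\<not> ?thesis"
  have inj: "inj_on (\<lambda>x. w b x * w x t) (N t)" if "t \<noteq> b" "N t = N b" for t b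
    using that nolink link_of_equal_ratio[of t b] by (intro inj_onI) blast
  have prod: "(\<Prod>x\<in>N v. w b x * w x t) = -1" if "t \<noteq> b" "N t = N b" "N t = N v" for t b
  proof -
    have "(\<Prod>x\<in>N t. w b x * w x t) = -1"
    proof (rule prod_gauss_units_inj[OF inj[OF that(1,2)]])
      show "card (N t) = 4" unfolding that(3) by (rule deg[OF assms(1)])
      show "(\<lambda>x. w b x * w x t) ` N t \<subseteq> gauss_units"
        using w_unit that(2) by (auto intro!: gauss_units_closed(5))
    qed
    thus ?thesis using that by simp
  qed
  have "N v \<noteq> {}" using deg[OF assms(1)] by auto
  then obtain a where a: "a \<in> N v" by blast
  have a': "v \<in> N a" "r \<in> N a" using a assms(3) N_symD by blast+
  have "card {v, r} < card (N a)" using deg[OF N_verts(2)[OF a]] by (simp add: card_insert_if)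
  hence "\<not> N a \<subseteq> {v, r}" using card_mono[of "{v, r}" "N a"] by auto
  then obtain s where s: "s \<in> N a" "s \<noteq> v" "s \<noteq> r" by blast
  have as: "a \<in> N s" using s N_symD by blast
  \<comment> \<open>If \<open>s\<close> shared only \<open>a\<close> and \<open>x\<close> with
    \<open>v\<close>, orthogonality of \<open>s\<close> to both \<open>v\<close> and
    \<open>r\<close> would give equal ratios at \<open>a\<close> and \<open>x\<close>.\<close>
  have "N s = N v"
  proof (rule ccontr)
    assume ne: "N s \<noteq> N v"
    have "card (N s \<inter> N v) = 2" by (rule card_common[OF s(2) as a ne])
    then obtain c d where cd: "N s \<inter> N v = {c, d}" "c \<noteq> d" unfolding card_2_iff by blast
    have acd: "a = c \<or> a = d" using cd as a by blast
    define x where "x = (if a = c then d else c)"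
    have x: "x \<noteq> a" "N s \<inter> N v = {a, x}" using cd acd by (auto simp: x_def)
    hence xs: "x \<in> N s" "x \<in> N v" by auto
    have "w s x = - (w s a * w a u * w u x)" if u: "u = v \<or> u = r" for u
    proof -
      have "s \<noteq> u" "N s \<inter> N u = {a, x}" "x \<in> N u" using u s x assms(3) xs by auto
      hence "w s a * w a u + w s x * w x u = 0"
        using orth[of s u] x(1) unfolding ip_common by simp
      hence "(w s a * w a u + w s x * w x u) * w u x = 0" by simp
      moreover have "w s x * w x u * w u x = w s x" using \<open>x \<in> N u\<close> by simp
      ultimately have "w s a * w a u * w u x + w s x = 0" by (simp only: distrib_right)
      thus ?thesis by (simp only: add_eq_0_iff)
    qed
    from this[of v] this[of r] have "w s a * w a v * w v x = w s a * w a r * w r x"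
      by (metis neg_equal_iff_equal)
    hence "w s a * (w a v * w v x) = w s a * (w a r * w r x)" by (simp only: mult.assoc)
    hence "w a v * w v x = w a r * w r x" using mult_left_cancel[OF w_nonzero[OF as]] by blast
    hence "w r a * (w a v * w v x) * w x v = w r a * (w a r * w r x) * w x v" by (simp only:)
    moreover have "w r a * (w a v * w v x) * w x v = w r a * w a v" using xs by (simp add: mult.assoc)
    moreover have "w r a * (w a r * w r x) * w x v = w r x * w x v" using a a' by simp
    ultimately have "w r a * w a v = w r x * w x v" by simp
    hence "a = x" using inj_onD[OF inj[OF assms(2,3)] _ a xs(2)] by simp
    thus False using x by simp
  qed
  define A where "A = (\<Prod>x\<in>N v. w r x * w x v)"
  define B where "B = (\<Prod>x\<in>N v. w s x * w x v)"
  have "A = -1" unfolding A_def by (rule prod) (use assms in auto)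
  moreover have "B = -1" unfolding B_def by (rule prod) (use s \<open>N s = N v\<close> in auto)
  \<comment> \<open>The ratio of rows \<open>r\<close> and \<open>s\<close> is the quotient of their
    ratios to row \<open>v\<close>, so its product is (-1)(-1) = 1, although it should be
    -1.\<close>
  moreover have "A * cnj B = (\<Prod>x\<in>N v. w r x * w x s)"
  proof -
    have "w r x * w x v * cnj (w s x * w x v) = w r x * w x s" if "x \<in> N v" for x
    proof -
      have "cnj (w s x * w x v) = w v x * w x s" using herm[of x s] herm[of v x] by (simp add: mult_ac)
      thus ?thesis using that by (simp add: mult.assoc)
    qed
    thus ?thesis unfolding A_def B_def cnj_prod prod.distrib[symmetric]
      by (intro prod.cong) simp_all
  qed
  moreover have "(\<Prod>x\<in>N v. w r x * w x s) = -1" by (rule prod) (use s \<open>N s = N v\<close> assms in auto)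
  ultimately show False by simp
qed

text \<open>Iterates \<open>link_next\<close> by dependent choice. The ladder is infinite as a
  sequence; it returns to its start in \<open>ladder_closes\<close>.\<close>

lemma ladder_exists:
  assumes "link t b t' b'"
  shows "\<exists>p q. \<forall>j. link (p j) (q j) (p (Suc j)) (q (Suc j)) \<and>
      N (p (Suc j)) = {p j, q j, p (Suc (Suc j)), q (Suc (Suc j))} \<and>
      distinct [p j, q j, p (Suc (Suc j)), q (Suc (Suc j))] \<and>
      w (q (Suc j)) (p (Suc (Suc j))) * w (p (Suc (Suc j))) (p (Suc j))
        = - (w (q (Suc j)) (p j) * w (p j) (p (Suc j)))"
proof -
  \<comment> \<open>A state consists of two consecutive pairs; successive states overlap in one
    pair.\<close>
  define Q where "Q = (\<lambda>((a, b), (c, d)) ((c', d'), (x, y)). c' = c \<and> d' = d \<and> N c = {a, b, x, y} \<and>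
    distinct [a, b, x, y] \<and> w d x * w x c = - (w d a * w a c))"
  have "\<exists>f. \<forall>n. (case f n of ((a, b), (c, d)) \<Rightarrow> link a b c d) \<and> Q (f n) (f (Suc n))"
  proof (rule dependent_nat_choice)
    show "\<exists>s. case s of ((a, b), (c, d)) \<Rightarrow> link a b c d" using assms by (auto intro!: exI[of _ "((t, b), (t', b'))"])
    fix s and n :: nat assume "case s of ((a, b), (c, d)) \<Rightarrow> link a b c d"
    then obtain a b c d where s: "s = ((a, b), (c, d))" "link a b c d" by (cases s) auto
    obtain x y where "link c d x y" "N c = {a, b, x, y}" "distinct [a, b, x, y]" "w d x * w x c = - (w d a * w a c)"
      using link_next[OF s(2)] .
    thus "\<exists>s'. (case s' of ((a, b), (c, d)) \<Rightarrow> link a b c d) \<and> Q s s'"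
      by (intro exI[of _ "((c, d), (x, y))"]) (auto simp: s Q_def)
  qed
  then obtain f where *: "\<forall>n. (case f n of ((a, b), (c, d)) \<Rightarrow> link a b c d) \<and> Q (f n) (f (Suc n))" ..
  hence f: "case f n of ((a, b), (c, d)) \<Rightarrow> link a b c d" "Q (f n) (f (Suc n))" for n by simp_all
  define p where "p n = fst (fst (f n))" for n
  define q where "q n = snd (fst (f n))" for n
  have f_eq: "f n = ((p n, q n), (p (Suc n), q (Suc n)))" for n
    using f(2)[of n] by (cases "f n"; cases "f (Suc n)") (auto simp: Q_def p_def q_def)
  show ?thesis
  proof (intro exI allI conjI)
    fix j
    show "link (p j) (q j) (p (Suc j)) (q (Suc j))" using f(1)[of j] by (simp add: f_eq)
    show "N (p (Suc j)) = {p j, q j, p (Suc (Suc j)), q (Suc (Suc j))}"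
      "distinct [p j, q j, p (Suc (Suc j)), q (Suc (Suc j))]"
      "w (q (Suc j)) (p (Suc (Suc j))) * w (p (Suc (Suc j))) (p (Suc j))
           = - (w (q (Suc j)) (p j) * w (p j) (p (Suc j)))"
      using f(2)[of j] by (simp_all add: f_eq Q_def)
  qed
qed

end

context weighing_graph
begin

text \<open>The weights of T_{2k} up to switching by \<open>\<alpha>\<close> and
  \<open>\<beta>\<close>, with the edges from the last pair back to the first multiplied by the
  closing gain \<open>g\<close>.\<close>

definition closed_ladder ::
  "nat \<Rightarrow> (nat \<Rightarrow> 'a) \<Rightarrow> (nat \<Rightarrow> 'a) \<Rightarrow> (nat \<Rightarrow> complex) \<Rightarrow> (nat \<Rightarrow> complex) \<Rightarrow> complex \<Rightarrow> bool" where
  "closed_ladder k p q \<alpha> \<beta> g \<longleftrightarrow> 3 \<le> k \<and> inj_on p {..<k} \<and> inj_on q {..<k} \<and>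
     (\<forall>i<k. \<forall>j<k. p i \<noteq> q j) \<and>
     (\<forall>j<k. p j \<in> V \<and> q j \<in> V \<and> \<alpha> j \<in> gauss_units \<and> \<beta> j \<in> gauss_units) \<and>
     (\<forall>j<k. \<forall>m c. m = (if Suc j = k then 0 else Suc j) \<longrightarrow> c = (if Suc j = k then g else 1) \<longrightarrow>
        w (p j) (p m) = c * \<alpha> j * cnj (\<alpha> m) \<and> w (p j) (q m) = c * \<alpha> j * cnj (\<beta> m) \<and>
        w (q j) (p m) = - (c * \<beta> j * cnj (\<alpha> m)) \<and> w (q j) (q m) = - (c * \<beta> j * cnj (\<beta> m)))"

text \<open>Edges entering the last pair have equal weights on both members, those leaving it have
  opposite ones. Exchanging the members therefore negates the gain, which reduces -1 and -i to 1 and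
  i.\<close>

lemma closed_ladder_flip:
  assumes "closed_ladder k p q \<alpha> \<beta> g"
  shows "closed_ladder k (p(k - 1 := q (k - 1))) (q(k - 1 := p (k - 1)))
           (\<alpha>(k - 1 := \<beta> (k - 1))) (\<beta>(k - 1 := \<alpha> (k - 1))) (- g)"
proof -
  have k: "3 \<le> k" and inj: "inj_on p {..<k}" "inj_on q {..<k}"
    and pq: "\<And>i j. i < k \<Longrightarrow> j < k \<Longrightarrow> p i \<noteq> q j"
    and V: "\<And>j. j < k \<Longrightarrow> p j \<in> V \<and> q j \<in> V \<and> \<alpha> j \<in> gauss_units \<and> \<beta> j \<in> gauss_units"
    and e: "\<And>j m c. j < k \<Longrightarrow> m = (if Suc j = k then 0 else Suc j) \<Longrightarrow> c = (if Suc j = k then g else 1) \<Longrightarrow>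
        w (p j) (p m) = c * \<alpha> j * cnj (\<alpha> m) \<and> w (p j) (q m) = c * \<alpha> j * cnj (\<beta> m) \<and>
        w (q j) (p m) = - (c * \<beta> j * cnj (\<alpha> m)) \<and> w (q j) (q m) = - (c * \<beta> j * cnj (\<beta> m))"
    using assms unfolding closed_ladder_def by blast+
  have i1: "p i = p j \<longleftrightarrow> i = j" "q i = q j \<longleftrightarrow> i = j" if "i < k" "j < k" for i j
    using inj that by (auto dest: inj_onD)
  have k1: "k - 1 < k" using k by simp
  show ?thesis unfolding closed_ladder_def
  proof (intro conjI)
    show "inj_on (p(k - 1 := q (k - 1))) {..<k}" "inj_on (q(k - 1 := p (k - 1))) {..<k}"
      using pq[OF _ k1] pq[OF k1, symmetric] by (intro inj_on_fun_updI inj; force)+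
    show "\<forall>i<k. \<forall>j<k. (p(k - 1 := q (k - 1))) i \<noteq> (q(k - 1 := p (k - 1))) j"
      using i1 pq k1 by (auto; metis)
    show "\<forall>j<k. \<forall>m c. m = (if Suc j = k then 0 else Suc j) \<longrightarrow> c = (if Suc j = k then - g else 1) \<longrightarrow>
      w ((p(k - 1 := q (k - 1))) j) ((p(k - 1 := q (k - 1))) m) = c * (\<alpha>(k - 1 := \<beta> (k - 1))) j * cnj ((\<alpha>(k - 1 := \<beta> (k - 1))) m) \<and>
      w ((p(k - 1 := q (k - 1))) j) ((q(k - 1 := p (k - 1))) m) = c * (\<alpha>(k - 1 := \<beta> (k - 1))) j * cnj ((\<beta>(k - 1 := \<alpha> (k - 1))) m) \<and>
      w ((q(k - 1 := p (k - 1))) j) ((p(k - 1 := q (k - 1))) m) = - (c * (\<beta>(k - 1 := \<alpha> (k - 1))) j * cnj ((\<alpha>(k - 1 := \<beta> (k - 1))) m)) \<and>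
      w ((q(k - 1 := p (k - 1))) j) ((q(k - 1 := p (k - 1))) m) = - (c * (\<beta>(k - 1 := \<alpha> (k - 1))) j * cnj ((\<beta>(k - 1 := \<alpha> (k - 1))) m))"
      (is "\<forall>j<k. \<forall>m c. _ \<longrightarrow> _ \<longrightarrow> ?P j m c")
    proof (intro allI impI)
      fix j m :: nat and c assume j: "j < k" and m: "m = (if Suc j = k then 0 else Suc j)" and c: "c = (if Suc j = k then - g else 1)"
      consider "Suc j = k" | "Suc j = k - 1" | "Suc j < k - 1" using j by linarith
      thus "?P j m c"
      proof cases
        case 1
        thus ?thesis using e[of j 0 g] j k m c by auto
      next
        case 2
        thus ?thesis using e[of j m 1] j k m c by auto
      next
        case 3
        thus ?thesis using e[of j m 1] j k m c by auto
      qed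
    qed
  qed (use k V k1 in auto)
qed

lemma closed_ladder_T:
  assumes "closed_ladder k p q \<alpha> \<beta> 1"
  shows "represents V w (T_verts k) (T_weight k)"
proof -
  have k: "3 \<le> k" and inj: "inj_on p {..<k}" "inj_on q {..<k}"
    and pq: "\<And>i j. i < k \<Longrightarrow> j < k \<Longrightarrow> p i \<noteq> q j"
    and V: "\<And>j. j < k \<Longrightarrow> p j \<in> V \<and> q j \<in> V \<and> \<alpha> j \<in> gauss_units \<and> \<beta> j \<in> gauss_units"
    and e: "\<And>j m. j < k \<Longrightarrow> m = (if Suc j = k then 0 else Suc j) \<Longrightarrow>
        w (p j) (p m) = \<alpha> j * cnj (\<alpha> m) \<and> w (p j) (q m) = \<alpha> j * cnj (\<beta> m) \<and>
        w (q j) (p m) = - (\<beta> j * cnj (\<alpha> m)) \<and> w (q j) (q m) = - (\<beta> j * cnj (\<beta> m))"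
    using assms unfolding closed_ladder_def by auto
  have md: "(i + 1) mod k = (if Suc i = k then 0 else Suc i)" if "i < k" for i using that by auto
  define \<gamma> where "\<gamma> = case_T_vertex p q"
  define \<mu> where "\<mu> = case_T_vertex \<alpha> \<beta>"
  show ?thesis unfolding T_weight_def
  proof (rule realize[where g = \<gamma> and \<mu> = \<mu>])
    show "finite (T_verts k)" "T_verts k \<noteq> {}" using k by (auto simp: T_verts_def)
    show "inj_on \<gamma> (T_verts k)"
      using inj pq by (auto simp: inj_on_def T_verts_def \<gamma>_def split: T_vertex.splits) metis+
    show "\<gamma> ` T_verts k \<subseteq> V" using V by (auto simp: T_verts_def \<gamma>_def)
    show "\<mu> x \<in> gauss_units" if "x \<in> T_verts k" for x using that V by (auto simp: T_verts_def \<mu>_def)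
    show "w (\<gamma> x) (\<gamma> y) = \<mu> x * T_listed k x y * cnj (\<mu> y)"
      if "x \<in> T_verts k" "y \<in> T_verts k" "T_listed k x y \<noteq> 0" for x y
      using that md e by (cases x; cases y) (auto simp: T_verts_def \<gamma>_def \<mu>_def split: if_splits)
    fix x assume "x \<in> T_verts k"
    then obtain i where i: "i < k" "x = Top i \<or> x = Bot i" by (auto simp: T_verts_def)
    define a where "a = (if Suc i = k then 0 else Suc i)"
    define b where "b = (if i = 0 then k - 1 else i - 1)"
    have ab: "a < k" "b < k" "a \<noteq> b" "(i + 1) mod k = a" "(b + 1) mod k = i"
      using i k by (auto simp: a_def b_def)
    hence "card {Top a, Bot a, Top b, Bot b} = 4" "{Top a, Bot a, Top b, Bot b} \<subseteq> T_verts k"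
      by (auto simp: T_verts_def)
    moreover have "\<forall>y\<in>{Top a, Bot a, Top b, Bot b}. T_listed k x y \<noteq> 0 \<or> T_listed k y x \<noteq> 0"
      using i(2) ab by auto
    ultimately show "\<exists>S\<subseteq>T_verts k. card S = 4 \<and> (\<forall>y\<in>S. T_listed k x y \<noteq> 0 \<or> T_listed k y x \<noteq> 0)"
      by blast
  qed
qed

lemma closed_ladder_Ti:
  assumes "closed_ladder k p q \<alpha> \<beta> \<i>"
  shows "represents V w (Ti_verts k) (Ti_weight k)"
proof -
  have k: "3 \<le> k" and inj: "inj_on p {..<k}" "inj_on q {..<k}"
    and pq: "\<And>i j. i < k \<Longrightarrow> j < k \<Longrightarrow> p i \<noteq> q j"
    and V: "\<And>j. j < k \<Longrightarrow> p j \<in> V \<and> q j \<in> V \<and> \<alpha> j \<in> gauss_units \<and> \<beta> j \<in> gauss_units"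
    and e: "\<And>j m c. j < k \<Longrightarrow> m = (if Suc j = k then 0 else Suc j) \<Longrightarrow> c = (if Suc j = k then \<i> else 1) \<Longrightarrow>
        w (p j) (p m) = c * \<alpha> j * cnj (\<alpha> m) \<and> w (p j) (q m) = c * \<alpha> j * cnj (\<beta> m) \<and>
        w (q j) (p m) = - (c * \<beta> j * cnj (\<alpha> m)) \<and> w (q j) (q m) = - (c * \<beta> j * cnj (\<beta> m))"
    using assms unfolding closed_ladder_def by blast+
  \<comment> \<open>Columns of T_{2k}^{(i)} are numbered from 1, those of the ladder from 0.\<close>
  define \<gamma> where "\<gamma> = case_T_vertex (\<lambda>i. p (i - 1)) (\<lambda>i. q (i - 1))"
  define \<mu> where "\<mu> = case_T_vertex (\<lambda>i. \<alpha> (i - 1)) (\<lambda>i. \<beta> (i - 1))"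
  show ?thesis unfolding Ti_weight_def
  proof (rule realize[where g = \<gamma> and \<mu> = \<mu>])
    show "finite (Ti_verts k)" "Ti_verts k \<noteq> {}" using k by (auto simp: Ti_verts_def)
    have lt: "i - 1 < k" if "1 \<le> i" "i \<le> k" for i :: nat using that by linarith
    have eq: "p (i - 1) = p (j - 1) \<longleftrightarrow> i = j" "q (i - 1) = q (j - 1) \<longleftrightarrow> i = j" "p (i - 1) \<noteq> q (j - 1)"
      if "1 \<le> i" "i \<le> k" "1 \<le> j" "j \<le> k" for i j
      using inj_onD[OF inj(1), of "i - 1" "j - 1"] inj_onD[OF inj(2), of "i - 1" "j - 1"]
        pq[of "i - 1" "j - 1"] lt[of i] lt[of j] that by auto
    show "inj_on \<gamma> (Ti_verts k)"
    proof (rule inj_onI)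
      fix x y assume "x \<in> Ti_verts k" "y \<in> Ti_verts k" "\<gamma> x = \<gamma> y"
      thus "x = y" using eq eq(3)[symmetric] by (cases x; cases y) (auto simp: Ti_verts_def \<gamma>_def)
    qed
    show "\<gamma> ` Ti_verts k \<subseteq> V" using V lt by (auto simp: Ti_verts_def \<gamma>_def)
    show "\<mu> x \<in> gauss_units" if "x \<in> Ti_verts k" for x using that V lt by (auto simp: Ti_verts_def \<mu>_def)
    have step: "Ti_step k i j \<noteq> 0 \<Longrightarrow> 1 \<le> i \<Longrightarrow> i \<le> k \<Longrightarrow> i - 1 < k \<and>
       j - 1 = (if Suc (i - 1) = k then 0 else Suc (i - 1)) \<and> Ti_step k i j = (if Suc (i - 1) = k then \<i> else 1)" for i j
      using k by (auto simp: Ti_step_def split: if_splits)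
    show "w (\<gamma> x) (\<gamma> y) = \<mu> x * Ti_listed k x y * cnj (\<mu> y)"
      if "x \<in> Ti_verts k" "y \<in> Ti_verts k" "Ti_listed k x y \<noteq> 0" for x y
    proof -
      obtain i where i: "x = Top i \<or> x = Bot i" "1 \<le> i" "i \<le> k" using \<open>x \<in> Ti_verts k\<close> by (auto simp: Ti_verts_def)
      obtain j where j: "y = Top j \<or> y = Bot j" by (cases y) auto
      have "Ti_step k i j \<noteq> 0" using that(3) i j by auto
      note s = step[OF this i(2,3)]
      show ?thesis using e[of "i - 1" "j - 1" "Ti_step k i j"] s i(1) j by (auto simp: \<gamma>_def \<mu>_def mult_ac)
    qed
    fix x assume "x \<in> Ti_verts k"
    then obtain i where i: "1 \<le> i" "i \<le> k" "x = Top i \<or> x = Bot i" by (auto simp: Ti_verts_def)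
    define a where "a = (if i = k then 1 else i + 1)"
    define b where "b = (if i = 1 then k else i - 1)"
    have ab: "1 \<le> a" "a \<le> k" "1 \<le> b" "b \<le> k" "a \<noteq> b" "Ti_step k i a \<noteq> 0" "Ti_step k b i \<noteq> 0"
      using i k by (auto simp: a_def b_def Ti_step_def)
    hence "card {Top a, Bot a, Top b, Bot b} = 4" "{Top a, Bot a, Top b, Bot b} \<subseteq> Ti_verts k"
      by (auto simp: Ti_verts_def)
    moreover have "\<forall>y\<in>{Top a, Bot a, Top b, Bot b}. Ti_listed k x y \<noteq> 0 \<or> Ti_listed k y x \<noteq> 0"
      using i(3) ab by auto
    ultimately show "\<exists>S\<subseteq>Ti_verts k. card S = 4 \<and> (\<forall>y\<in>S. Ti_listed k x y \<noteq> 0 \<or> Ti_listed k y x \<noteq> 0)"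
      by blast
  qed
qed

text \<open>By finiteness some pair meets an earlier one. Neighbourhoods on the ladder consist of
  the adjacent pairs, so at the first return the pair met is pair 0, and it is met in both members.
  Adjacent pairs and pairs two apart are disjoint, whence \<open>3 \<le> k\<close>.\<close>

lemma ladder_closes:
  assumes link: "\<And>j. link (p j) (q j) (p (Suc j)) (q (Suc j))"
    and N: "\<And>j. N (p (Suc j)) = {p j, q j, p (Suc (Suc j)), q (Suc (Suc j))}"
    and dist: "\<And>j. distinct [p j, q j, p (Suc (Suc j)), q (Suc (Suc j))]"
  obtains k where "3 \<le> k" "inj_on p {..<k}" "inj_on q {..<k}" "\<forall>i<k. \<forall>j<k. p i \<noteq> q j"
    "{p k, q k} = {p 0, q 0}" "N (p 0) = {p 1, q 1, p (k - 1), q (k - 1)}"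
proof -
  define S where "S j = {p j, q j}" for j
  note D = link_D[OF link]
  have NS: "N x = S j \<union> S (Suc (Suc j))" if "x \<in> S (Suc j)" for x j
    using that N[of j] D(3)[of "Suc j"] by (auto simp: S_def)
  have S1: "S j \<inter> S (Suc j) = {}" for j
    using D[of j] by (auto simp: S_def)
  have S2: "S j \<inter> S (Suc (Suc j)) = {}" for j
    using dist[of j] by (auto simp: S_def)
  have SV: "S j \<subseteq> V" for j using D(5-12)[of j] N_verts by (auto simp: S_def)
  have "\<not> inj p"
  proof
    assume "inj p"
    moreover have "range p \<subseteq> V" using SV by (auto simp: S_def)
    ultimately show False using finite_verts finite_subset infinite_UNIV_nat finite_imageD by blast
  qed
  then obtain i j where "i < j" "p i = p j" unfolding inj_def by (metis linorder_neqE_nat)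
  hence "S i \<inter> S j \<noteq> {}" by (simp add: S_def)
  hence ex: "\<exists>k. \<exists>m<k. S m \<inter> S k \<noteq> {}" using \<open>i < j\<close> by blast
  define k where "k = (LEAST k. \<exists>m<k. S m \<inter> S k \<noteq> {})"
  have "\<exists>m<k. S m \<inter> S k \<noteq> {}" unfolding k_def using ex by (rule LeastI_ex)
  then obtain m x where m: "m < k" "x \<in> S m" "x \<in> S k" by blast
  have disj: "S i \<inter> S j = {}" if "i < j" "j < k" for i j
    using not_less_Least[of j "\<lambda>k. \<exists>m<k. S m \<inter> S k \<noteq> {}"] that unfolding k_def by blast
  have m1: "Suc m \<noteq> k" using S1[of m] m by auto
  have m2: "Suc (Suc m) \<noteq> k" using S2[of m] m by auto
  have k: "3 \<le> k" using m(1) m1 m2 by linarith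
  have pk: "S (k - 1) \<subseteq> N x"
    using m(3) D(5-12)[of "k - 1"] k N_symD by (auto simp: S_def)
  \<comment> \<open>For m > 0 the pair k - 1, adjacent to \<open>x\<close>, would lie in the pairs m
    - 1 and m + 1, which are disjoint from it.\<close>
  have "m = 0"
  proof (rule ccontr)
    assume "m \<noteq> 0"
    then obtain l where l: "m = Suc l" by (cases m) auto
    hence "S (k - 1) \<subseteq> S l \<union> S (Suc m)" using NS[of x l] m(2) pk by auto
    moreover have "S l \<inter> S (k - 1) = {}" "S (Suc m) \<inter> S (k - 1) = {}"
      using disj[of l "k - 1"] disj[of "Suc m" "k - 1"] l m(1) m1 m2 by auto
    ultimately show False by (auto simp: S_def)
  qed
  have Nx: "N x = N (p 0)" using m(2) \<open>m = 0\<close> D(3)[of 0] by (auto simp: S_def)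
  have "S 1 \<subseteq> N (p 0)" using D(5,6)[of 0] by (auto simp: S_def)
  moreover have "S 1 \<inter> S (k - 1) = {}" using disj[of 1 "k - 1"] k by auto
  ultimately have Np0: "N (p 0) = {p 1, q 1, p (k - 1), q (k - 1)}"
    using pk Nx D(1)[of 1] D(1)[of "k - 1"] by (intro N_eqI) (auto simp: S_def)
  \<comment> \<open>The neighbours of pair k - 1 are the pairs l = k - 2 and k. Pair 0 is among them
    and disjoint from pair l, so it is pair k as a set, possibly with members exchanged.\<close>
  obtain l where l: "k = Suc (Suc l)" using k by (metis add_2_eq_Suc le_Suc_ex numeral_3_eq_3 Suc_eq_plus1 add_Suc_right add_Suc numeral_2_eq_2 add.commute)
  have "p (k - 1) \<in> N (p 0)" "p (k - 1) \<in> N (q 0)" using Np0 D(3)[of 0] by auto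
  hence "S 0 \<subseteq> N (p (k - 1))" using N_symD by (auto simp: S_def)
  moreover have "N (p (k - 1)) = S l \<union> S k" using NS[of "p (k - 1)" l] l by (auto simp: S_def)
  moreover have "S 0 \<inter> S l = {}" using disj[of 0 l] l k by auto
  ultimately have "S 0 \<subseteq> S k" by blast
  moreover have "card (S 0) = 2" "card (S k) = 2" using D(1)[of 0] D(1)[of k] by (auto simp: S_def)
  ultimately have "S 0 = S k" by (intro card_subset_eq) (auto simp: S_def)
  moreover have "p i \<noteq> q j" if "i < k" "j < k" for i j
    using disj[of i j] disj[of j i] that D(1)[of i] by (cases i j rule: linorder_cases) (auto simp: S_def)
  hence "\<forall>i<k. \<forall>j<k. p i \<noteq> q j" by blast
  moreover have "inj_on p {..<k}" "inj_on q {..<k}"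
    using disj by (auto simp: inj_on_def S_def) (metis insertI1 disjoint_iff insertI2 linorder_neqE_nat)+
  ultimately show ?thesis using that[of k] k Np0 by (auto simp: S_def)
qed

text \<open>Switching by transport along p 0, p 1, ... turns the weights into those of T_{2k}, up to
  one unit on the closing rung. Either way of gluing the last pair to the first is covered, as rows
  of a rung are proportional.\<close>

lemma ladder_gauge:
  assumes link: "\<And>j. link (p j) (q j) (p (Suc j)) (q (Suc j))"
    and N: "\<And>j. N (p (Suc j)) = {p j, q j, p (Suc (Suc j)), q (Suc (Suc j))}"
    and dist: "\<And>j. distinct [p j, q j, p (Suc (Suc j)), q (Suc (Suc j))]"
    and gain: "\<And>j. w (q (Suc j)) (p (Suc (Suc j))) * w (p (Suc (Suc j))) (p (Suc j))
           = - (w (q (Suc j)) (p j) * w (p j) (p (Suc j)))"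
  obtains k p' q' \<alpha> \<beta> g where "closed_ladder k p' q' \<alpha> \<beta> g" "g \<in> gauss_units"
proof -
  obtain k where k: "3 \<le> k" "inj_on p {..<k}" "inj_on q {..<k}" "\<forall>i<k. \<forall>j<k. p i \<noteq> q j"
    "{p k, q k} = {p 0, q 0}" "N (p 0) = {p 1, q 1, p (k - 1), q (k - 1)}"
    using ladder_closes[of p q, OF link N dist] .
  note D = link_D[OF link]
  \<comment> \<open>\<open>\<alpha>\<close> is the transport along the top rail;
    \<open>\<beta> j\<close> is chosen so that row \<open>q j\<close> becomes minus row
    \<open>p j\<close> on the following rung.\<close>
  define \<alpha> where "\<alpha> = rec_nat 1 (\<lambda>j a. w (p (Suc j)) (p j) * a)"
  define \<beta> where "\<beta> j = - (w (q j) (p (Suc j)) * w (p (Suc j)) (p j)) * \<alpha> j" for j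
  have \<alpha>: "\<alpha> 0 = 1" "\<alpha> (Suc j) = w (p (Suc j)) (p j) * \<alpha> j" for j by (simp_all add: \<alpha>_def)
  have \<alpha>u: "\<alpha> j \<in> gauss_units" for j
    by (induction j) (use D w_unit in \<open>auto simp: \<alpha>\<close>)
  have \<beta>u: "\<beta> j \<in> gauss_units" for j
    using \<alpha>u[of j] D(5-12)[of j] w_unit by (auto simp: \<beta>_def)
  \<comment> \<open>\<open>gain\<close> makes the factor of \<open>q (Suc j)\<close>, defined by the
    next rung, agree with the one read off the previous rung.\<close>
  have \<beta>Suc: "\<beta> (Suc j) = w (q (Suc j)) (p j) * \<alpha> j" for j
    unfolding \<beta>_def \<alpha> gain using D(5-12)[of j] by (simp add: mult.assoc)
  have \<beta>q: "\<beta> j = - (w (q j) (q (Suc j)) * w (q (Suc j)) (p j)) * \<alpha> j" for j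
    unfolding \<beta>_def D(13) ..
  have cnjw: "cnj (w x y) = w y x" for x y using herm[of y x] by simp
  have pp: "w (p j) (p (Suc j)) = \<alpha> j * cnj (\<alpha> (Suc j))" and pq: "w (p j) (q (Suc j)) = \<alpha> j * cnj (\<beta> (Suc j))" for j
    using \<alpha>u[of j] by (simp_all add: \<alpha> \<beta>Suc cnjw mult_ac)
  have up: "w (q j) x = - \<beta> j * cnj (\<alpha> j) * w (p j) x" if "x = p (Suc j) \<or> x = q (Suc j)" for j x
  proof -
    have "x \<in> N (p j)" using that D(5,6)[of j] by auto
    have "- \<beta> j = w (q j) x * w x (p j) * \<alpha> j" using that \<beta>_def[of j] \<beta>q[of j] by auto
    hence "- \<beta> j * cnj (\<alpha> j) * w (p j) x = w (q j) x * (w x (p j) * w (p j) x) * (\<alpha> j * cnj (\<alpha> j))"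
      by (simp add: mult_ac)
    thus ?thesis using \<open>x \<in> N (p j)\<close> \<alpha>u[of j] by simp
  qed
  have qp: "w (q j) (p (Suc j)) = - (\<beta> j * cnj (\<alpha> (Suc j)))" and qq: "w (q j) (q (Suc j)) = - (\<beta> j * cnj (\<beta> (Suc j)))" for j
    using up[of "p (Suc j)" j] up[of "q (Suc j)" j] \<alpha>u[of j] by (simp_all add: pp pq mult.assoc)
  define f where "f z = w (q 0) z * w z (p 0)" for z
  define l where "l = k - 1"
  have l: "Suc l = k" "0 < l" using k(1) by (auto simp: l_def)
  have \<beta>0: "f (p 1) = - \<beta> 0" "f (q 1) = - \<beta> 0" using \<beta>_def[of 0] \<beta>q[of 0] by (auto simp: f_def \<alpha>)
  have pl: "p l \<in> N (p 0)" "q l \<in> N (p 0)" "p l \<in> N (q 0)" "q l \<in> N (q 0)"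
    using k(6) D(3)[of 0] by (auto simp: l_def)
  \<comment> \<open>Orthogonality of the twins \<open>p 0\<close> and \<open>q 0\<close>: the ratios
    on pair 1 agree, so those on the last pair are both the opposite.\<close>
  have fl: "f (p l) = \<beta> 0" "f (q l) = \<beta> 0"
  proof -
    have "1 \<noteq> l" using k(1) l by auto
    moreover have "1 < k" "l < k" using k(1) l by auto
    ultimately have "p 1 \<noteq> p l" "q 1 \<noteq> q l" "p 1 \<noteq> q l" "p l \<noteq> q 1"
      using k(4) inj_onD[OF k(2), of 1 l] inj_onD[OF k(3), of 1 l] by auto
    hence "distinct [p 1, q 1, p l, q l]" using D(1)[of 1] D(1)[of l] by auto
    moreover have "sum f (N (p 0)) = 0"
      using orth[of "q 0" "p 0"] D(1)[of 0] D(3)[of 0] unfolding ip_common f_def by auto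
    ultimately have "f (p 1) + f (p 1) + (f (p l) + f (q l)) = 0"
      using k(6) \<beta>0 by (simp add: l_def add.assoc)
    moreover have "f (p 1) \<in> gauss_units" "f (p l) \<in> gauss_units" "f (q l) \<in> gauss_units"
      using \<beta>0 \<beta>u[of 0] pl w_unit by (auto simp: f_def)
    ultimately show "f (p l) = \<beta> 0" "f (q l) = \<beta> 0" using units_sum_cancel \<beta>0(1) by force+
  qed
  have closing: "w z (q 0) = cnj (\<beta> 0) * w z (p 0)" if "z = p l \<or> z = q l" for z
  proof -
    have z: "z \<in> N (p 0)" "z \<in> N (q 0)" using that pl by auto
    have "cnj (f z) = w z (q 0) * w (p 0) z" by (simp add: f_def cnjw)
    hence "cnj (\<beta> 0) * w z (p 0) = w z (q 0) * (w (p 0) z * w z (p 0))" using that fl by auto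
    thus ?thesis using z by simp
  qed
  \<comment> \<open>The weight of the closing edge after switching, since
    \<open>\<alpha> 0 = 1\<close>.\<close>
  define g where "g = cnj (\<alpha> l) * w (p l) (p 0)"
  have gu: "g \<in> gauss_units" using \<alpha>u pl w_unit by (auto simp: g_def)
  have g1: "w (p l) (p 0) = g * \<alpha> l" using \<alpha>u[of l] by (simp add: g_def mult_ac)
  have "p 0 = p (Suc l) \<or> p 0 = q (Suc l)" using k(5) l by auto
  hence g2: "w (q l) (p 0) = - (g * \<beta> l)" using up[of "p 0" l] by (simp add: g_def mult_ac)
  have "closed_ladder k p q \<alpha> \<beta> g" unfolding closed_ladder_def
  proof (intro conjI allI impI)
    fix j m :: nat and c assume j: "j < k" and m: "m = (if Suc j = k then 0 else Suc j)" and c: "c = (if Suc j = k then g else 1)"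
    show "w (p j) (p m) = c * \<alpha> j * cnj (\<alpha> m)" "w (p j) (q m) = c * \<alpha> j * cnj (\<beta> m)"
      "w (q j) (p m) = - (c * \<beta> j * cnj (\<alpha> m))" "w (q j) (q m) = - (c * \<beta> j * cnj (\<beta> m))"
      using m c l pp[of j] pq[of j] qp[of j] qq[of j] closing[of "p l"] closing[of "q l"] g1 g2 \<alpha>(1)
      by (auto split: if_splits)
  qed (use k \<alpha>u \<beta>u N_verts[OF D(5)] N_verts[OF D(7)] in auto)
  thus ?thesis using that gu by blast
qed

lemma represents_T_of_twins:
  assumes "v \<in> V" "v \<noteq> r" "N v = N r"
  shows "\<exists>k\<ge>3. represents V w (T_verts k) (T_weight k) \<or> represents V w (Ti_verts k) (Ti_weight k)"
proof -
  obtain t b t' b' where "link t b t' b'" using link_exists[OF assms] by blast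
  from ladder_exists[OF this] obtain p q where
    "\<forall>j. link (p j) (q j) (p (Suc j)) (q (Suc j)) \<and>
      N (p (Suc j)) = {p j, q j, p (Suc (Suc j)), q (Suc (Suc j))} \<and>
      distinct [p j, q j, p (Suc (Suc j)), q (Suc (Suc j))] \<and>
      w (q (Suc j)) (p (Suc (Suc j))) * w (p (Suc (Suc j))) (p (Suc j))
        = - (w (q (Suc j)) (p j) * w (p j) (p (Suc j)))" by blast
  hence pq: "link (p j) (q j) (p (Suc j)) (q (Suc j))"
    "N (p (Suc j)) = {p j, q j, p (Suc (Suc j)), q (Suc (Suc j))}"
    "distinct [p j, q j, p (Suc (Suc j)), q (Suc (Suc j))]"
    "w (q (Suc j)) (p (Suc (Suc j))) * w (p (Suc (Suc j))) (p (Suc j))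
        = - (w (q (Suc j)) (p j) * w (p j) (p (Suc j)))" for j by simp_all
  obtain k p' q' \<alpha> \<beta> g where L: "closed_ladder k p' q' \<alpha> \<beta> g" "g \<in> gauss_units"
    using ladder_gauge[of p q, OF pq] .
  obtain p' q' \<alpha> \<beta> g where L: "closed_ladder k p' q' \<alpha> \<beta> g" "g = 1 \<or> g = \<i>"
    using L(2)
  proof (cases rule: gauss_units_cases)
    case minus_one
    thus ?thesis using that closed_ladder_flip[OF L(1)] by fastforce
  next
    case minus_i
    thus ?thesis using that closed_ladder_flip[OF L(1)] by fastforce
  qed (use that L in blast)+
  hence "3 \<le> k" by (auto simp: closed_ladder_def)
  thus ?thesis using L closed_ladder_T closed_ladder_Ti by blast
qed

end

section \<open>Twin-free graphs with a triangle: S_8^dagger\<close>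

locale twin_free = weighing_graph +
  assumes no_twins: "u \<in> V \<Longrightarrow> u \<noteq> v \<Longrightarrow> N u \<noteq> N v"
begin

lemma card_common_2: "u \<noteq> v \<Longrightarrow> x \<in> N u \<Longrightarrow> x \<in> N v \<Longrightarrow> card (N u \<inter> N v) = 2"
  by (rule card_common[OF _ _ _ no_twins]) (auto intro: N_verts(1))

lemma common_eq:
  assumes "u \<noteq> v" "x \<noteq> y" "x \<in> N u" "x \<in> N v" "y \<in> N u" "y \<in> N v"
  shows "N u \<inter> N v = {x, y}"
proof -
  have "{x, y} = N u \<inter> N v"
    using card_common_2[OF assms(1,3,4)] assms by (intro card_subset_eq) auto
  thus ?thesis by simp
qed

lemma other:
  assumes "u \<noteq> v" "x \<in> N u" "x \<in> N v"
  obtains y where "y \<noteq> x" "y \<in> N u" "y \<in> N v" "N u \<inter> N v = {x, y}"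
proof -
  obtain a b where ab: "N u \<inter> N v = {a, b}" "a \<noteq> b"
    using card_common_2[OF assms] unfolding card_2_iff by blast
  define y where "y = (if x = a then b else a)"
  have "x = a \<or> x = b" using ab assms by blast
  hence "y \<noteq> x" "N u \<inter> N v = {x, y}" unfolding y_def using ab by auto
  thus ?thesis using that by blast
qed

lemma square:
  assumes "u \<noteq> v" "x \<noteq> y" "x \<in> N u" "x \<in> N v" "y \<in> N u" "y \<in> N v"
  shows "w u x * w x v + w u y * w y v = 0"
  using orth[OF assms(1)] assms(2) unfolding ip_common common_eq[OF assms] by simp

text \<open>Orthogonality of \<open>u\<close> and \<open>v\<close> says that the weights around the
  quadrangle u, x, v, y multiply to -1, so three of them determine the fourth.\<close>

lemma corner:
  assumes "u \<noteq> v" "x \<noteq> y" "x \<in> N u" "x \<in> N v" "y \<in> N u" "y \<in> N v"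
  shows "w y v = - (w y u * w u x * w x v)"
proof -
  have "w y u * (w u x * w x v + w u y * w y v) = 0" unfolding square[OF assms] by simp
  hence "w y u * w u x * w x v + w y v = 0" using assms by (simp add: distrib_left mult.assoc)
  thus ?thesis by (simp only: add_eq_0_iff minus_minus)
qed

text \<open>Let \<open>c\<close> be the second common neighbour of \<open>v\<close> and
  \<open>a\<close>, and \<open>y\<close> that of \<open>v\<close> and \<open>b\<close>. If they
  differed, the second common neighbour of \<open>v\<close> and \<open>c\<close> would have to be
  \<open>y\<close>, and \<open>a\<close> and \<open>y\<close> would share the three vertices
  \<open>v\<close>, \<open>b\<close>, \<open>c\<close>.\<close>

lemma triangle_extends:
  assumes "a \<in> N v" "b \<in> N v" "b \<in> N a"
  obtains c where "c \<in> N v" "c \<in> N a" "c \<in> N b"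
proof -
  have ne: "a \<noteq> v" "b \<noteq> v" "a \<noteq> b" using assms by auto
  obtain c where c: "c \<noteq> b" "c \<in> N v" "c \<in> N a" "N v \<inter> N a = {b, c}"
    using other[of v a b] assms ne by metis
  obtain y where y: "y \<noteq> a" "y \<in> N v" "y \<in> N b" "N v \<inter> N b = {a, y}"
    using other[of v b a] assms ne N_sym by metis
  have "y = c"
  proof (rule ccontr)
    assume yc: "y \<noteq> c"
    have ca: "c \<noteq> a" "y \<noteq> b" using c y by auto
    have Nv: "N v = {a, b, c, y}" by (rule N_eqI) (use assms c y ne yc ca in auto)
    have "v \<noteq> c" "a \<in> N c" using c N_sym by auto
    then obtain z where z: "z \<noteq> a" "z \<in> N v" "z \<in> N c" "N v \<inter> N c = {a, z}"
      using other[of v c a] assms by metis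
    have "c \<notin> N b" using y c yc ca by blast
    hence "z \<noteq> b" using z(3) N_sym by blast
    moreover have "z \<noteq> c" using z by auto
    ultimately have "z = y" using z Nv by auto
    hence "N a \<inter> N y \<supseteq> {v, b, c}" using assms c y z N_sym by blast
    hence "card {v, b, c} \<le> card (N a \<inter> N y)" by (intro card_mono) auto
    moreover have "card {v, b, c} = 3" using c ne \<open>v \<noteq> c\<close> by auto
    moreover have "card (N a \<inter> N y) = 2"
      using card_common_2[of a y v] y assms N_sym by blast
    ultimately show False by simp
  qed
  thus ?thesis using that c y by blast
qed

definition clique4 :: "'a \<Rightarrow> 'a \<Rightarrow> 'a \<Rightarrow> 'a \<Rightarrow> bool" where
  "clique4 a c e g \<longleftrightarrow> c \<in> N a \<and> e \<in> N a \<and> g \<in> N a \<and> e \<in> N c \<and> g \<in> N c \<and> g \<in> N e"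

lemma clique4_D:
  assumes "clique4 a c e g"
  shows "clique4 c a e g" "clique4 e a c g" "clique4 g a c e" "clique4 a g e c" "clique4 a e c g"
    "distinct [a, c, e, g]"
    "c \<in> N a" "e \<in> N a" "g \<in> N a" "e \<in> N c" "g \<in> N c" "g \<in> N e"
    "a \<in> N c" "a \<in> N e" "a \<in> N g" "c \<in> N e" "c \<in> N g" "e \<in> N g"
proof -
  have "c \<in> N a" "e \<in> N a" "g \<in> N a" "e \<in> N c" "g \<in> N c" "g \<in> N e"
    using assms by (auto simp: clique4_def)
  from this this[THEN N_symD] show "clique4 c a e g" "clique4 e a c g" "clique4 g a c e" "clique4 a g e c"
    "clique4 a e c g" "distinct [a, c, e, g]" "c \<in> N a" "e \<in> N a" "g \<in> N a" "e \<in> N c" "g \<in> N c" "g \<in> N e"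
    "a \<in> N c" "a \<in> N e" "a \<in> N g" "c \<in> N e" "c \<in> N g" "e \<in> N g"
    by (auto simp: clique4_def)
qed

text \<open>Two clique vertices already have the other two as their common neighbours, so the fourth
  neighbour of \<open>a\<close> is adjacent to no other clique vertex.\<close>

lemma clique4_outer:
  assumes "clique4 a c e g"
  obtains b where "N a = {b, c, e, g}" "c \<notin> N b" "e \<notin> N b" "g \<notin> N b"
proof -
  note K = clique4_D[OF assms]
  have "\<not> N a \<subseteq> {c, e, g}"
  proof
    assume "N a \<subseteq> {c, e, g}"
    hence "card (N a) \<le> card {c, e, g}" by (intro card_mono) auto
    also have "\<dots> \<le> 3" by (simp add: card_insert_if)
    finally show False using deg[of a] N_verts(1)[OF K(7)] by simp
  qed
  then obtain b where b: "b \<in> N a" "b \<notin> {c, e, g}" by blast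
  have "N a = {b, c, e, g}" by (rule N_eqI) (use K b in auto)
  moreover have "N a \<inter> N c = {e, g}" "N a \<inter> N e = {c, g}" "N a \<inter> N g = {c, e}"
    by (rule common_eq; use K in auto)+
  hence "b \<notin> N c" "b \<notin> N e" "b \<notin> N g" using b by blast+
  ultimately show ?thesis using that N_sym by blast
qed

text \<open>\<open>b\<close> and \<open>c\<close> share \<open>a\<close>, hence a second vertex, and
  among the neighbours of \<open>c\<close> only \<open>d\<close> is left. So the outer vertices form
  a second K_4, matched to the first.\<close>

lemma clique4_outer_adjacent:
  assumes "clique4 a c e g" "N a = {b, c, e, g}" "N c = {d, a, e, g}" "c \<notin> N b" "e \<notin> N b" "g \<notin> N b"
  shows "d \<in> N b"
proof -
  note K = clique4_D[OF assms(1)]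
  have "b \<noteq> c" using assms(5) K by auto
  moreover have "a \<in> N b" using assms(2) N_sym by blast
  ultimately obtain y where "y \<noteq> a" "y \<in> N b" "y \<in> N c" using other[of b c a] K by metis
  moreover have "y \<in> {d, a, e, g}" using \<open>y \<in> N c\<close> assms(3) by simp
  ultimately show ?thesis using assms(4-6) by auto
qed

text \<open>Seven tree edges and the chord \<open>w c e\<close> are normalised;
  \<open>corner\<close> computes the other eight edges one after the other.\<close>

lemma S8_normal:
  assumes K: "clique4 a c e g"
    and "b \<in> N a" "d \<in> N c" "f \<in> N e" "h \<in> N g"
    and "d \<in> N b" "f \<in> N b" "h \<in> N b" "f \<in> N d" "h \<in> N d" "h \<in> N f"
    and dist: "distinct [a, b, c, d, e, f, g, h]"
    and tree: "w b a = 1" "w d c = 1" "w f e = 1" "w h g = 1" "w c a = 1" "w g a = 1" "w e a = \<i>"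
    and "w c e = 1"
  shows "represents V w UNIV S8_weight"
proof -
  note adj = clique4_D(7-)[OF K] assms(2-11)
  note adj' = adj adj[THEN N_symD]
  have d: "a \<noteq> b" "a \<noteq> c" "a \<noteq> d" "a \<noteq> e" "a \<noteq> f" "a \<noteq> g" "a \<noteq> h" "b \<noteq> c" "b \<noteq> d" "b \<noteq> e" "b \<noteq> f" "b \<noteq> g"
    "b \<noteq> h" "c \<noteq> d" "c \<noteq> e" "c \<noteq> f" "c \<noteq> g" "c \<noteq> h" "d \<noteq> e" "d \<noteq> f" "d \<noteq> g" "d \<noteq> h" "e \<noteq> f" "e \<noteq> g" "e \<noteq> h"
    "f \<noteq> g" "f \<noteq> h" "g \<noteq> h" using dist by auto
  note d' = d d[symmetric]
  have t: "w a b = 1" "w c d = 1" "w e f = 1" "w g h = 1" "w a c = 1" "w a g = 1" "w a e = - \<i>"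
    and ec: "w e c = 1"
    using tree assms(20) herm[of a] herm[of c d] herm[of e f] herm[of g h] herm[of e c] by simp_all
  have ge: "w g e = -1" using corner[of a e c g] adj' d' t tree assms(20) by simp
  have eg: "w e g = -1" using herm[of e g] ge by simp
  have gc: "w g c = \<i>" using corner[of a c e g] adj' d' t tree ec by simp
  have cg: "w c g = - \<i>" using herm[of c g] gc by simp
  have bd: "w b d = -1" using corner[of a d c b] adj' d' t tree by simp
  have bf: "w b f = \<i>" using corner[of a f e b] adj' d' t tree by simp
  have bh: "w b h = -1" using corner[of a h g b] adj' d' t tree by simp
  have df: "w d f = -1" using corner[of c f e d] adj' d' t tree assms(20) by simp
  have dh: "w d h = \<i>" using corner[of c h g d] adj' d' t tree cg by simp
  have fh: "w f h = 1" using corner[of e h g f] adj' d' t tree eg by simp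
  define \<gamma> where "\<gamma> p = (case p of Va \<Rightarrow> a | Vb \<Rightarrow> b | Vc \<Rightarrow> c | Vd \<Rightarrow> d | Ve \<Rightarrow> e | Vf \<Rightarrow> f | Vg \<Rightarrow> g | Vh \<Rightarrow> h)" for p
  have UNIV: "UNIV = {Va, Vb, Vc, Vd, Ve, Vf, Vg, Vh}" using S8_vertex.exhaust by blast
  show ?thesis unfolding S8_weight_def
  proof (rule realize[where g = \<gamma> and \<mu> = "\<lambda>_. 1"])
    show "finite (UNIV :: S8_vertex set)" unfolding UNIV by simp
    show "inj_on \<gamma> UNIV" using d' by (intro injI) (auto simp: \<gamma>_def split: S8_vertex.splits)
    show "\<gamma> ` UNIV \<subseteq> V" using adj' N_verts unfolding UNIV by (auto simp: \<gamma>_def)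
    show "w (\<gamma> p) (\<gamma> q) = 1 * S8_listed p q * cnj 1" if "S8_listed p q \<noteq> 0" for p q
      using that tree t assms(20) ec ge eg gc cg bd bf bh df dh fh
      by (cases p; cases q) (simp_all add: \<gamma>_def S8_listed_def)
    fix p
    show "\<exists>S\<subseteq>UNIV. card S = 4 \<and> (\<forall>q\<in>S. S8_listed p q \<noteq> 0 \<or> S8_listed q p \<noteq> 0)"
      by (rule exI[of _ "case p of Va \<Rightarrow> {Vb, Vc, Ve, Vg} | Vb \<Rightarrow> {Va, Vd, Vf, Vh} | Vc \<Rightarrow> {Va, Vd, Ve, Vg}
        | Vd \<Rightarrow> {Vb, Vc, Vf, Vh} | Ve \<Rightarrow> {Va, Vc, Vf, Vg} | Vf \<Rightarrow> {Vb, Vd, Ve, Vh} | Vg \<Rightarrow> {Va, Vc, Ve, Vh}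
        | Vh \<Rightarrow> {Vb, Vd, Vf, Vg}"], cases p) (simp_all add: S8_listed_def)
  qed auto
qed

lemma switch_twin_free:
  assumes "\<And>v. \<nu> v \<in> gauss_units"
  shows "twin_free V (\<lambda>u v. \<nu> u * w u v * cnj (\<nu> v))"
    and "gauss_graph.N (\<lambda>u v. \<nu> u * w u v * cnj (\<nu> v)) = N"
proof -
  interpret W: weighing_graph V "\<lambda>u v. \<nu> u * w u v * cnj (\<nu> v)" by (rule switch[OF assms])
  have "\<nu> v \<noteq> 0" for v using assms[of v] by auto
  thus N: "W.N = N" by (simp add: fun_eq_iff W.N_def N_def)
  show "twin_free V (\<lambda>u v. \<nu> u * w u v * cnj (\<nu> v))"
    by unfold_locales (use no_twins N in auto)
qed

text \<open>The gain of the triangle is invariant under switching, so with the tree values below it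
  forces the weight of the chord from \<open>c\<close> to \<open>e\<close> to be 1.\<close>

lemma S8_oriented:
  assumes K: "clique4 a c e g" and \<Gamma>: "w a c * w c e * w e a = \<i>"
  shows "represents V w UNIV S8_weight"
proof -
  note D = clique4_D[OF K]
  obtain b where b: "N a = {b, c, e, g}" "c \<notin> N b" "e \<notin> N b" "g \<notin> N b" using clique4_outer[OF K] .
  obtain d where d: "N c = {d, a, e, g}" "a \<notin> N d" "e \<notin> N d" "g \<notin> N d" using clique4_outer[OF D(1)] .
  obtain f where f: "N e = {f, a, c, g}" "a \<notin> N f" "c \<notin> N f" "g \<notin> N f" using clique4_outer[OF D(2)] .
  obtain h where h: "N g = {h, a, c, e}" "a \<notin> N h" "c \<notin> N h" "e \<notin> N h" using clique4_outer[OF D(3)] .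
  have adj: "d \<in> N b" "f \<in> N b" "h \<in> N b" "f \<in> N d" "h \<in> N d" "h \<in> N f"
  proof -
    show "d \<in> N b" by (rule clique4_outer_adjacent[OF K b(1) d(1)]) (use b in auto)
    show "f \<in> N b" by (rule clique4_outer_adjacent[of a e c g]) (use b f D in auto)
    show "h \<in> N b" by (rule clique4_outer_adjacent[of a g c e]) (use b h D in \<open>auto simp: clique4_def\<close>)
    show "f \<in> N d" by (rule clique4_outer_adjacent[of c e a g]) (use d f D in \<open>auto simp: clique4_def\<close>)
    show "h \<in> N d" by (rule clique4_outer_adjacent[of c g a e]) (use d h D in \<open>auto simp: clique4_def\<close>)
    show "h \<in> N f" by (rule clique4_outer_adjacent[of e g a c]) (use f h D in \<open>auto simp: clique4_def\<close>)
  qed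
  have in1: "b \<in> N a" "d \<in> N c" "f \<in> N e" "h \<in> N g" using b d f h by auto
  have in2: "a \<in> N b" "c \<in> N d" "e \<in> N f" "g \<in> N h" using in1[THEN N_symD] by auto
  have dist: "distinct [a, b, c, d, e, f, g, h]"
    using D(6) D(7-18) b(2-4) d(2-4) f(2-4) h(2-4) adj in1 in2
    by auto
  \<comment> \<open>A spanning tree rooted at \<open>a\<close>, outer vertices first; the value i at
    the edge from \<open>e\<close> to \<open>a\<close> is that of S_8^dagger.\<close>
  define es where "es = [(b, a, 1), (d, c, 1), (f, e, 1), (h, g, 1), (c, a, 1), (g, a, 1), (e, a, \<i>)]"
  have "tree_order w es" using dist in2 in1 D w_unit by (auto simp: es_def)
  then obtain \<nu> where \<nu>: "\<forall>v. \<nu> v \<in> gauss_units" "\<forall>(x, p, t) \<in> set es. \<nu> x * w x p * cnj (\<nu> p) = t"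
    using tree_switch by blast
  define w' where "w' = (\<lambda>u v. \<nu> u * w u v * cnj (\<nu> v))"
  interpret W: twin_free V w' unfolding w'_def by (rule switch_twin_free) (use \<nu> in auto)
  have WN: "W.N = N" unfolding w'_def by (rule switch_twin_free) (use \<nu> in auto)
  have tree: "w' b a = 1" "w' d c = 1" "w' f e = 1" "w' h g = 1" "w' c a = 1" "w' g a = 1" "w' e a = \<i>"
    using \<nu>(2) by (simp_all add: es_def w'_def)
  have "w' a c * w' c e * w' e a = w a c * w c e * w e a * (\<nu> a * cnj (\<nu> a)) * (\<nu> c * cnj (\<nu> c)) * (\<nu> e * cnj (\<nu> e))"
    by (simp add: w'_def mult_ac)
  also have "\<dots> = \<i>" using \<nu>(1) \<Gamma> by simp
  finally have "w' c e = 1" using tree W.herm[of c a] by simp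
  hence "represents V w' UNIV S8_weight"
    by (intro W.S8_normal[of a c e g b d f h])
       (use K dist adj in1 tree in \<open>auto simp: WN clique4_def W.clique4_def\<close>)
  thus ?thesis unfolding w'_def by (rule represents_switch) (use \<nu> in auto)
qed

text \<open>Orthogonality relates the gains of the triangles at \<open>v\<close>: y = -x, z = -y and
  cnj z = -x. So cnj x = -x, which leaves x = i or x = -i; in the latter case y = i, and the other
  triangle is used.\<close>

lemma S8_of_triangle:
  assumes "a \<in> N v" "b \<in> N v" "b \<in> N a"
  shows "represents V w UNIV S8_weight"
proof -
  obtain c where c: "c \<in> N v" "c \<in> N a" "c \<in> N b" using triangle_extends[OF assms] .
  have K: "clique4 v a b c" using assms c by (auto simp: clique4_def)
  note D = clique4_D[OF K]
  define x where "x = w v a * w a b * w b v"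
  define y where "y = w v a * w a c * w c v"
  define z where "z = w v b * w b c * w c v"
  have u: "x \<in> gauss_units" unfolding x_def using D w_unit by simp
  have "(w v a * w a c + w v b * w b c) * w c v = 0" using square[of v c a b] D by auto
  hence 1: "z = - y" by (simp add: z_def y_def distrib_right add_eq_0_iff)
  have "(w v a * w a b + w v c * w c b) * w b v = 0" using square[of v b a c] D by auto
  moreover have "cnj z = w v c * w c b * w b v"
    by (simp add: z_def mult_ac herm[of b v] herm[of c b] herm[of v c])
  ultimately have 2: "cnj z = - x" by (simp add: x_def distrib_right add_eq_0_iff)
  have "(w v b * w b a + w v c * w c a) * w a v = 0" using square[of v a b c] D by auto
  moreover have "cnj x = w v b * w b a * w a v" "cnj y = w v c * w c a * w a v"
    by (simp_all add: x_def y_def mult_ac herm[of b v] herm[of c a] herm[of b a] herm[of a v] herm[of v c])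
  ultimately have "cnj y = cnj (- x)" by (simp add: distrib_right add_eq_0_iff)
  hence "y = - x" by (simp only: complex_cnj_cancel_iff)
  hence "cnj x = - x" using 1 2 by simp
  hence "x = \<i> \<or> y = \<i>" using u \<open>y = - x\<close> by (auto simp: gauss_units_eq)
  thus ?thesis
  proof
    assume "x = \<i>"
    thus ?thesis using S8_oriented[OF K] by (simp add: x_def)
  next
    assume "y = \<i>"
    moreover have "clique4 v a c b" using D by (auto simp: clique4_def)
    ultimately show ?thesis using S8_oriented[of v a c b] by (simp add: y_def)
  qed
qed

end

section \<open>Twin-free graphs without triangles: S_14 and S_16\<close>

definition list_label :: "'a list \<Rightarrow> 'a list \<Rightarrow> ON_vertex \<Rightarrow> 'a" where
  "list_label xs ys p = (case p of Ov i \<Rightarrow> xs ! i | Nv i \<Rightarrow> ys ! i)"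

lemma inj_on_list_label:
  assumes "distinct xs" "distinct ys" "set xs \<inter> set ys = {}" "length xs = m" "length ys = m"
  shows "inj_on (list_label xs ys) (ON_verts m)"
proof (rule inj_onI)
  fix p q assume "p \<in> ON_verts m" "q \<in> ON_verts m" "list_label xs ys p = list_label xs ys q"
  moreover have "xs ! i \<noteq> ys ! j" if "i < m" "j < m" for i j
    using assms(3-5) that nth_mem[of i xs] nth_mem[of j ys] by (metis IntI empty_iff)
  ultimately show "p = q"
    using assms by (cases p; cases q) (auto simp: list_label_def ON_verts_def nth_eq_iff_index_eq, metis)
qed

lemma list_label_image:
  assumes "set xs \<union> set ys \<subseteq> S" "length xs = m" "length ys = m"
  shows "list_label xs ys ` ON_verts m \<subseteq> S"
proof (rule image_subsetI)
  fix p assume p: "p \<in> ON_verts m"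
  show "list_label xs ys p \<in> S"
  proof (cases p)
    case (Ov i)
    hence "xs ! i \<in> set xs" using p assms(2) by (intro nth_mem) (auto simp: ON_verts_def)
    thus ?thesis using assms(1) Ov by (auto simp: list_label_def)
  next
    case (Nv i)
    hence "ys ! i \<in> set ys" using p assms(3) by (intro nth_mem) (auto simp: ON_verts_def)
    thus ?thesis using assms(1) Nv by (auto simp: list_label_def)
  qed
qed

lemma all_less_7: "(\<forall>i<7. P i) \<longleftrightarrow> P 0 \<and> P 1 \<and> P 2 \<and> P 3 \<and> P 4 \<and> P 5 \<and> P (6::nat)"
  by (simp add: numeral_eq_Suc All_less_Suc) blast

lemma all_less_8: "(\<forall>i<8. P i) \<longleftrightarrow> P 0 \<and> P 1 \<and> P 2 \<and> P 3 \<and> P 4 \<and> P 5 \<and> P 6 \<and> P (7::nat)"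
  by (simp add: numeral_eq_Suc All_less_Suc) blast

context twin_free
begin

lemma w_real_sym: "w x y = t \<Longrightarrow> w y x = cnj t"
  using herm[of y x] by simp

lemma w_N: "w x y = t \<Longrightarrow> t \<noteq> 0 \<Longrightarrow> y \<in> N x"
  by (simp add: N_def)

text \<open>\<open>corner\<close> in the form used for computing with weights 1 and -1, yielding
  both directions of the new edge.\<close>

lemma corner_real:
  assumes "u \<noteq> v" "x \<noteq> y" "x \<in> N u" "x \<in> N v" "y \<in> N u" "y \<in> N v"
    and "w y u * w u x * w x v = - t" "cnj t = t"
  shows "w y v = t" "w v y = t"
proof -
  show "w y v = t" using corner[OF assms(1-6)] assms(7) by simp
  thus "w v y = t" using herm[of v y] assms(8) by simp
qed

lemma (in -) S14_regular:
  assumes "p \<in> ON_verts 7"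
  shows "\<exists>S\<subseteq>ON_verts 7. card S = 4 \<and> (\<forall>q\<in>S. S14_listed p q \<noteq> 0 \<or> S14_listed q p \<noteq> 0)"
proof (cases p)
  case (Ov i)
  define S where "S = {Nv i, Nv ((i + 1) mod 7), Nv ((i + 3) mod 7), Nv ((i + 6) mod 7)}"
  have i: "i < 7" using assms Ov by (auto simp: ON_verts_def)
  have "\<forall>i<7. let S = {Nv i, Nv ((i + 1) mod 7), Nv ((i + 3) mod 7), Nv ((i + 6) mod 7)} in card S = 4 \<and>
      (\<forall>q\<in>S. S14_listed (Ov i) q \<noteq> 0 \<or> S14_listed q (Ov i) \<noteq> 0)"
    unfolding all_less_7 by (simp add: Let_def)
  from this[rule_format, OF i] have "card S = 4 \<and> (\<forall>q\<in>S. S14_listed p q \<noteq> 0 \<or> S14_listed q p \<noteq> 0)"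
    unfolding S_def Ov Let_def .
  moreover have "S \<subseteq> ON_verts 7" using i by (auto simp: S_def ON_verts_def)
  ultimately show ?thesis by blast
next
  case (Nv i)
  \<comment> \<open>Seen from an n-vertex, the offsets 0, 1, 3, -1 are negated modulo 7.\<close>
  define S where "S = {Ov i, Ov ((i + 6) mod 7), Ov ((i + 4) mod 7), Ov ((i + 1) mod 7)}"
  have i: "i < 7" using assms Nv by (auto simp: ON_verts_def)
  have "\<forall>i<7. let S = {Ov i, Ov ((i + 6) mod 7), Ov ((i + 4) mod 7), Ov ((i + 1) mod 7)} in card S = 4 \<and>
      (\<forall>q\<in>S. S14_listed (Nv i) q \<noteq> 0 \<or> S14_listed q (Nv i) \<noteq> 0)"
    unfolding all_less_7 by (simp add: Let_def)
  from this[rule_format, OF i] have "card S = 4 \<and> (\<forall>q\<in>S. S14_listed p q \<noteq> 0 \<or> S14_listed q p \<noteq> 0)"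
    unfolding S_def Nv Let_def .
  moreover have "S \<subseteq> ON_verts 7" using i by (auto simp: S_def ON_verts_def)
  ultimately show ?thesis by blast
qed

lemma (in -) S14_listed_cases:
  assumes "p \<in> ON_verts 7" "q \<in> ON_verts 7" "S14_listed p q \<noteq> 0"
  obtains i where "i < 7" "p = Ov i" "q = Nv i" "S14_listed p q = 1"
    | i where "i < 7" "p = Ov i" "q = Nv ((i + 1) mod 7)" "S14_listed p q = 1"
    | i where "i < 7" "p = Ov i" "q = Nv ((i + 3) mod 7)" "S14_listed p q = 1"
    | i where "i < 7" "p = Ov i" "q = Nv ((i + 6) mod 7)" "S14_listed p q = - 1"
  using assms by (cases p; cases q; simp add: ON_verts_def image_iff split: if_splits; blast?)

text \<open>The 14 vertices form the incidence graph of the complement of the Fano plane: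
  \<open>v\<close> and the r's against the a's and \<open>x\<close>, \<open>y\<close>,
  \<open>z\<close>. Of its 28 edges, 13 form a spanning tree whose values are prescribed so that
  \<open>corner\<close> gives exactly the weights of S_14 on the other 15.\<close>

lemma S14_normal:
  assumes dist: "distinct [v, a1, a2, a3, a4, r12, r13, r14, r23, r24, r34, x, y, z]"
    and tree:
      "w a1 v = 1" "w a2 v = 1" "w a3 v = 1" "w a4 v = - 1" "w r12 a1 = - 1" "w r13 a1 = 1"
      "w r14 a1 = 1" "w r23 a2 = - 1" "w r24 a2 = 1" "w r34 a3 = 1" "w x r12 = 1" "w y r12 = 1"
      "w z r13 = 1"
    and adj:
      "a2 \<in> N r12" "a3 \<in> N r13" "a4 \<in> N r14" "a3 \<in> N r23" "a4 \<in> N r24"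
      "a4 \<in> N r34" "r13 \<in> N x" "r24 \<in> N x" "r34 \<in> N x" "r14 \<in> N y"
      "r23 \<in> N y" "r34 \<in> N y" "r14 \<in> N z" "r23 \<in> N z" "r24 \<in> N z"
  shows "represents V w (ON_verts 7) S14_weight"
proof -
  note t = tree tree[THEN w_real_sym, simplified]
  note d = dist[simplified]
  note a = t[THEN w_N, simplified] adj adj[THEN N_symD]
  note e = t
  have "w r12 a2 = 1" "w a2 r12 = 1"
    by (rule corner_real[of a1 a2 v r12 "1"]; simp add: a d e)+
  note e = e this
  have "w r13 a3 = - 1" "w a3 r13 = - 1"
    by (rule corner_real[of a1 a3 v r13 "- 1"]; simp add: a d e)+
  note e = e this
  have "w r14 a4 = 1" "w a4 r14 = 1"
    by (rule corner_real[of a1 a4 v r14 "1"]; simp add: a d e)+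
  note e = e this
  have "w r23 a3 = 1" "w a3 r23 = 1"
    by (rule corner_real[of a2 a3 v r23 "1"]; simp add: a d e)+
  note e = e this
  have "w r24 a4 = 1" "w a4 r24 = 1"
    by (rule corner_real[of a2 a4 v r24 "1"]; simp add: a d e)+
  note e = e this
  have "w r34 a4 = 1" "w a4 r34 = 1"
    by (rule corner_real[of a3 a4 v r34 "1"]; simp add: a d e)+
  note e = e this
  have "w x r13 = 1" "w r13 x = 1"
    by (rule corner_real[of r12 r13 a1 x "1"]; simp add: a d e)+
  note e = e this
  have "w x r24 = - 1" "w r24 x = - 1"
    by (rule corner_real[of r12 r24 a2 x "- 1"]; simp add: a d e)+
  note e = e this
  have "w x r34 = 1" "w r34 x = 1"
    by (rule corner_real[of r13 r34 a3 x "1"]; simp add: a d e)+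
  note e = e this
  have "w y r14 = 1" "w r14 y = 1"
    by (rule corner_real[of r12 r14 a1 y "1"]; simp add: a d e)+
  note e = e this
  have "w y r23 = 1" "w r23 y = 1"
    by (rule corner_real[of r12 r23 a2 y "1"]; simp add: a d e)+
  note e = e this
  have "w y r34 = - 1" "w r34 y = - 1"
    by (rule corner_real[of r14 r34 a4 y "- 1"]; simp add: a d e)+
  note e = e this
  have "w z r14 = - 1" "w r14 z = - 1"
    by (rule corner_real[of r13 r14 a1 z "- 1"]; simp add: a d e)+
  note e = e this
  have "w z r23 = 1" "w r23 z = 1"
    by (rule corner_real[of r13 r23 a3 z "1"]; simp add: a d e)+
  note e = e this
  have "w z r24 = 1" "w r24 z = 1"
    by (rule corner_real[of r14 r24 a4 z "1"]; simp add: a d e)+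
  note e = e this
  \<comment> \<open>The two sides of the bipartition, ordered so that incidence becomes the offsets
    0, 1, 3 and -1 modulo 7.\<close>
  define \<gamma> where "\<gamma> = list_label [v, r12, r23, r34, r13, r24, r14] [a1, a2, y, a3, x, z, a4]"
  show ?thesis unfolding S14_weight_def
  proof (rule realize[where g = \<gamma> and \<mu> = "\<lambda>_. 1"])
    show "finite (ON_verts 7)" "ON_verts 7 \<noteq> {}" by (auto simp: ON_verts_def)
    show "inj_on \<gamma> (ON_verts 7)" unfolding \<gamma>_def by (rule inj_on_list_label) (use dist in auto)
    have "set [v, r12, r23, r34, r13, r24, r14] \<union> set [a1, a2, y, a3, x, z, a4] \<subseteq> V" using a N_verts by simp
    thus "\<gamma> ` ON_verts 7 \<subseteq> V" unfolding \<gamma>_def by (intro list_label_image) simp_all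
    have "\<forall>i<7. w (\<gamma> (Ov i)) (\<gamma> (Nv i)) = 1 \<and>
      w (\<gamma> (Ov i)) (\<gamma> (Nv ((i + 1) mod 7))) = 1 \<and>
      w (\<gamma> (Ov i)) (\<gamma> (Nv ((i + 3) mod 7))) = 1 \<and>
      w (\<gamma> (Ov i)) (\<gamma> (Nv ((i + 6) mod 7))) = - 1"
      unfolding all_less_7 by (simp add: \<gamma>_def list_label_def e)
    note vals = this[rule_format]
    show "w (\<gamma> p) (\<gamma> q) = 1 * S14_listed p q * cnj 1"
      if "p \<in> ON_verts 7" "q \<in> ON_verts 7" "S14_listed p q \<noteq> 0" for p q
      using that by (cases rule: S14_listed_cases) (use vals in simp_all)
    show "\<exists>S\<subseteq>ON_verts 7. card S = 4 \<and> (\<forall>q\<in>S. S14_listed p q \<noteq> 0 \<or> S14_listed q p \<noteq> 0)"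
      if "p \<in> ON_verts 7" for p using S14_regular[OF that] .
  qed auto
qed

lemma S14:
  assumes dist: "distinct [v, a1, a2, a3, a4, r12, r13, r14, r23, r24, r34, x, y, z]"
    and adj:
      "v \<in> N a1" "v \<in> N a2" "v \<in> N a3" "v \<in> N a4" "a1 \<in> N r12" "a1 \<in> N r13"
      "a1 \<in> N r14" "a2 \<in> N r23" "a2 \<in> N r24" "a3 \<in> N r34" "r12 \<in> N x"
      "r12 \<in> N y" "r13 \<in> N z" "a2 \<in> N r12" "a3 \<in> N r13" "a4 \<in> N r14"
      "a3 \<in> N r23" "a4 \<in> N r24" "a4 \<in> N r34" "r13 \<in> N x" "r24 \<in> N x"
      "r34 \<in> N x" "r14 \<in> N y" "r23 \<in> N y" "r34 \<in> N y" "r14 \<in> N z"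
      "r23 \<in> N z" "r24 \<in> N z"
  shows "represents V w (ON_verts 7) S14_weight"
proof -
  define es :: "('a \<times> 'a \<times> complex) list" where "es =
    [(z, r13, 1), (y, r12, 1), (x, r12, 1), (r34, a3, 1), (r24, a2, 1), (r23, a2, - 1), (r14, a1, 1),
    (r13, a1, 1), (r12, a1, - 1), (a4, v, - 1), (a3, v, 1), (a2, v, 1), (a1, v, 1)]"
  have "tree_order w es" using dist adj[THEN w_unit(1)] by (auto simp: es_def)
  then obtain \<nu> where \<nu>: "\<forall>v. \<nu> v \<in> gauss_units" "\<forall>(x, p, t) \<in> set es. \<nu> x * w x p * cnj (\<nu> p) = t"
    using tree_switch by blast
  define w' where "w' = (\<lambda>u v. \<nu> u * w u v * cnj (\<nu> v))"
  interpret W: twin_free V w' unfolding w'_def by (rule switch_twin_free) (use \<nu> in auto)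
  have WN: "W.N = N" unfolding w'_def by (rule switch_twin_free) (use \<nu> in auto)
  have tree:
    "w' a1 v = 1" "w' a2 v = 1" "w' a3 v = 1" "w' a4 v = - 1" "w' r12 a1 = - 1" "w' r13 a1 = 1"
    "w' r14 a1 = 1" "w' r23 a2 = - 1" "w' r24 a2 = 1" "w' r34 a3 = 1" "w' x r12 = 1" "w' y r12 = 1"
    "w' z r13 = 1"
    using \<nu>(2) by (simp_all add: es_def w'_def)
  have "represents V w' (ON_verts 7) S14_weight"
    by (rule W.S14_normal[OF dist tree]) (use adj in \<open>auto simp: WN\<close>)
  thus ?thesis unfolding w'_def by (rule represents_switch) (use \<nu> in auto)
qed
lemma (in -) S16_regular:
  assumes "p \<in> ON_verts 8"
  shows "\<exists>S\<subseteq>ON_verts 8. card S = 4 \<and> (\<forall>q\<in>S. S16_listed p q \<noteq> 0 \<or> S16_listed q p \<noteq> 0)"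
proof (cases p)
  case (Ov i)
  define S where "S = {Ov ((i + 1) mod 8), Ov ((i + 7) mod 8), Nv ((i + 1) mod 8), Nv ((i + 7) mod 8)}"
  have i: "i < 8" using assms Ov by (auto simp: ON_verts_def)
  have "\<forall>i<8. let S = {Ov ((i + 1) mod 8), Ov ((i + 7) mod 8), Nv ((i + 1) mod 8), Nv ((i + 7) mod 8)} in card S = 4 \<and>
      (\<forall>q\<in>S. S16_listed (Ov i) q \<noteq> 0 \<or> S16_listed q (Ov i) \<noteq> 0)"
    unfolding all_less_8 by (simp add: Let_def)
  from this[rule_format, OF i] have "card S = 4 \<and> (\<forall>q\<in>S. S16_listed p q \<noteq> 0 \<or> S16_listed q p \<noteq> 0)"
    unfolding S_def Ov Let_def .
  moreover have "S \<subseteq> ON_verts 8" using i by (auto simp: S_def ON_verts_def)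
  ultimately show ?thesis by blast
next
  case (Nv i)
  define S where "S = {Nv ((i + 3) mod 8), Nv ((i + 5) mod 8), Ov ((i + 1) mod 8), Ov ((i + 7) mod 8)}"
  have i: "i < 8" using assms Nv by (auto simp: ON_verts_def)
  have "\<forall>i<8. let S = {Nv ((i + 3) mod 8), Nv ((i + 5) mod 8), Ov ((i + 1) mod 8), Ov ((i + 7) mod 8)} in card S = 4 \<and>
      (\<forall>q\<in>S. S16_listed (Nv i) q \<noteq> 0 \<or> S16_listed q (Nv i) \<noteq> 0)"
    unfolding all_less_8 by (simp add: Let_def)
  from this[rule_format, OF i] have "card S = 4 \<and> (\<forall>q\<in>S. S16_listed p q \<noteq> 0 \<or> S16_listed q p \<noteq> 0)"
    unfolding S_def Nv Let_def .
  moreover have "S \<subseteq> ON_verts 8" using i by (auto simp: S_def ON_verts_def)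
  ultimately show ?thesis by blast
qed

lemma (in -) S16_listed_cases:
  assumes "p \<in> ON_verts 8" "q \<in> ON_verts 8" "S16_listed p q \<noteq> 0"
  obtains i where "i < 8" "p = Ov i" "q = Ov ((i + 1) mod 8)" "S16_listed p q = 1"
    | i where "i < 8" "p = Nv i" "q = Nv ((i + 3) mod 8)" "S16_listed p q = 1"
    | i where "i < 8" "p = Ov i" "q = Nv ((i + 1) mod 8)" "S16_listed p q = - 1"
    | i where "i < 8" "p = Ov i" "q = Nv ((i + 7) mod 8)" "S16_listed p q = 1"
  using assms by (cases p; cases q; simp add: ON_verts_def image_iff split: if_splits; blast?)

text \<open>The 4-cube by distance from \<open>v\<close>: four a's, six r's, four c's and the
  antipode \<open>z\<close>. Of its 32 edges, 15 form the spanning tree and 17 are computed by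
  \<open>corner\<close>.\<close>

lemma S16_normal:
  assumes dist: "distinct [v, a1, a2, a3, a4, r12, r13, r14, r23, r24, r34, c4, c3, c2, c1, z]"
    and tree:
      "w a1 v = 1" "w a2 v = 1" "w a3 v = - 1" "w a4 v = 1" "w r12 a1 = 1" "w r13 a1 = 1"
      "w r14 a1 = - 1" "w r23 a2 = 1" "w r24 a2 = 1" "w r34 a3 = 1" "w c4 r12 = 1" "w c3 r12 = 1"
      "w c2 r13 = 1" "w c1 r23 = - 1" "w z c4 = 1"
    and adj:
      "a2 \<in> N r12" "a3 \<in> N r13" "a4 \<in> N r14" "a3 \<in> N r23" "a4 \<in> N r24"
      "a4 \<in> N r34" "r13 \<in> N c4" "r23 \<in> N c4" "r14 \<in> N c3" "r24 \<in> N c3"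
      "r14 \<in> N c2" "r34 \<in> N c2" "r24 \<in> N c1" "r34 \<in> N c1" "c3 \<in> N z"
      "c2 \<in> N z" "c1 \<in> N z"
  shows "represents V w (ON_verts 8) S16_weight"
proof -
  note t = tree tree[THEN w_real_sym, simplified]
  note d = dist[simplified]
  note a = t[THEN w_N, simplified] adj adj[THEN N_symD]
  note e = t
  have "w r12 a2 = - 1" "w a2 r12 = - 1"
    by (rule corner_real[of a1 a2 v r12 "- 1"]; simp add: a d e)+
  note e = e this
  have "w r13 a3 = 1" "w a3 r13 = 1"
    by (rule corner_real[of a1 a3 v r13 "1"]; simp add: a d e)+
  note e = e this
  have "w r14 a4 = 1" "w a4 r14 = 1"
    by (rule corner_real[of a1 a4 v r14 "1"]; simp add: a d e)+
  note e = e this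
  have "w r23 a3 = 1" "w a3 r23 = 1"
    by (rule corner_real[of a2 a3 v r23 "1"]; simp add: a d e)+
  note e = e this
  have "w r24 a4 = - 1" "w a4 r24 = - 1"
    by (rule corner_real[of a2 a4 v r24 "- 1"]; simp add: a d e)+
  note e = e this
  have "w r34 a4 = 1" "w a4 r34 = 1"
    by (rule corner_real[of a3 a4 v r34 "1"]; simp add: a d e)+
  note e = e this
  have "w c4 r13 = - 1" "w r13 c4 = - 1"
    by (rule corner_real[of r12 r13 a1 c4 "- 1"]; simp add: a d e)+
  note e = e this
  have "w c4 r23 = 1" "w r23 c4 = 1"
    by (rule corner_real[of r12 r23 a2 c4 "1"]; simp add: a d e)+
  note e = e this
  have "w c3 r14 = 1" "w r14 c3 = 1"
    by (rule corner_real[of r12 r14 a1 c3 "1"]; simp add: a d e)+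
  note e = e this
  have "w c3 r24 = 1" "w r24 c3 = 1"
    by (rule corner_real[of r12 r24 a2 c3 "1"]; simp add: a d e)+
  note e = e this
  have "w c2 r14 = 1" "w r14 c2 = 1"
    by (rule corner_real[of r13 r14 a1 c2 "1"]; simp add: a d e)+
  note e = e this
  have "w c2 r34 = - 1" "w r34 c2 = - 1"
    by (rule corner_real[of r13 r34 a3 c2 "- 1"]; simp add: a d e)+
  note e = e this
  have "w c1 r24 = 1" "w r24 c1 = 1"
    by (rule corner_real[of r23 r24 a2 c1 "1"]; simp add: a d e)+
  note e = e this
  have "w c1 r34 = 1" "w r34 c1 = 1"
    by (rule corner_real[of r23 r34 a3 c1 "1"]; simp add: a d e)+
  note e = e this
  have "w z c3 = - 1" "w c3 z = - 1"
    by (rule corner_real[of c4 c3 r12 z "- 1"]; simp add: a d e)+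
  note e = e this
  have "w z c2 = 1" "w c2 z = 1"
    by (rule corner_real[of c4 c2 r13 z "1"]; simp add: a d e)+
  note e = e this
  have "w z c1 = 1" "w c1 z = 1"
    by (rule corner_real[of c4 c1 r23 z "1"]; simp add: a d e)+
  note e = e this
  \<comment> \<open>The first list is an 8-circuit of the cube; the second orders the other vertices
    so that steps of 3 are edges.\<close>
  define \<gamma> where "\<gamma> = list_label [v, a1, r13, c2, z, c1, r24, a2] [r12, a3, r14, c4, r34, c3, r23, a4]"
  show ?thesis unfolding S16_weight_def
  proof (rule realize[where g = \<gamma> and \<mu> = "\<lambda>_. 1"])
    show "finite (ON_verts 8)" "ON_verts 8 \<noteq> {}" by (auto simp: ON_verts_def)
    show "inj_on \<gamma> (ON_verts 8)" unfolding \<gamma>_def by (rule inj_on_list_label) (use dist in auto)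
    have "set [v, a1, r13, c2, z, c1, r24, a2] \<union> set [r12, a3, r14, c4, r34, c3, r23, a4] \<subseteq> V" using a N_verts by simp
    thus "\<gamma> ` ON_verts 8 \<subseteq> V" unfolding \<gamma>_def by (intro list_label_image) simp_all
    have "\<forall>i<8. w (\<gamma> (Ov i)) (\<gamma> (Ov ((i + 1) mod 8))) = 1 \<and>
      w (\<gamma> (Nv i)) (\<gamma> (Nv ((i + 3) mod 8))) = 1 \<and>
      w (\<gamma> (Ov i)) (\<gamma> (Nv ((i + 1) mod 8))) = - 1 \<and>
      w (\<gamma> (Ov i)) (\<gamma> (Nv ((i + 7) mod 8))) = 1"
      unfolding all_less_8 by (simp add: \<gamma>_def list_label_def e)
    note vals = this[rule_format]
    show "w (\<gamma> p) (\<gamma> q) = 1 * S16_listed p q * cnj 1"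
      if "p \<in> ON_verts 8" "q \<in> ON_verts 8" "S16_listed p q \<noteq> 0" for p q
      using that by (cases rule: S16_listed_cases) (use vals in simp_all)
    show "\<exists>S\<subseteq>ON_verts 8. card S = 4 \<and> (\<forall>q\<in>S. S16_listed p q \<noteq> 0 \<or> S16_listed q p \<noteq> 0)"
      if "p \<in> ON_verts 8" for p using S16_regular[OF that] .
  qed auto
qed

lemma S16:
  assumes dist: "distinct [v, a1, a2, a3, a4, r12, r13, r14, r23, r24, r34, c4, c3, c2, c1, z]"
    and adj:
      "v \<in> N a1" "v \<in> N a2" "v \<in> N a3" "v \<in> N a4" "a1 \<in> N r12" "a1 \<in> N r13"
      "a1 \<in> N r14" "a2 \<in> N r23" "a2 \<in> N r24" "a3 \<in> N r34" "r12 \<in> N c4"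
      "r12 \<in> N c3" "r13 \<in> N c2" "r23 \<in> N c1" "c4 \<in> N z" "a2 \<in> N r12"
      "a3 \<in> N r13" "a4 \<in> N r14" "a3 \<in> N r23" "a4 \<in> N r24" "a4 \<in> N r34"
      "r13 \<in> N c4" "r23 \<in> N c4" "r14 \<in> N c3" "r24 \<in> N c3" "r14 \<in> N c2"
      "r34 \<in> N c2" "r24 \<in> N c1" "r34 \<in> N c1" "c3 \<in> N z" "c2 \<in> N z"
      "c1 \<in> N z"
  shows "represents V w (ON_verts 8) S16_weight"
proof -
  define es :: "('a \<times> 'a \<times> complex) list" where "es =
    [(z, c4, 1), (c1, r23, - 1), (c2, r13, 1), (c3, r12, 1), (c4, r12, 1), (r34, a3, 1),
    (r24, a2, 1), (r23, a2, 1), (r14, a1, - 1), (r13, a1, 1), (r12, a1, 1), (a4, v, 1),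
    (a3, v, - 1), (a2, v, 1), (a1, v, 1)]"
  have "tree_order w es" using dist adj[THEN w_unit(1)] by (auto simp: es_def)
  then obtain \<nu> where \<nu>: "\<forall>v. \<nu> v \<in> gauss_units" "\<forall>(x, p, t) \<in> set es. \<nu> x * w x p * cnj (\<nu> p) = t"
    using tree_switch by blast
  define w' where "w' = (\<lambda>u v. \<nu> u * w u v * cnj (\<nu> v))"
  interpret W: twin_free V w' unfolding w'_def by (rule switch_twin_free) (use \<nu> in auto)
  have WN: "W.N = N" unfolding w'_def by (rule switch_twin_free) (use \<nu> in auto)
  have tree:
    "w' a1 v = 1" "w' a2 v = 1" "w' a3 v = - 1" "w' a4 v = 1" "w' r12 a1 = 1" "w' r13 a1 = 1"
    "w' r14 a1 = - 1" "w' r23 a2 = 1" "w' r24 a2 = 1" "w' r34 a3 = 1" "w' c4 r12 = 1"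
    "w' c3 r12 = 1" "w' c2 r13 = 1" "w' c1 r23 = - 1" "w' z c4 = 1"
    using \<nu>(2) by (simp_all add: es_def w'_def)
  have "represents V w' (ON_verts 8) S16_weight"
    by (rule W.S16_normal[OF dist tree]) (use adj in \<open>auto simp: WN\<close>)
  thus ?thesis unfolding w'_def by (rule represents_switch) (use \<nu> in auto)
qed
end

context twin_free
begin

lemma three_common:
  assumes "x \<in> N u" "y \<in> N u" "z \<in> N u" "x \<in> N v" "y \<in> N v" "z \<in> N v" "distinct [x, y, z]"
  shows "u = v"
proof (rule ccontr)
  assume "u \<noteq> v"
  hence "card (N u \<inter> N v) = 2" using card_common_2 assms by blast
  moreover have "card {x, y, z} \<le> card (N u \<inter> N v)" using assms by (intro card_mono) auto
  ultimately show False using assms(7) by simp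
qed

text \<open>Any two neighbours of \<open>v\<close> have one further common neighbour r_ij; these six
  vertices are distinct and pairwise nonadjacent. Two of them that share an index also share one
  vertex further out, and these outer vertices can be attached in two ways, leading to S_14 and
  S_16.\<close>

lemma S14_or_S16_of_triangle_free:
  assumes tf: "\<And>u x y. x \<in> N u \<Longrightarrow> y \<in> N u \<Longrightarrow> y \<notin> N x"
  shows "represents V w (ON_verts 7) S14_weight \<or> represents V w (ON_verts 8) S16_weight"
proof -
  obtain v where "v \<in> V" using nonempty by blast
  obtain a1 a2 a3 a4 where Nv: "N v = {a1, a2, a3, a4}" and da: "distinct [a1, a2, a3, a4]"
    using N_cases[OF \<open>v \<in> V\<close>] .
  have av: "a1 \<in> N v" "a2 \<in> N v" "a3 \<in> N v" "a4 \<in> N v" using Nv by auto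
  note va = av[THEN N_symD]
  have na: "v \<noteq> a1" "v \<noteq> a2" "v \<noteq> a3" "v \<noteq> a4" using av by auto
  have ex: "\<exists>r. r \<noteq> v \<and> r \<in> N a \<and> r \<in> N b" if "a \<in> N v" "b \<in> N v" "a \<noteq> b" for a b
    using other[of a b v] that N_symD by metis
  obtain r12 where r12: "r12 \<noteq> v" "r12 \<in> N a1" "r12 \<in> N a2" using ex[of a1 a2] av da by auto
  obtain r13 where r13: "r13 \<noteq> v" "r13 \<in> N a1" "r13 \<in> N a3" using ex[of a1 a3] av da by auto
  obtain r14 where r14: "r14 \<noteq> v" "r14 \<in> N a1" "r14 \<in> N a4" using ex[of a1 a4] av da by auto
  obtain r23 where r23: "r23 \<noteq> v" "r23 \<in> N a2" "r23 \<in> N a3" using ex[of a2 a3] av da by auto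
  obtain r24 where r24: "r24 \<noteq> v" "r24 \<in> N a2" "r24 \<in> N a4" using ex[of a2 a4] av da by auto
  obtain r34 where r34: "r34 \<noteq> v" "r34 \<in> N a3" "r34 \<in> N a4" using ex[of a3 a4] av da by auto
  note ra = r12(2,3) r13(2,3) r14(2,3) r23(2,3) r24(2,3) r34(2,3)
  note ar = ra[THEN N_symD]
  have no3: False if "r \<noteq> v" "r \<in> N a" "r \<in> N b" "r \<in> N c" "a \<in> N v" "b \<in> N v" "c \<in> N v" "distinct [a, b, c]"
    for r a b c
    using three_common[of a r b c v] that N_symD by metis
  have "r12 \<notin> N a3" "r12 \<notin> N a4" "r13 \<notin> N a2" "r13 \<notin> N a4" "r14 \<notin> N a2" "r14 \<notin> N a3"
    "r23 \<notin> N a1" "r23 \<notin> N a4" "r24 \<notin> N a1" "r24 \<notin> N a3" "r34 \<notin> N a1" "r34 \<notin> N a2"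
    using no3[OF r12(1,2,3), of a3] no3[OF r12(1,2,3), of a4] no3[OF r13(1,2,3), of a2]
      no3[OF r13(1,2,3), of a4] no3[OF r14(1,2,3), of a2] no3[OF r14(1,2,3), of a3]
      no3[OF r23(1,2,3), of a1] no3[OF r23(1,2,3), of a4] no3[OF r24(1,2,3), of a1]
      no3[OF r24(1,2,3), of a3] no3[OF r34(1,2,3), of a1] no3[OF r34(1,2,3), of a2] av da by auto
  hence dr: "distinct [r12, r13, r14, r23, r24, r34]"
    using ra by auto
  have Na: "N a1 = {v, r12, r13, r14}" "N a2 = {v, r12, r23, r24}" "N a3 = {v, r13, r23, r34}" "N a4 = {v, r14, r24, r34}"
    using va ra dr r12(1)[symmetric] r13(1)[symmetric] r14(1)[symmetric] r23(1)[symmetric]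
      r24(1)[symmetric] r34(1)[symmetric] by - (rule N_eqI; simp)+
  define R where "R = {r12, r13, r14, r23, r24, r34}"
  have aR: "a \<notin> R" if "a \<in> N v" for a
  proof
    assume "a \<in> R"
    then obtain b where "b \<in> N v" "a \<in> N b" using ra av unfolding R_def by blast
    thus False using tf[of b v a] that by blast
  qed
  have vR: "v \<notin> R" using r12(1) r13(1) r14(1) r23(1) r24(1) r34(1) by (auto simp: R_def)
  \<comment> \<open>For r_ij and r_kl with disjoint indices: an edge would give \<open>s\<close> and
    \<open>a\<close> a second common neighbour besides \<open>r\<close>, namely \<open>p\<close> or
    \<open>q\<close>. But these already share a neighbour with \<open>s\<close>, so a triangle would
    arise.\<close>
  have far: "s \<notin> N r" if "s \<in> R" "a \<in> N v" "N a = {v, r, p, q}" "p \<in> N c" "s \<in> N c" "q \<in> N d" "s \<in> N d"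
    for r s a p q c d
  proof
    assume "s \<in> N r"
    hence "r \<in> N s" "r \<in> N a" using N_symD that by blast+
    moreover have "s \<noteq> a" using aR that by blast
    ultimately obtain t where t: "t \<noteq> r" "t \<in> N s" "t \<in> N a" using other by metis
    have "v \<notin> N s" using aR[of s] that(1) N_symD by blast
    moreover have "t \<in> {v, r, p, q}" using t(3) that(3) by simp
    ultimately have "t = p \<or> t = q" using t by auto
    thus False using tf t(2) that(4-7) by blast
  qed
  have near: "s \<notin> N r" if "r \<in> N a" "s \<in> N a" for r s a
    using tf that by blast
  have RR: "s \<notin> N r" if "r \<in> R" "s \<in> R" for r s
  proof -
    have "r34 \<notin> N r12" "r24 \<notin> N r13" "r23 \<notin> N r14"
      using far[of r34 a1 r12 r13 r14 a3 a4] far[of r24 a1 r13 r12 r14 a2 a4]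
        far[of r23 a1 r14 r12 r13 a2 a3] Na av ra by (auto simp: R_def insert_commute)
    hence 1: "r12 \<notin> N r34" "r34 \<notin> N r12" "r13 \<notin> N r24" "r24 \<notin> N r13" "r14 \<notin> N r23" "r23 \<notin> N r14"
      using N_symD by blast+
    show ?thesis using that 1 near[of r a1 s] near[of r a2 s] near[of r a3 s] near[of r a4 s] ra
      by (auto simp: R_def)
  qed
  have third: "x \<noteq> v \<and> x \<notin> R" if "x \<in> N r" "r \<in> R" for x r
  proof -
    have "x \<noteq> v" using aR that Nv N_symD by blast
    thus ?thesis using RR that by blast
  qed
  have third_a: "x \<notin> {a1, a2, a3, a4}" if "x \<in> N r" "x \<in> N s" "r \<in> N a" "s \<in> N a" "x \<noteq> a" "r \<in> R" "s \<in> R" "r \<noteq> s" "a \<in> N v"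
    for x r s a
  proof
    assume "x \<in> {a1, a2, a3, a4}"
    hence "x \<in> N v" using Nv by auto
    have "r \<in> N x" "s \<in> N x" "v \<in> N x" "v \<in> N a" using that \<open>x \<in> N v\<close> N_symD by blast+
    moreover have "distinct [r, s, v]" using that vR by auto
    ultimately show False using three_common[of r x s v a] that by blast
  qed
  \<comment> \<open>r_ij and r_ik share a_i and hence a second vertex, which is at a new distance
    from \<open>v\<close>.\<close>
  have step: "\<exists>x. x \<in> N r \<and> x \<in> N s \<and> x \<noteq> v \<and> x \<notin> R \<and> x \<notin> {a1, a2, a3, a4}"
    if "r \<in> N a" "s \<in> N a" "r \<noteq> s" "r \<in> R" "s \<in> R" "a \<in> N v" for r s a
  proof -
    have "a \<in> N r" "a \<in> N s" using that N_symD by blast+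
    then obtain x where x: "x \<noteq> a" "x \<in> N r" "x \<in> N s" using other[OF \<open>r \<noteq> s\<close>] by blast
    thus ?thesis using third[of x r] third_a[of x r s a] that by blast
  qed
  \<comment> \<open>The three r's around one a_i have only a_i in common, by
    \<open>three_common\<close>.\<close>
  have no: False if "x \<in> N r" "x \<in> N s" "x \<in> N t" "N a = {v, r, s, t}" "x \<notin> {a1, a2, a3, a4}" "a \<in> N v" "distinct [r, s, t]" for x r s t a
  proof -
    have "x = a" using three_common[of r x s t a] that N_symD by blast
    thus False using that Nv by blast
  qed
  have Nr: "y \<in> {a, b, p, q}"
    if "y \<in> N r" "r \<in> N a" "r \<in> N b" "a \<noteq> b" "p \<in> N r" "q \<in> N r" "p \<noteq> q"
      "a \<in> N v" "b \<in> N v" "p \<notin> {a1, a2, a3, a4}" "q \<notin> {a1, a2, a3, a4}" for y r a b p q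
  proof -
    have "N r = {a, b, p, q}" by (rule N_eqI) (use that Nv N_symD in auto)
    thus ?thesis using that by blast
  qed
  define A where "A = {a1, a2, a3, a4}"
  have inR: "r12 \<in> R" "r13 \<in> R" "r14 \<in> R" "r23 \<in> R" "r24 \<in> R" "r34 \<in> R" by (auto simp: R_def)
  have no1: False if "x \<in> N r12" "x \<in> N r13" "x \<in> N r14" "x \<notin> A" for x
    using no[OF that(1-3) Na(1)] that(4) av dr unfolding A_def by simp
  have no2: False if "x \<in> N r12" "x \<in> N r23" "x \<in> N r24" "x \<notin> A" for x
    using no[OF that(1-3) Na(2)] that(4) av dr unfolding A_def by simp
  have no3: False if "x \<in> N r13" "x \<in> N r23" "x \<in> N r34" "x \<notin> A" for x
    using no[OF that(1-3) Na(3)] that(4) av dr unfolding A_def by simp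
  have no4: False if "x \<in> N r14" "x \<in> N r24" "x \<in> N r34" "x \<notin> A" for x
    using no[OF that(1-3) Na(4)] that(4) av dr unfolding A_def by simp
  have drn: "r12 \<noteq> r13" "r12 \<noteq> r14" "r13 \<noteq> r14" "r12 \<noteq> r23" "r12 \<noteq> r24" "r23 \<noteq> r24"
    "r13 \<noteq> r23" "r13 \<noteq> r34" "r23 \<noteq> r34" "r14 \<noteq> r24" "r14 \<noteq> r34" "r24 \<noteq> r34" using dr by auto
  note step' = step[folded A_def]
  note Nr' = Nr[folded A_def]
  obtain x where x: "x \<in> N r12" "x \<in> N r13" "x \<noteq> v" "x \<notin> R" "x \<notin> A"
    using step'[OF ra(1) ra(3) drn(1) inR(1) inR(2) av(1)] by blast
  obtain y where y: "y \<in> N r12" "y \<in> N r14" "y \<noteq> v" "y \<notin> R" "y \<notin> A"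
    using step'[OF ra(1) ra(5) drn(2) inR(1) inR(3) av(1)] by blast
  obtain u where u: "u \<in> N r13" "u \<in> N r14" "u \<noteq> v" "u \<notin> R" "u \<notin> A"
    using step'[OF ra(3) ra(5) drn(3) inR(2) inR(3) av(1)] by blast
  have xy: "x \<noteq> y" "x \<noteq> u" "y \<noteq> u" using no1 x y u by auto
  have N12: "t = x \<or> t = y" if "t \<in> N r12" "t \<notin> A" for t
    using Nr'[of t r12 a1 a2 x y] that x y xy ra da av unfolding A_def by auto
  have N13: "t = x \<or> t = u" if "t \<in> N r13" "t \<notin> A" for t
    using Nr'[of t r13 a1 a3 x u] that x u xy ra da av unfolding A_def by auto
  have N14: "t = y \<or> t = u" if "t \<in> N r14" "t \<notin> A" for t
    using Nr'[of t r14 a1 a4 y u] that y u xy ra da av unfolding A_def by auto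
  have dA: "distinct [v, a1, a2, a3, a4]" using da na by auto
  obtain t1 where t1: "t1 \<in> N r12" "t1 \<in> N r23" "t1 \<notin> A"
    using step'[OF ra(2) ra(7) drn(4) inR(1) inR(4) av(2)] by blast
  obtain t2 where t2: "t2 \<in> N r12" "t2 \<in> N r24" "t2 \<notin> A"
    using step'[OF ra(2) ra(9) drn(5) inR(1) inR(5) av(2)] by blast
  obtain t3 where t3: "t3 \<in> N r13" "t3 \<in> N r34" "t3 \<notin> A"
    using step'[OF ra(4) ra(11) drn(8) inR(2) inR(6) av(3)] by blast
  obtain t4 where t4: "t4 \<in> N r14" "t4 \<in> N r34" "t4 \<notin> A"
    using step'[OF ra(6) ra(12) drn(11) inR(3) inR(6) av(4)] by blast
  obtain t5 where t5: "t5 \<in> N r13" "t5 \<in> N r23" "t5 \<notin> A"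
    using step'[OF ra(4) ra(8) drn(7) inR(2) inR(4) av(3)] by blast
  obtain t6 where t6: "t6 \<in> N r14" "t6 \<in> N r24" "t6 \<notin> A"
    using step'[OF ra(6) ra(10) drn(10) inR(3) inR(5) av(4)] by blast
  have d11: "distinct [v, a1, a2, a3, a4, r12, r13, r14, r23, r24, r34]"
    using dA dr vR aR av unfolding R_def by auto
  \<comment> \<open>\<open>r12\<close> has the outer neighbours \<open>x\<close> and
    \<open>y\<close>; it shares one with \<open>r23\<close> and one with \<open>r24\<close>, and
    these differ by \<open>no2\<close>.\<close>
  consider (cyc) "y \<in> N r23" "x \<in> N r24" | (tri) "x \<in> N r23" "y \<in> N r24"
    using N12[OF t1(1,3)] N12[OF t2(1,3)] t1 t2 no2[of x] no2[of y] x y by blast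
  thus ?thesis
  proof cases
    case cyc
    \<comment> \<open>Each of \<open>x\<close>, \<open>y\<close>, \<open>u\<close> turns out to be
      adjacent to four r's, so the graph closes up with 14 vertices.\<close>
    have "x \<notin> N r23" "y \<notin> N r24" using no2 x y cyc by blast+
    hence u1: "u \<in> N r23" "u \<in> N r24"
      using N13[OF t5(1,3)] N14[OF t6(1,3)] t5 t6 by blast+
    hence "u \<notin> N r34" using no3 u by blast
    hence x1: "x \<in> N r34" "y \<in> N r34"
      using N13[OF t3(1,3)] N14[OF t4(1,3)] t3 t4 by blast+
    have "distinct [v, a1, a2, a3, a4, r12, r13, r14, r23, r24, r34, x, y, u]"
      using d11 x(3-5) y(3-5) u(3-5) xy unfolding R_def A_def by auto
    hence "represents V w (ON_verts 7) S14_weight"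
      by (rule S14) (use va ar x y u cyc u1 x1 N_symD in auto)
    thus ?thesis ..
  next
    case tri
    \<comment> \<open>Each outer vertex is adjacent to the three r's avoiding one index:
      \<open>x\<close>, \<open>y\<close>, \<open>u\<close>, \<open>t\<close> avoid 4, 3, 2, 1
      respectively, as in the 4-cube.\<close>
    have "x \<notin> N r24" "y \<notin> N r23" "x \<notin> N r34" using no2 no3 x y tri by blast+
    hence u1: "u \<in> N r34" using N13[OF t3(1,3)] t3 by blast
    hence "u \<notin> N r23" using no3 u by blast
    obtain t where t: "t \<in> N r23" "t \<in> N r24" "t \<noteq> v" "t \<notin> R" "t \<notin> A"
      using step'[OF ra(7) ra(9) drn(6) inR(4) inR(5) av(2)] by blast
    have tne: "x \<noteq> t" "y \<noteq> t" "u \<noteq> t"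
      using t \<open>x \<notin> N r24\<close> \<open>y \<notin> N r23\<close> \<open>u \<notin> N r23\<close> by blast+
    obtain t7 where t7: "t7 \<in> N r23" "t7 \<in> N r34" "t7 \<notin> A"
      using step'[OF ra(8) ra(11) drn(9) inR(4) inR(6) av(3)] by blast
    have "t7 = x \<or> t7 = t"
      using Nr'[of t7 r23 a2 a3 x t] t7 x t tri tne ra da av unfolding A_def by auto
    hence t1: "t \<in> N r34" using t7 \<open>x \<notin> N r34\<close> by blast
    have xr: "r12 \<in> N x" "r13 \<in> N x" "r23 \<in> N x" using x tri N_symD by blast+
    have "x \<in> V" using xr N_verts by blast
    have "card {r12, r13, r23} < card (N x)" using deg[OF \<open>x \<in> V\<close>] by (simp add: card_insert_if)
    hence "\<not> N x \<subseteq> {r12, r13, r23}" using card_mono[of "{r12, r13, r23}" "N x"] by auto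
    then obtain z where z: "z \<in> N x" "z \<notin> {r12, r13, r23}" by blast
    have Nx: "N x = {r12, r13, r23, z}" by (rule N_eqI) (use xr z drn in auto)
    have "y \<notin> N r13" "u \<notin> N r12" "t \<notin> N r12" "t \<notin> N r13"
      using no1 no2 no3 y u t t1 by blast+
    hence ns: "r13 \<notin> N y" "r23 \<notin> N y" "r12 \<notin> N u" "r23 \<notin> N u" "r12 \<notin> N t" "r13 \<notin> N t"
      using \<open>y \<notin> N r23\<close> \<open>u \<notin> N r23\<close> N_symD by blast+
    \<comment> \<open>\<open>x\<close> shares one r with each other outer vertex \<open>c\<close>,
      hence a second neighbour; the other two r's at \<open>x\<close> are not adjacent to
      \<open>c\<close>, so it is \<open>z\<close>.\<close>
    have zN: "z \<in> N c" if "r \<in> N x" "r \<in> N c" "x \<noteq> c" "\<forall>s\<in>{r12, r13, r23}. s = r \<or> s \<notin> N c" for r c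
    proof -
      obtain s where "s \<noteq> r" "s \<in> N x" "s \<in> N c"
        using other[OF \<open>x \<noteq> c\<close> \<open>r \<in> N x\<close> \<open>r \<in> N c\<close>] by blast
      thus ?thesis using that(4) Nx by auto
    qed
    have zy: "z \<in> N y" using zN[of r12 y] xr y(1)[THEN N_symD] xy ns by auto
    have zu: "z \<in> N u" using zN[of r13 u] xr u(1)[THEN N_symD] xy ns by auto
    have zt: "z \<in> N t" using zN[of r23 t] xr t(1)[THEN N_symD] tne ns by auto
    have zv: "z \<noteq> v" using z(1) x(5) Nv N_symD unfolding A_def by blast
    have zA: "z \<notin> A"
    proof
      assume "z \<in> A"
      hence "x \<in> insert v R" using z(1)[THEN N_symD] Na unfolding A_def R_def by auto
      thus False using x by blast
    qed
    have "r14 \<notin> N x" "r24 \<notin> N x" "r34 \<notin> N x"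
      using no1[OF x(1,2) _ x(5)] \<open>x \<notin> N r24\<close> \<open>x \<notin> N r34\<close> N_symD by blast+
    hence zR: "z \<notin> R" using z unfolding R_def by auto
    have zc: "z \<noteq> x" "z \<noteq> y" "z \<noteq> u" "z \<noteq> t" using z zy zu zt by auto
    have d15: "distinct [v, a1, a2, a3, a4, r12, r13, r14, r23, r24, r34, x, y, u, t]"
      using d11 x(3-5) y(3-5) u(3-5) t(3-5) xy tne unfolding R_def A_def by auto
    hence "distinct [v, a1, a2, a3, a4, r12, r13, r14, r23, r24, r34, x, y, u, t, z]"
      using zv zA zR zc unfolding R_def A_def by auto
    hence "represents V w (ON_verts 8) S16_weight"
      by (rule S16) (use va ar x y u t tri u1 t1 z zy zu zt N_symD in auto)
    thus ?thesis ..
  qed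
qed

end

section \<open>The classification, and its translation to matrices\<close>

lemma (in twin_free) represents_S8_S14_S16:
  "represents V w UNIV S8_weight \<or> represents V w (ON_verts 7) S14_weight \<or> represents V w (ON_verts 8) S16_weight"
proof (cases "\<exists>u x y. x \<in> N u \<and> y \<in> N u \<and> y \<in> N x")
  case True
  thus ?thesis using S8_of_triangle by blast
next
  case False
  hence "\<And>u x y. x \<in> N u \<Longrightarrow> y \<in> N u \<Longrightarrow> y \<notin> N x" by blast
  thus ?thesis using S14_or_S16_of_triangle_free by blast
qed

lemma (in weighing_graph) classification:
  "(\<exists>k\<ge>3. represents V w (T_verts k) (T_weight k)) \<or> (\<exists>k\<ge>3. represents V w (Ti_verts k) (Ti_weight k)) \<or>
   represents V w UNIV S8_weight \<or> represents V w (ON_verts 7) S14_weight \<or> represents V w (ON_verts 8) S16_weight"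
proof (cases "\<exists>v r. v \<in> V \<and> v \<noteq> r \<and> N v = N r")
  case True
  thus ?thesis using represents_T_of_twins by meson
next
  case False
  interpret twin_free V w by unfold_locales (use False in metis)
  show ?thesis using represents_S8_S14_S16 by blast
qed

lemma (in maximal_graph) weighing: "weighing_graph V w"
proof unfold_locales
  show "card (N v) = 4" if "v \<in> V" for v by (rule all_full[OF that])
  show "ip u v = 0" if "u \<noteq> v" for u v
  proof (cases "v \<in> V")
    case True
    thus ?thesis using full_orth all_full that by blast
  next
    case False
    hence "N v = {}" using N_verts(1) by blast
    thus ?thesis by (simp add: ip_common)
  qed
qed

text \<open>Degrees and orthogonality come from 4 - A^2 being positive semidefinite; the remaining
  conditions say that certain borderings of A would contradict maximality.\<close>

lemma maximal_graph_of_mat: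
  assumes max: "maximal_indecomposable_cyclotomic A"
    and diag: "\<forall>v < dim_row A. A $$ (v, v) = 0"
    and units: "\<forall>x \<in> elements_mat A. x \<noteq> 0 \<longrightarrow> x \<in> gauss_units"
  shows "maximal_graph {0..<dim_row A} (\<lambda>i j. if i < dim_row A \<and> j < dim_row A then A $$ (i, j) else 0)"
proof -
  define n where "n = dim_row A"
  define V where "V = {0..<n}"
  define w where "w i j = (if i < n \<and> j < n then A $$ (i, j) else 0)" for i j
  have cyc: "cyclotomic_mat A" and ind: "indecomposable_mat A"
    using max by (auto simp: maximal_indecomposable_cyclotomic_def)
  note D = cyclotomic_mat_D[OF cyc, folded n_def]
  have h: "w v u = cnj (w u v)" for u v
    using D(4)[of u v] by (cases "u < n"; cases "v < n") (simp_all add: w_def)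
  have sym: "A $$ (j, i) \<noteq> 0" if "i < dim_row A" "j < dim_row A" "A $$ (i, j) \<noteq> 0" for i j
    using that D(4)[of i j] by (simp add: n_def)
  have cl: "closed_connected n (\<lambda>i j. A $$ (i, j))"
    unfolding n_def by (rule indecomposable_mat_iff[THEN iffD1, OF _ ind]) (rule sym)
  interpret gauss_graph V w
  proof
    show "finite V" "V \<noteq> {}" using cl by (auto simp: V_def closed_connected_def)
    show "u \<in> V" if "w u v \<noteq> 0" for u v using that by (auto simp: w_def V_def split: if_splits)
    show "w v u = cnj (w u v)" for u v by (rule h)
    show "w v v = 0" for v using diag by (simp add: w_def n_def)
    show "w u v \<in> gauss_units" if "w u v \<noteq> 0" for u v
      using that units elements_matI[OF D(2), of u v "A $$ (u, v)"] by (auto simp: w_def split: if_splits)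
    show "S = V" if "S \<subseteq> V" "S \<noteq> {}" "\<And>u v. u \<in> S \<Longrightarrow> w u v \<noteq> 0 \<Longrightarrow> v \<in> S" for S
    proof -
      have "v \<in> S" if "u \<in> S" "v < n" "A $$ (u, v) \<noteq> 0" for u v
        using \<open>S \<subseteq> V\<close> that \<open>\<And>u v. u \<in> S \<Longrightarrow> w u v \<noteq> 0 \<Longrightarrow> v \<in> S\<close>[of u v] by (auto simp: w_def V_def)
      thus ?thesis using closed_connectedD[OF cl] \<open>S \<subseteq> V\<close> \<open>S \<noteq> {}\<close> unfolding V_def by blast
    qed
  qed
  have app_w: "app V w x i = app V (\<lambda>i j. A $$ (i, j)) x i" if "i \<in> V" for x i
    using that unfolding app_def by (intro sum.cong) (auto simp: w_def V_def)
  have dot_w: "dot V x (app V w y) = dot V x (app V (\<lambda>i j. A $$ (i, j)) y)" for x y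
    by (rule dot_cong) (simp_all add: app_w)
  have hV: "w j i = cnj (w i j)" if "i \<in> V" "j \<in> V" for i j by (rule h)
  have "two_bounded V (\<lambda>i j. A $$ (i, j))"
    unfolding V_def n_def by (rule cyclotomic_two_bounded[OF cyc])
  hence two: "two_bounded V w" unfolding two_bounded_def dot_w .
  have ext: False
    if c: "\<And>i. i \<in> V \<Longrightarrow> c i \<in> gauss_ints" "\<exists>i\<in>V. c i \<noteq> 0" and d: "d \<in> \<int>"
      and form: "\<And>x t \<epsilon>. \<epsilon> = 1 \<or> \<epsilon> = -1 \<Longrightarrow> 0 \<le> 2 * Re (dot V x x) + 2 * (cmod t)\<^sup>2
       + \<epsilon> * (Re (dot V x (app V w x)) + 2 * Re (t * dot V x c) + d * (cmod t)\<^sup>2)" for c d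
  proof -
    have "\<not> maximal_indecomposable_cyclotomic A"
    proof (rule not_maximal[OF cyc ind, of c d])
      show "c i \<in> gauss_ints" if "i < dim_row A" for i using c(1) that by (simp add: V_def n_def)
      show "\<exists>i<dim_row A. c i \<noteq> 0" using c(2) by (auto simp: V_def n_def)
      show "0 \<le> 2 * Re (dot {0..<dim_row A} x x) + 2 * (cmod t)\<^sup>2 + \<epsilon> *
          (Re (dot {0..<dim_row A} x (app {0..<dim_row A} (\<lambda>i j. A $$ (i, j)) x)) +
           2 * Re (t * dot {0..<dim_row A} x c) + d * (cmod t)\<^sup>2)" if "\<epsilon> = 1 \<or> \<epsilon> = -1" for x t \<epsilon>
        using form[OF that, of x t] unfolding dot_w unfolding V_def n_def .
    qed (rule d)
    thus False using max by blast
  qed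
  have square_ext: False
    if c: "\<And>i. i \<in> V \<Longrightarrow> c i \<in> gauss_ints" "\<exists>i\<in>V. c i \<noteq> 0" and d: "d \<in> \<int>"
      and z: "\<And>i. i \<in> V \<Longrightarrow> c i = 4 * z i - app V w (app V w z) i"
      and le: "\<bar>Re (dot V z (app V w c)) + d\<bar> \<le> 2 - 2 * Re (dot V z c)" for c z d
    by (rule ext[OF c d bordered_nonneg[OF hV two z le]])
  define e where "e v i = (if i = v then 1 else 0 :: complex)" for v i :: nat
  have app_e: "app V w (e v) i = w i v" if "v \<in> V" for v i
    using finite_verts that by (simp add: app_def e_def if_distrib[of "\<lambda>y. _ * y"] cong: if_cong)
  have dot_e: "dot V (e v) y = y v" if "v \<in> V" for v y
    using finite_verts that by (simp add: dot_def e_def if_distrib[of cnj] if_distrib[of "\<lambda>y. y * _"] cong: if_cong)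
  have app2_e: "app V w (app V w (e v)) i = ip i v" if "v \<in> V" for v i
    using that by (simp add: app_def[of V w "app V w (e v)"] app_e ip_def)
  have ip_self: "ip v v = of_nat (card (N v))" for v
    unfolding ip_common by simp
  have square_le: "Re (dot V (app V w x) (app V w x)) \<le> 4 * Re (dot V x x)" for x
    by (rule two_bounded_imp_square[OF hV two])
  \<comment> \<open>The matrix 4 - A^2.\<close>
  define b where "b i j = 4 * e j i - ip i j" for i j
  have ip_h: "ip v u = cnj (ip u v)" for u v
    unfolding ip_def cnj_sum by (intro sum.cong refl) (metis complex_cnj_mult h mult.commute)
  have bh: "b j i = cnj (b i j)" if "i \<in> V" "j \<in> V" for i j
    unfolding b_def by (simp add: e_def ip_h[of i j])
  have app_b: "app V b x i = 4 * x i + (- 1) * app V w (app V w x) i" if "i \<in> V" for x i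
  proof -
    have "app V w (app V w x) i = (\<Sum>k\<in>V. \<Sum>j\<in>V. w i k * w k j * x j)"
      by (simp add: app_def sum_distrib_left mult.assoc)
    also have "\<dots> = (\<Sum>j\<in>V. ip i j * x j)"
      unfolding ip_def sum_distrib_right by (rule sum.swap)
    finally have "app V w (app V w x) i = (\<Sum>j\<in>V. ip i j * x j)" .
    moreover have "(\<Sum>j\<in>V. 4 * e j i * x j) = 4 * x i"
      using finite_verts that by (simp add: e_def if_distrib[of "\<lambda>y. y * _"] if_distrib[of "\<lambda>y. _ * y"] cong: if_cong)
    ultimately show ?thesis by (simp add: app_def b_def left_diff_distrib sum_subtractf)
  qed
  have dot_b: "dot V x (app V b x) = 4 * dot V x x - dot V (app V w x) (app V w x)" for x
  proof -
    have "dot V x (app V b x) = dot V x (\<lambda>i. 4 * x i + (- 1) * app V w (app V w x) i)"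
      by (rule dot_cong) (simp_all add: app_b)
    also have "\<dots> = 4 * dot V x x - dot V x (app V w (app V w x))" unfolding dot_add_right by simp
    finally show ?thesis using dot_app[of V w x "app V w x", OF hV] by simp
  qed
  have b_psd: "0 \<le> Re (dot V x (app V b x))" for x
    using square_le[of x] by (simp add: dot_b)
  have dot_e_b: "dot V (e v) (app V b (e v)) = 4 - of_nat (card (N v))" if "v \<in> V" for v
    using that by (simp add: dot_e app_b app2_e ip_self) (simp add: e_def)
  have deg: "card (N v) \<le> 4" for v
  proof (cases "v \<in> V")
    case True
    thus ?thesis using b_psd[of "e v"] by (simp add: dot_e_b)
  next
    case False
    hence "N v = {}" using N_verts(1) by blast
    thus ?thesis by simp
  qed
  have orth: "ip u v = 0" if v: "card (N v) = 4" and uv: "u \<noteq> v" for u v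
  proof (cases "u \<in> V")
    case True
    have "N v \<noteq> {}" using v by auto
    hence "v \<in> V" using N_verts(1) by blast
    \<comment> \<open>A full vertex is a zero of the form of 4 - A^2, so its column
      vanishes.\<close>
    have "Re (dot V (e v) (app V b (e v))) = 0" unfolding dot_e_b[OF \<open>v \<in> V\<close>] v by simp
    hence "app V b (e v) u = 0" by (intro psd_kernel[of V b "e v" u] finite_verts bh b_psd True)
    thus ?thesis using uv app_b[OF True] app2_e[OF \<open>v \<in> V\<close>] by (simp add: e_def)
  next
    case False
    hence "N u = {}" using N_verts(1) by blast
    thus ?thesis by (simp add: ip_common)
  qed
  have ints: "w i j \<in> gauss_ints" for i j
    using D(3)[of i j] by (simp add: w_def gauss_ints_def)
  have ints_sum: "(\<Sum>j\<in>S. f j) \<in> gauss_ints" if "\<And>j. f j \<in> gauss_ints" for f :: "nat \<Rightarrow> complex" and S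
    using that by (induction S rule: infinite_finite_induct) (auto simp: gauss_ints_def)
  have ints_mult: "x * y \<in> gauss_ints" if "x \<in> gauss_ints" "y \<in> gauss_ints" for x y
    using that by (auto simp: gauss_ints_def)
  have deg3: "card (N v) \<noteq> 3" for v
  proof
    assume v3: "card (N v) = 3"
    hence "N v \<noteq> {}" by auto
    hence v: "v \<in> V" using N_verts(1) by blast
    \<comment> \<open>Bordering with z the unit vector at \<open>v\<close>: the product of z with c
      is 4 - 3 = 1, so the inequality leaves no slack, and the charge has to cancel the product of z
      with A c. That value is an integer.\<close>
    define c where "c i = 4 * e v i - app V w (app V w (e v)) i" for i
    have cZ: "c i \<in> gauss_ints" for i
    proof -
      have "ip i v \<in> gauss_ints" unfolding ip_def by (intro ints_sum ints_mult ints)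
      thus ?thesis unfolding c_def app2_e[OF v] by (auto simp: e_def gauss_ints_def)
    qed
    have cv: "c v = 1" by (simp add: c_def app2_e[OF v] ip_self v3) (simp add: e_def)
    have "app V w c v \<in> gauss_ints" unfolding app_def by (intro ints_sum ints_mult ints cZ)
    hence dZ: "- Re (app V w c v) \<in> \<int>" by (simp add: gauss_ints_def)
    show False
    proof (rule square_ext[of c "- Re (app V w c v)" "e v"])
      show "c i \<in> gauss_ints" for i by (rule cZ)
      show "\<exists>i\<in>V. c i \<noteq> 0" using v cv by (intro bexI[of _ v]) simp_all
      show "- Re (app V w c v) \<in> \<int>" by (rule dZ)
      show "c i = 4 * e v i - app V w (app V w (e v)) i" for i by (rule c_def)
      show "\<bar>Re (dot V (e v) (app V w c)) + - Re (app V w c v)\<bar> \<le> 2 - 2 * Re (dot V (e v) c)"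
        unfolding dot_e[OF v] cv by simp
    qed
  qed
  have full: "\<exists>v\<in>V. card (N v) = 4"
  proof (rule ccontr)
    assume no: "\<not> ?thesis"
    have thin: "card (N i) \<le> 2" if "i \<in> V" for i
    proof -
      have "card (N i) \<noteq> 4" using no that by blast
      thus ?thesis using deg[of i] deg3[of i] by linarith
    qed
    show False
    proof (rule thin_extension[OF thin])
      fix c assume "\<And>i. c i \<in> gauss_ints" "\<exists>i\<in>V. c i \<noteq> 0"
        "\<And>x t \<epsilon>. \<epsilon> = 1 \<or> \<epsilon> = -1 \<Longrightarrow> 0 \<le> 2 * Re (dot V x x) + 2 * (cmod t)\<^sup>2
          + \<epsilon> * (Re (dot V x (app V w x)) + 2 * Re (t * dot V x c) + 0 * (cmod t)\<^sup>2)"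
      from ext[of c 0, OF this(1,2) Ints_0 this(3)] show False .
    qed
  qed
  have "maximal_graph V w"
  proof
    show "card (N v) \<le> 4" "card (N v) \<noteq> 3" for v by (rule deg deg3)+
    show "ip u v = 0" if "card (N v) = 4" "u \<noteq> v" for u v by (rule orth[OF that])
    show "\<exists>v\<in>V. card (N v) = 4" by (rule full)
    fix c and l :: real
    assume cZ: "\<And>x. c x \<in> gauss_ints" and nz: "\<exists>x\<in>V. c x \<noteq> 0"
      and ev: "\<And>x. x \<in> V \<Longrightarrow> (\<Sum>y\<in>V. w x y * (\<Sum>z\<in>V. w y z * c z)) = complex_of_real l * c x"
      and o: "(\<Sum>x\<in>V. cnj (c x) * (\<Sum>y\<in>V. w x y * c y)) = 0"
      and l: "l < 4" and norm: "(\<Sum>x\<in>V. (cmod (c x))\<^sup>2) + l \<le> 4"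
    \<comment> \<open>On this eigenspace 4 - A^2 is multiplication by 4 - l, so z = s c is a
      preimage of c; orthogonality of c and A c permits charge 0.\<close>
    define s where "s = 1 / (4 - l)"
    define z where "z i = complex_of_real s * c i" for i
    have app_z: "app V w z = (\<lambda>i. complex_of_real s * app V w c i)" unfolding z_def by (rule app_scale)
    have ev': "app V w (app V w c) i = complex_of_real l * c i" if "i \<in> V" for i
      using ev[OF that] by (simp add: app_def)
    have "c i = 4 * z i - app V w (app V w z) i" if "i \<in> V" for i
    proof -
      have "4 * z i - app V w (app V w z) i = complex_of_real (s * (4 - l)) * c i"
        unfolding app_z app_scale by (simp add: ev'[OF that] z_def algebra_simps)
      thus ?thesis using l by (simp add: s_def)
    qed
    note c_eq = this
    have dot_z: "dot V z y = complex_of_real s * dot V c y" for y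
      by (simp add: dot_def z_def sum_distrib_left mult.assoc)
    have dot_0: "dot V c (app V w c) = 0" using o by (simp add: dot_def app_def)
    have dot_1: "s * Re (dot V c c) \<le> 1"
      using norm l by (simp add: dot_self s_def pos_divide_le_eq)
    show False
    proof (rule square_ext[of c 0 z])
      show "c i \<in> gauss_ints" for i by (rule cZ)
      show "\<exists>i\<in>V. c i \<noteq> 0" by (rule nz)
      show "c i = 4 * z i - app V w (app V w z) i" if "i \<in> V" for i by (rule c_eq[OF that])
      show "\<bar>Re (dot V z (app V w c)) + 0\<bar> \<le> 2 - 2 * Re (dot V z c)"
        using dot_1 by (simp add: dot_z dot_0)
    qed simp
  qed
  thus ?thesis unfolding V_def w_def n_def .
qed

text \<open>B lists the vertices of \<open>T\<close> in the order f, the inverse of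
  \<open>g\<close>, and Q is the diagonal matrix of the switching factors; the sign is 1 and
  \<sigma> the identity. Entries of B lie in Z[i], being entries of A times units.\<close>

lemma equivalent_of_represents:
  assumes A: "A \<in> carrier_mat n n" "elements_mat A \<subseteq> gauss_ints"
    and rep: "represents {0..<n} (\<lambda>i j. if i < n \<and> j < n then A $$ (i, j) else 0) T W"
  shows "\<exists>B. equivalent_mat A B \<and> is_adjacency_mat T W B"
proof -
  define w where "w i j = (if i < n \<and> j < n then A $$ (i, j) else 0)" for i j
  obtain g \<mu> where g: "bij_betw g T {0..<n}" and \<mu>: "\<And>p. p \<in> T \<Longrightarrow> \<mu> p \<in> gauss_units"
    and gw: "\<And>p q. p \<in> T \<Longrightarrow> q \<in> T \<Longrightarrow> w (g p) (g q) = \<mu> p * W p q * cnj (\<mu> q)"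
    using rep unfolding represents_def w_def by blast
  define f where "f = inv_into T g"
  have f: "bij_betw f {0..<n} T" unfolding f_def by (rule bij_betw_inv_into[OF g])
  have fT: "f i \<in> T" and gf: "g (f i) = i" if "i < n" for i
    using that bij_betw_apply[OF f] bij_betw_inv_into_right[OF g, of i] by (auto simp: f_def)
  have card: "card T = n" using bij_betw_same_card[OF g] by simp
  define B where "B = Matrix.mat n n (\<lambda>(r, c). W (f r) (f c))"
  define Q where "Q = Matrix.mat n n (\<lambda>(i, j). if i = j then \<mu> (f i) else 0)"
  have u: "\<mu> (f i) \<in> gauss_units" if "i < n" for i using \<mu> fT that by blast
  have Aij: "A $$ (i, j) = \<mu> (f i) * W (f i) (f j) * cnj (\<mu> (f j))" if "i < n" "j < n" for i j
    using gw[OF fT[OF that(1)] fT[OF that(2)]] that by (simp add: gf w_def)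
  have BZ: "elements_mat B \<subseteq> gauss_ints"
  proof
    fix x assume "x \<in> elements_mat B"
    then obtain i j where ij: "i < n" "j < n" "x = W (f i) (f j)"
      by (auto simp: B_def dest!: elements_matD)
    have "cnj (\<mu> (f i)) * A $$ (i, j) * \<mu> (f j) = x"
      unfolding Aij[OF ij(1,2)] ij(3) using u[OF ij(1)] u[OF ij(2)] by (simp add: mult.assoc)
    moreover have "A $$ (i, j) \<in> gauss_ints" by (rule subsetD[OF A(2) elements_matI[OF A(1) ij(1,2) refl]])
    moreover have "cnj (\<mu> (f i)) \<in> gauss_ints" "\<mu> (f j) \<in> gauss_ints"
      using u[OF ij(1)] u[OF ij(2)] by (auto intro!: gauss_units_subset_ints)
    ultimately show "x \<in> gauss_ints" by (auto simp: gauss_ints_def)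
  qed
  have Q: "Q \<in> carrier_mat n n" "mat_adjoint Q \<in> carrier_mat n n" "B \<in> carrier_mat n n"
    by (auto simp: Q_def B_def dim_mat_adjoint)
  have Qij: "Q $$ (i, j) = (if i = j then \<mu> (f i) else 0)" "mat_adjoint Q $$ (i, j) = (if i = j then cnj (\<mu> (f i)) else 0)"
    if "i < n" "j < n" for i j
    using that by (auto simp: Q_def mat_adjoint_index)
  have QM: "(Q * M) $$ (i, j) = \<mu> (f i) * M $$ (i, j)" if "M \<in> carrier_mat n n" "i < n" "j < n" for M i j
  proof -
    have "(Q * M) $$ (i, j) = (\<Sum>k = 0..<n. (if i = k then \<mu> (f i) else 0) * M $$ (k, j))"
      using that Q(1) by (auto simp: scalar_prod_def Qij intro!: sum.cong)
    thus ?thesis using that by (simp add: if_distrib[of "\<lambda>y. y * _"] cong: if_cong)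
  qed
  have MQ: "(M * mat_adjoint Q) $$ (i, j) = M $$ (i, j) * cnj (\<mu> (f j))" if "M \<in> carrier_mat n n" "i < n" "j < n" for M i j
  proof -
    have "(M * mat_adjoint Q) $$ (i, j) = (\<Sum>k = 0..<n. M $$ (i, k) * (if k = j then cnj (\<mu> (f k)) else 0))"
      using that Q(2) by (auto simp: scalar_prod_def Qij intro!: sum.cong)
    thus ?thesis using that by (simp add: if_distrib[of "\<lambda>y. _ * y"] cong: if_cong)
  qed
  have "gauss_unitary n Q" unfolding gauss_unitary_def
  proof (intro conjI)
    show "elements_mat Q \<subseteq> gauss_ints"
      using u gauss_units_subset_ints by (auto simp: Q_def gauss_ints_def dest!: elements_matD)
    show "Q * mat_adjoint Q = 1\<^sub>m n"
    proof (rule eq_matI)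
      fix i j assume "i < dim_row (1\<^sub>m n :: complex mat)" "j < dim_col (1\<^sub>m n :: complex mat)"
      hence ij: "i < n" "j < n" by auto
      show "(Q * mat_adjoint Q) $$ (i, j) = 1\<^sub>m n $$ (i, j)"
        unfolding QM[OF Q(2) ij] using ij u[OF ij(1)] u[OF ij(2)] by (simp add: Qij)
    qed (use Q in auto)
    show "mat_adjoint Q * Q = 1\<^sub>m n"
    proof (rule eq_matI)
      fix i j assume "i < dim_row (1\<^sub>m n :: complex mat)" "j < dim_col (1\<^sub>m n :: complex mat)"
      hence ij: "i < n" "j < n" by auto
      have "(mat_adjoint Q * Q) $$ (i, j) = (\<Sum>k = 0..<n. (if i = k then cnj (\<mu> (f i)) else 0) * Q $$ (k, j))"
        using ij Q(1,2) by (auto simp: scalar_prod_def Qij intro!: sum.cong)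
      also have "\<dots> = cnj (\<mu> (f i)) * Q $$ (i, j)"
        using ij by (simp add: if_distrib[of "\<lambda>y. y * _"] cong: if_cong)
      finally show "(mat_adjoint Q * Q) $$ (i, j) = 1\<^sub>m n $$ (i, j)" using ij u[OF ij(1)] u[OF ij(2)] by (simp add: Qij)
    qed (use Q in auto)
  qed (rule Q)
  moreover have "A = 1 \<cdot>\<^sub>m map_mat id (Q * B * mat_adjoint Q)"
  proof (rule eq_matI)
    fix i j assume "i < dim_row (1 \<cdot>\<^sub>m map_mat id (Q * B * mat_adjoint Q))"
      "j < dim_col (1 \<cdot>\<^sub>m map_mat id (Q * B * mat_adjoint Q))"
    hence ij: "i < n" "j < n" using Q by auto
    have QB: "Q * B \<in> carrier_mat n n" using Q by simp
    have "(1 \<cdot>\<^sub>m map_mat id (Q * B * mat_adjoint Q)) $$ (i, j) = (Q * B * mat_adjoint Q) $$ (i, j)"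
      using ij Q by (simp del: index_mult_mat(1))
    also have "\<dots> = A $$ (i, j)"
      unfolding MQ[OF QB ij] QM[OF Q(3) ij] Aij[OF ij] using ij by (simp add: B_def)
    finally show "A $$ (i, j) = (1 \<cdot>\<^sub>m map_mat id (Q * B * mat_adjoint Q)) $$ (i, j)" by (rule sym)
  qed (use A(1) Q in auto)
  ultimately have "equivalent_mat A B"
    unfolding equivalent_mat_def using A Q(3) BZ by blast
  moreover have "is_adjacency_mat T W B"
    unfolding is_adjacency_mat_def card B_def using f by blast
  ultimately show ?thesis by blast
qed

theorem theorem3p1:
  fixes A :: "complex mat"
  assumes "maximal_indecomposable_cyclotomic A"
    and "\<forall>v < dim_row A. A $$ (v, v) = 0"
    and "\<forall>x \<in> elements_mat A. x \<noteq> 0 \<longrightarrow> x \<in> gauss_units"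
  shows "\<exists>B. equivalent_mat A B \<and>
           ((\<exists>k\<ge>3. is_adjacency_mat (T_verts k) (T_weight k) B) \<or>
            (\<exists>k\<ge>3. is_adjacency_mat (Ti_verts k) (Ti_weight k) B) \<or>
            is_adjacency_mat UNIV S8_weight B \<or>
            is_adjacency_mat (ON_verts 7) S14_weight B \<or>
            is_adjacency_mat (ON_verts 8) S16_weight B)"
proof -
  interpret maximal_graph "{0..<dim_row A}" "\<lambda>i j. if i < dim_row A \<and> j < dim_row A then A $$ (i, j) else 0"
    by (rule maximal_graph_of_mat[OF assms])
  interpret weighing_graph "{0..<dim_row A}" "\<lambda>i j. if i < dim_row A \<and> j < dim_row A then A $$ (i, j) else 0"
    by (rule weighing)
  have "cyclotomic_mat A" using assms(1) by (simp add: maximal_indecomposable_cyclotomic_def)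
  hence "elements_mat A \<subseteq> gauss_ints" unfolding cyclotomic_mat_def by (elim conjE)
  note rep = equivalent_of_represents[OF cyclotomic_mat_D(2)[OF \<open>cyclotomic_mat A\<close>] this]
  from classification consider
      k where "k \<ge> 3" "represents {0..<dim_row A} (\<lambda>i j. if i < dim_row A \<and> j < dim_row A then A $$ (i, j) else 0) (T_verts k) (T_weight k)"
    | k where "k \<ge> 3" "represents {0..<dim_row A} (\<lambda>i j. if i < dim_row A \<and> j < dim_row A then A $$ (i, j) else 0) (Ti_verts k) (Ti_weight k)"
    | "represents {0..<dim_row A} (\<lambda>i j. if i < dim_row A \<and> j < dim_row A then A $$ (i, j) else 0) UNIV S8_weight"
    | "represents {0..<dim_row A} (\<lambda>i j. if i < dim_row A \<and> j < dim_row A then A $$ (i, j) else 0) (ON_verts 7) S14_weight"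
    | "represents {0..<dim_row A} (\<lambda>i j. if i < dim_row A \<and> j < dim_row A then A $$ (i, j) else 0) (ON_verts 8) S16_weight"
    by blast
  thus ?thesis
  proof cases
    case 1
    show ?thesis using rep[OF 1(2)] 1(1) by blast
  next
    case 2
    show ?thesis using rep[OF 2(2)] 2(1) by blast
  next
    case 3
    show ?thesis using rep[OF 3] by blast
  next
    case 4
    show ?thesis using rep[OF 4] by blast
  next
    case 5
    show ?thesis using rep[OF 5] by blast
  qed
qed

end
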